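(* For every positive real number $\alpha$ there exists a positive integer $k$, depending only on $\alpha$, such that the following holds. Let $n\geq 5$ be odd, let $G=A_n$ be the alternating group on $n$ letters, let $C$ be a conjugacy class of $G$ consisting of $n$-cycles, and suppose that $S\subset G$ is such that $S\cap C\neq\emptyset$ and $$|S|\geq\left(\frac{1}{\frac12 n(n-3)}\right)^{1-\alpha}|G|.$$ Then $G=(S\cup S^{-1})^k$.
   Context: For a subset $B$ of a group and a positive integer $k$, $B^k=\{b_1b_2\cdots b_k \mid b_1,\dots,b_k\in B\}$, and $S^{-1}=\{s^{-1}\mid s\in S\}$. *)

theory Defs
  imports Complex_Main "HOL-Algebra.Algebra"
begin

definition conjugacy_class :: "('a, 'b) monoid_scheme \<Rightarrow> 'a \<Rightarrow> 'a set"
  where "conjugacy_class G x = {g \<otimes>\<^bsub>G\<^esub> x \<otimes>\<^bsub>G\<^esub> inv\<^bsub>G\<^esub> g | g. g \<in> carrier G}"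

definition conjugacy_classes :: "('a, 'b) monoid_scheme \<Rightarrow> 'a set set"
  where "conjugacy_classes G = conjugacy_class G ` carrier G"

text \<open>\<open>set_power G B k\<close> is the set of all products of \<open>k\<close> factors taken from \<open>B\<close>, repetitions
  allowed.\<close>

definition set_power :: "('a, 'b) monoid_scheme \<Rightarrow> 'a set \<Rightarrow> nat \<Rightarrow> 'a set"
  where "set_power G B k =
    {foldr (\<otimes>\<^bsub>G\<^esub>) bs \<one>\<^bsub>G\<^esub> | bs. length bs = k \<and> set bs \<subseteq> B}"

text \<open>The library's predicate \<^term>\<open>cycle\<close> only says that a list is distinct; the permutation it
  denotes is \<^term>\<open>cycle_of_list cs\<close>.\<close>

definition is_cycle_of_length :: "nat \<Rightarrow> ('a \<Rightarrow> 'a) \<Rightarrow> bool"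
  where "is_cycle_of_length m p \<longleftrightarrow> (\<exists>cs. cycle cs \<and> length cs = m \<and> p = cycle_of_list cs)"

end

theory Submission
  imports Defs "HOL-Analysis.Convex"
begin

text \<open>Let \<open>V\<close> be the space of functions on \<open>A_n\<close> orthogonal to the trivial and the standard
  representation. If \<open>M\<close> right translates of \<open>f\<close> are mutually orthogonal, then Bessel's inequality
  gives \<open>M |v * f|^2 \<le> |G| |v|^2 |f|^2\<close>. Every element of \<open>V\<close> is a sum of common eigenfunctions of
  commuting double transpositions with many orthogonal translates, so on \<open>V\<close> convolution with the
  uniform measure on \<open>S\<close> contracts the squared norm by a factor of order \<open>|G| / (n^2 |S|)\<close>, which
  the hypothesis makes a negative power of \<open>n\<close>. The standard representation has no nonzero vector
  fixed by an \<open>n\<close>-cycle \<open>c \<in> S\<close>, hence for large \<open>n\<close> almost all \<open>x\<close> lie in \<open>S^(j+1) \<langle>c\<rangle>\<close>, and then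
  almost all conjugates \<open>x c x^-1\<close> lie in a bounded power of \<open>B = S \<union> S^-1\<close>. A few random
  conjugates of \<open>c\<close> multiply to a distribution covering more than half of the group, which suffices.

  For the finitely many remaining \<open>n\<close> it is enough to see that the union of the even powers of \<open>B\<close>,
  a subgroup \<open>H\<close> containing \<open>S\<close>, is all of \<open>A_n\<close>. If a set of permutations has all its quotients
  outside \<open>H\<close>, its elements lie in distinct cosets, so that it is smaller than \<open>n (n - 3) / 2\<close>.
  Applied to explicit sets this makes \<open>H\<close> doubly transitive and, in the absence of 3-cycles, triply
  transitive; but triple transitivity yields a 3-cycle as a commutator (for \<open>n = 7\<close> it makes \<open>H\<close> too
  large instead). The conjugates of a 3-cycle in \<open>H\<close> generate \<open>A_n\<close>.\<close>

section \<open>Convolution on a finite permutation group\<close>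

text \<open>In general \<open>n (n - 3) / 2\<close> is the degree of the smallest irreducible
  representation of A_n beyond the trivial and the standard one. No character theory enters: the
  number of orthogonal translates replaces the degree. About \<open>n/2\<close> disjoint blocks give
  about \<open>n^2/8\<close> translates, a loss by a constant factor that confines the analytic
  argument to large n. For small n only the strict inequality
  \<open>|S| > |G| / (n (n - 3) / 2)\<close> remains. The standard representation must be left out
  of the contraction: for small \<alpha> all but one of the elements of S may lie in a point
  stabilizer, and then convolution with S hardly contracts there. The second obstacle is that a
  bound \<open>|v * f|^2 \<le> L |f|^2\<close> does not pass to sums of functions that are not
  orthogonal, and a function in V is only known to be a sum of good ones. The bound is therefore
  first weakened to a growth rate under iterates of a positive operator. Growth rates do pass to
  sums, and log-convexity recovers the bound from them.\<close>

lemma log_convex_ratio_le: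
  fixes a :: "nat \<Rightarrow> real"
  assumes nonneg: "\<And>j. a j \<ge> 0"
    and conv: "\<And>j. (a (Suc j))\<^sup>2 \<le> a j * a (Suc (Suc j))"
    and bound: "\<And>j. a j \<le> C * L ^ j" and L: "L \<ge> 0"
  shows "a 1 \<le> L * a 0"
proof (rule ccontr)
  assume "\<not> a 1 \<le> L * a 0"
  hence gt: "a 1 > L * a 0" by simp
  have a1: "a 1 > 0" using gt nonneg[of 0] L by (smt (verit) mult_nonneg_nonneg)
  have a0: "a 0 > 0"
  proof (rule ccontr)
    assume "\<not> a 0 > 0"
    hence "a 0 = 0" using nonneg[of 0] by simp
    hence "(a 1)\<^sup>2 \<le> 0" using conv[of 0] by simp
    thus False using a1 by simp
  qed
  define q where "q = a 1 / a 0"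
  have q: "q > L" "q > 0" using gt a0 a1 by (auto simp: q_def field_simps)
  \<comment> \<open>Log-convexity makes successive ratios nondecreasing, so none falls below the
    first ratio \<open>q\<close>; geometric growth at rate \<open>q > L\<close> then contradicts
    \<open>bound\<close>.\<close>
  have step: "a (Suc j) \<ge> q * a j \<and> a j > 0" for j
  proof (induction j)
    case 0 thus ?case using a0 by (simp add: q_def)
  next
    case (Suc j)
    have pos: "a (Suc j) > 0" using Suc q by (smt (verit) mult_pos_pos)
    have "q * a (Suc j) * a j \<le> a (Suc j) * a (Suc j)"
      using Suc pos by (simp add: mult.commute mult.left_commute)
    also have "\<dots> \<le> a (Suc (Suc j)) * a j" using conv[of j] by (simp add: power2_eq_square mult.commute)
    finally have "q * a (Suc j) \<le> a (Suc (Suc j))" using Suc by simp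
    thus ?case using pos by simp
  qed
  have lower: "a j \<ge> q ^ j * a 0" for j
  proof (induction j)
    case (Suc j)
    have "q ^ Suc j * a 0 = q * (q ^ j * a 0)" by simp
    also have "\<dots> \<le> q * a j" using Suc q by (intro mult_left_mono) auto
    also have "\<dots> \<le> a (Suc j)" using step by blast
    finally show ?case .
  qed simp
  show False
  proof (cases "L = 0")
    case True
    thus ?thesis using bound[of 1] a1 by simp
  next
    case False
    hence Lp: "L > 0" using L by simp
    obtain j where j: "C / a 0 < (q / L) ^ j"
      using real_arch_pow[of "q / L" "C / a 0"] q Lp by auto
    have "q ^ j * a 0 \<le> C * L ^ j" using lower[of j] bound[of j] by linarith
    hence "(q / L) ^ j \<le> C / a 0" using a0 Lp by (simp add: power_divide field_simps)
    thus False using j by simp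
  qed
qed

text \<open>The elements are actual maps under \<open>\<circ>\<close> rather than members of a group
  record, because the argument constantly evaluates them at points.\<close>

locale fin_perm_group =
  fixes G :: "('b \<Rightarrow> 'b) set"
  assumes finite_G: "finite G" and id_G: "id \<in> G"
    and comp_G: "p \<in> G \<Longrightarrow> q \<in> G \<Longrightarrow> p \<circ> q \<in> G"
    and inv_G: "p \<in> G \<Longrightarrow> inv' p \<in> G"
    and bij_G: "p \<in> G \<Longrightarrow> bij p"
begin

lemma inv_comp: "p \<in> G \<Longrightarrow> inv' p \<circ> p = id" "p \<in> G \<Longrightarrow> p \<circ> inv' p = id"
  using bij_G by (auto simp: fun_eq_iff bij_is_inj bij_is_surj surj_f_inv_f)

lemma inv_comp_apply: "p \<in> G \<Longrightarrow> inv' p (p i) = i" "p \<in> G \<Longrightarrow> p (inv' p i) = i"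
  using bij_G by (auto simp: bij_is_inj bij_is_surj surj_f_inv_f)

lemma inv_comp_cancel: "p \<in> G \<Longrightarrow> inv' p \<circ> (p \<circ> x) = x" "p \<in> G \<Longrightarrow> p \<circ> (inv' p \<circ> x) = x"
  by (simp_all add: fun_eq_iff inv_comp_apply)

lemma inv_inv: "p \<in> G \<Longrightarrow> inv' (inv' p) = p"
  using bij_G by (simp add: inv_inv_eq)

lemma inv_of_comp: "p \<in> G \<Longrightarrow> q \<in> G \<Longrightarrow> inv' (p \<circ> q) = inv' q \<circ> inv' p"
  using bij_G by (simp add: o_inv_distrib)

lemma card_G_pos: "card G > 0"
  using finite_G id_G by (auto simp: card_gt_0_iff)

lemma sum_right: "g \<in> G \<Longrightarrow> (\<Sum>x\<in>G. F (x \<circ> g)) = (\<Sum>x\<in>G. F x)"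
  by (rule sum.reindex_bij_witness[where i = "\<lambda>x. x \<circ> inv' g" and j = "\<lambda>x. x \<circ> g"])
    (auto simp: comp_assoc inv_comp inv_G comp_G)

lemma sum_left: "g \<in> G \<Longrightarrow> (\<Sum>x\<in>G. F (g \<circ> x)) = (\<Sum>x\<in>G. F x)"
  by (rule sum.reindex_bij_witness[where i = "\<lambda>x. inv' g \<circ> x" and j = "\<lambda>x. g \<circ> x"])
    (auto simp: inv_comp_cancel inv_G comp_G)

lemma sum_inv: "(\<Sum>x\<in>G. F (inv' x)) = (\<Sum>x\<in>G. F x)"
  by (rule sum.reindex_bij_witness[where i = "\<lambda>x. inv' x" and j = "\<lambda>x. inv' x"])
    (auto simp: inv_inv inv_G)

section \<open>Inner product, norm and convolution of functions on the group\<close>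

definition ip :: "(('b \<Rightarrow> 'b) \<Rightarrow> real) \<Rightarrow> (('b \<Rightarrow> 'b) \<Rightarrow> real) \<Rightarrow> real"
  where "ip f h = (\<Sum>x\<in>G. f x * h x)"

definition nsq :: "(('b \<Rightarrow> 'b) \<Rightarrow> real) \<Rightarrow> real"
  where "nsq f = (\<Sum>x\<in>G. (f x)\<^sup>2)"

definition conv :: "(('b \<Rightarrow> 'b) \<Rightarrow> real) \<Rightarrow> (('b \<Rightarrow> 'b) \<Rightarrow> real) \<Rightarrow> ('b \<Rightarrow> 'b) \<Rightarrow> real"
  where "conv v f x = (\<Sum>y\<in>G. v y * f (inv' y \<circ> x))"

lemma nsq_nonneg: "nsq f \<ge> 0" by (simp add: nsq_def sum_nonneg)

lemma ip_self: "ip f f = nsq f" by (simp add: nsq_def ip_def power2_eq_square)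

lemma ip_commute: "ip f h = ip h f" by (simp add: ip_def mult.commute)

lemma ip_add: "ip (\<lambda>x. a x + b x) h = ip a h + ip b h"
  by (simp add: ip_def distrib_right sum.distrib)

lemma ip_diff: "ip (\<lambda>x. a x - b x) h = ip a h - ip b h"
  by (simp add: ip_def left_diff_distrib sum_subtractf)

lemma ip_scale: "ip (\<lambda>x. c * a x) h = c * ip a h"
  by (simp add: ip_def sum_distrib_left mult.assoc)

lemma ip_eq_0: "nsq h = 0 \<Longrightarrow> ip f h = 0"
  using finite_G by (simp add: nsq_def ip_def sum_nonneg_eq_0_iff)

lemma ip_cauchy: "(ip f h)\<^sup>2 \<le> nsq f * nsq h"
  unfolding ip_def nsq_def by (rule Cauchy_Schwarz_ineq_sum)

lemma nsq_add_le: "nsq (\<lambda>x. a x + b x) \<le> 2 * nsq a + 2 * nsq b"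
proof -
  have "(a x + b x)\<^sup>2 \<le> 2 * (a x)\<^sup>2 + 2 * (b x)\<^sup>2" for x
    using sum_squares_bound[of "a x" "b x"] by (simp add: power2_sum)
  hence "nsq (\<lambda>x. a x + b x) \<le> (\<Sum>x\<in>G. 2 * (a x)\<^sup>2 + 2 * (b x)\<^sup>2)"
    unfolding nsq_def by (intro sum_mono) auto
  thus ?thesis by (simp add: nsq_def sum.distrib sum_distrib_left)
qed

lemma nsq_scale: "nsq (\<lambda>x. c * a x) = c\<^sup>2 * nsq a"
  by (simp add: nsq_def power_mult_distrib sum_distrib_left)

lemma nsq_right: "g \<in> G \<Longrightarrow> nsq (\<lambda>x. f (x \<circ> g)) = nsq f"
  unfolding nsq_def by (rule sum_right)

lemma nsq_inv: "nsq (\<lambda>x. f (inv' x)) = nsq f"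
  unfolding nsq_def by (rule sum_inv)

text \<open>Convolution acts from the left and so commutes with right translations. This is why
  eigenfunctions, orthogonal translates and averages over the cycle are all taken on the
  right.\<close>

lemma conv_right: "conv v (\<lambda>x. f (x \<circ> g)) x = conv v f (x \<circ> g)"
  by (simp add: conv_def comp_assoc)

lemma conv_add: "conv v (\<lambda>x. a x + b x) = (\<lambda>x. conv v a x + conv v b x)"
  by (simp add: conv_def fun_eq_iff distrib_left sum.distrib)

lemma conv_scale: "conv v (\<lambda>x. c * a x) = (\<lambda>x. c * conv v a x)"
  by (simp add: conv_def fun_eq_iff sum_distrib_left mult.left_commute)

lemma conv_cong: "(\<And>x. x \<in> G \<Longrightarrow> f x = h x) \<Longrightarrow> x \<in> G \<Longrightarrow> conv v f x = conv v h x"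
  unfolding conv_def by (intro sum.cong) (auto simp: comp_G inv_G)

lemma conv_alt:
  assumes "x \<in> G" shows "conv v f x = (\<Sum>z\<in>G. v (x \<circ> inv' z) * f z)"
  unfolding conv_def
  by (rule sum.reindex_bij_witness[where i = "\<lambda>z. x \<circ> inv' z" and j = "\<lambda>y. inv' y \<circ> x"])
    (use assms in \<open>auto simp: comp_G inv_G inv_of_comp inv_inv inv_comp inv_comp_cancel comp_assoc\<close>)

text \<open>The adjoint of convolution by \<open>v\<close> is convolution by \<open>v\<close>
  reflected under inversion, a function of the same norm.\<close>

lemma ip_conv: "ip (conv v f) h = ip f (conv (\<lambda>y. v (inv' y)) h)"
proof -
  have "ip (conv v f) h = (\<Sum>x\<in>G. \<Sum>z\<in>G. v (x \<circ> inv' z) * f z * h x)"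
    unfolding ip_def by (intro sum.cong refl) (simp add: conv_alt sum_distrib_right)
  also have "\<dots> = (\<Sum>z\<in>G. \<Sum>x\<in>G. v (x \<circ> inv' z) * f z * h x)" by (rule sum.swap)
  also have "\<dots> = (\<Sum>z\<in>G. f z * (\<Sum>x\<in>G. v (inv' (z \<circ> inv' x)) * h x))"
    by (intro sum.cong refl) (simp add: sum_distrib_left inv_of_comp inv_G inv_inv mult_ac)
  also have "\<dots> = ip f (conv (\<lambda>y. v (inv' y)) h)"
    unfolding ip_def by (intro sum.cong refl) (simp add: conv_alt)
  finally show ?thesis .
qed

lemma sum_conv: "(\<Sum>x\<in>G. conv v f x) = (\<Sum>y\<in>G. v y) * (\<Sum>x\<in>G. f x)"
proof -
  have "(\<Sum>x\<in>G. conv v f x) = (\<Sum>y\<in>G. \<Sum>x\<in>G. v y * f (inv' y \<circ> x))"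
    unfolding conv_def by (rule sum.swap)
  also have "\<dots> = (\<Sum>y\<in>G. v y * (\<Sum>x\<in>G. f x))"
    by (intro sum.cong refl) (simp add: sum_distrib_left[symmetric] sum_left inv_G)
  finally show ?thesis by (simp add: sum_distrib_right)
qed

text \<open>The squared distance from \<open>v\<close> to its projection \<open>s\<close> onto the
  span is nonnegative. The functions are not normalized, since they will be translates of one
  function; their common squared norm \<open>N\<close> may be 0, and this case is split off.\<close>

lemma bessel:
  assumes "finite I" and orth: "\<And>i j. i \<in> I \<Longrightarrow> j \<in> I \<Longrightarrow> i \<noteq> j \<Longrightarrow> ip (f i) (f j) = 0"
    and norm: "\<And>i. i \<in> I \<Longrightarrow> nsq (f i) = N" and "N \<ge> 0"
  shows "(\<Sum>i\<in>I. (ip v (f i))\<^sup>2) \<le> N * nsq v"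
proof (cases "N = 0")
  case True
  thus ?thesis using norm by (simp add: ip_eq_0)
next
  case False
  hence N: "N > 0" using \<open>N \<ge> 0\<close> by simp
  define c where "c i = ip v (f i) / N" for i
  define s where "s x = (\<Sum>i\<in>I. c i * f i x)" for x
  define Q where "Q = (\<Sum>i\<in>I. (ip v (f i))\<^sup>2)"
  have ip_s: "ip h s = (\<Sum>i\<in>I. c i * ip h (f i))" for h
    unfolding ip_def s_def sum_distrib_left by (subst sum.swap) (simp add: mult_ac)
  have vs: "ip v s = Q / N"
    unfolding ip_s c_def Q_def by (simp add: sum_divide_distrib power2_eq_square)
  have fs: "ip (f i) s = ip v (f i)" if "i \<in> I" for i
  proof -
    have "ip (f i) s = (\<Sum>j\<in>I. if j = i then c i * N else 0)"
      unfolding ip_s by (intro sum.cong refl) (use that orth norm in \<open>auto simp: ip_self\<close>)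
    also have "\<dots> = c i * N" using that \<open>finite I\<close> by simp
    finally show ?thesis using N by (simp add: c_def)
  qed
  have "ip s s = (\<Sum>i\<in>I. c i * ip v (f i))"
    unfolding ip_s[of s] by (intro sum.cong refl) (simp add: fs ip_commute[of s])
  also have "\<dots> = Q / N"
    unfolding c_def Q_def by (simp add: sum_divide_distrib power2_eq_square)
  finally have ss: "ip s s = Q / N" .
  have "0 \<le> ip (\<lambda>x. v x - s x) (\<lambda>x. v x - s x)" by (simp add: ip_self nsq_nonneg)
  also have "\<dots> = nsq v - Q / N"
    by (simp add: ip_diff ip_commute[of _ "\<lambda>x. v x - s x"] vs ss ip_self[symmetric] ip_commute[of s v])
  finally show ?thesis using N by (simp add: Q_def field_simps)
qed

text \<open>The value of \<open>conv v f\<close> at \<open>x\<close> is the inner product of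
  \<open>f\<close> with a reflected translate of \<open>v\<close>. The convolutions of all
  translates of \<open>f\<close> have the same norm, so summing over \<open>I\<close> and applying
  Bessel for each \<open>x\<close> gains the factor \<open>card I\<close>; the sum over
  \<open>x\<close> costs \<open>card G\<close>.\<close>

lemma nsq_conv_orth_translates:
  assumes "finite I" and g: "\<And>i. i \<in> I \<Longrightarrow> g i \<in> G"
    and orth: "\<And>i j. i \<in> I \<Longrightarrow> j \<in> I \<Longrightarrow> i \<noteq> j \<Longrightarrow> ip (\<lambda>x. f (x \<circ> g i)) (\<lambda>x. f (x \<circ> g j)) = 0"
  shows "real (card I) * nsq (conv v f) \<le> real (card G) * nsq v * nsq f"
proof -
  define F where "F i x = f (x \<circ> g i)" for i x
  have "nsq (conv v (F i)) = nsq (conv v f)" if "i \<in> I" for i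
  proof -
    have "conv v (F i) = (\<lambda>x. conv v f (x \<circ> g i))" 
      using conv_right[of v f "g i"] by (simp add: F_def[abs_def] fun_eq_iff)
    thus ?thesis by (simp add: nsq_right[OF g[OF that]])
  qed
  hence "real (card I) * nsq (conv v f) = (\<Sum>i\<in>I. nsq (conv v (F i)))" by simp
  also have "\<dots> = (\<Sum>x\<in>G. \<Sum>i\<in>I. (ip (\<lambda>z. v (x \<circ> inv' z)) (F i))\<^sup>2)"
    unfolding nsq_def by (subst sum.swap) (simp add: conv_alt ip_def)
  also have "\<dots> \<le> (\<Sum>x\<in>G. nsq f * nsq (\<lambda>z. v (x \<circ> inv' z)))"
    by (intro sum_mono bessel) (use assms in \<open>auto simp: F_def[abs_def] nsq_right nsq_nonneg\<close>)
  also have "\<dots> = (\<Sum>x\<in>G. nsq f * nsq v)"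
  proof (intro sum.cong refl)
    fix x assume "x \<in> G"
    have "nsq (\<lambda>z. v (x \<circ> inv' z)) = nsq (\<lambda>z. v (x \<circ> z))"
      using nsq_inv[of "\<lambda>z. v (x \<circ> z)"] by simp
    also have "\<dots> = nsq v" unfolding nsq_def by (rule sum_left[OF \<open>x \<in> G\<close>])
    finally show "nsq f * nsq (\<lambda>z. v (x \<circ> inv' z)) = nsq f * nsq v" by simp
  qed
  finally show ?thesis by (simp add: mult_ac)
qed

text \<open>The positive operator \<open>A^* A\<close>, where \<open>A\<close> is convolution by
  \<open>v\<close>.\<close>

definition gram :: "(('b \<Rightarrow> 'b) \<Rightarrow> real) \<Rightarrow> (('b \<Rightarrow> 'b) \<Rightarrow> real) \<Rightarrow> ('b \<Rightarrow> 'b) \<Rightarrow> real"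
  where "gram v f = conv (\<lambda>y. v (inv' y)) (conv v f)"

text \<open>A growth rate: the iterates of \<open>gram v\<close> on \<open>f\<close> have norm
  \<open>O(L^j)\<close>, with a constant that may depend on \<open>f\<close>. This freedom is what
  makes the tame functions a subspace.\<close>

definition tame :: "(('b \<Rightarrow> 'b) \<Rightarrow> real) \<Rightarrow> real \<Rightarrow> (('b \<Rightarrow> 'b) \<Rightarrow> real) \<Rightarrow> bool"
  where "tame v L f \<longleftrightarrow> (\<exists>C. \<forall>j. nsq ((gram v ^^ j) f) \<le> C * (L ^ j)\<^sup>2)"

lemma ip_gram: "ip (gram v f) h = ip (conv v f) (conv v h)"
proof -
  have "ip (gram v f) h = ip h (gram v f)" by (rule ip_commute)
  also have "\<dots> = ip (conv v h) (conv v f)" unfolding gram_def by (rule ip_conv[symmetric])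
  finally show ?thesis by (simp add: ip_commute)
qed

lemma gram_pow_add: "(gram v ^^ j) (\<lambda>x. a x + b x) = (\<lambda>x. (gram v ^^ j) a x + (gram v ^^ j) b x)"
  by (induction j) (simp_all add: gram_def conv_add)

lemma gram_pow_scale: "(gram v ^^ j) (\<lambda>x. c * a x) = (\<lambda>x. c * (gram v ^^ j) a x)"
  by (induction j) (simp_all add: gram_def conv_scale)

lemma tame_add: assumes "tame v L a" "tame v L b" shows "tame v L (\<lambda>x. a x + b x)"
proof -
  obtain C D where C: "\<And>j. nsq ((gram v ^^ j) a) \<le> C * (L ^ j)\<^sup>2"
    and D: "\<And>j. nsq ((gram v ^^ j) b) \<le> D * (L ^ j)\<^sup>2"
    using assms unfolding tame_def by auto
  have "nsq ((gram v ^^ j) (\<lambda>x. a x + b x)) \<le> (2 * C + 2 * D) * (L ^ j)\<^sup>2" for j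
    unfolding gram_pow_add
    using nsq_add_le[of "(gram v ^^ j) a" "(gram v ^^ j) b"] C[of j] D[of j]
    by (simp add: distrib_right)
  thus ?thesis unfolding tame_def by blast
qed

lemma tame_scale: assumes "tame v L a" shows "tame v L (\<lambda>x. c * a x)"
proof -
  obtain C where C: "\<And>j. nsq ((gram v ^^ j) a) \<le> C * (L ^ j)\<^sup>2"
    using assms unfolding tame_def by auto
  have "nsq ((gram v ^^ j) (\<lambda>x. c * a x)) \<le> (c\<^sup>2 * C) * (L ^ j)\<^sup>2" for j
    unfolding gram_pow_scale nsq_scale using C[of j] by (simp add: mult_left_mono mult.assoc)
  thus ?thesis unfolding tame_def by blast
qed

text \<open>One application of \<open>gram\<close> consists of two convolutions, by \<open>v\<close>
  and by its reflection. The bound is therefore required for every \<open>u\<close> with the norm of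
  \<open>v\<close>, and it is used twice, whence \<open>L^2\<close>.\<close>

lemma tame_invariant_class:
  assumes P: "\<And>v h. P h \<Longrightarrow> P (conv v h)" and "P f" and "L \<ge> 0"
    and bound: "\<And>u h. nsq u = nsq v \<Longrightarrow> P h \<Longrightarrow> nsq (conv u h) \<le> L * nsq h"
  shows "tame v L f"
proof -
  have step: "nsq (gram v h) \<le> L\<^sup>2 * nsq h" if "P h" for h
  proof -
    have "nsq (gram v h) \<le> L * nsq (conv v h)"
      unfolding gram_def by (rule bound) (use P that in \<open>auto simp: nsq_inv\<close>)
    also have "\<dots> \<le> L * (L * nsq h)" by (intro mult_left_mono bound) (use that \<open>L \<ge> 0\<close> in auto)
    finally show ?thesis by (simp add: power2_eq_square mult.assoc)
  qed
  have "nsq ((gram v ^^ j) f) \<le> nsq f * (L ^ j)\<^sup>2 \<and> P ((gram v ^^ j) f)" for j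
  proof (induction j)
    case 0 thus ?case using \<open>P f\<close> by simp
  next
    case (Suc j)
    have "nsq (gram v ((gram v ^^ j) f)) \<le> L\<^sup>2 * nsq ((gram v ^^ j) f)"
      by (rule step) (use Suc in auto)
    also have "\<dots> \<le> L\<^sup>2 * (nsq f * (L ^ j)\<^sup>2)" by (intro mult_left_mono) (use Suc in auto)
    finally have "nsq ((gram v ^^ Suc j) f) \<le> nsq f * (L ^ Suc j)\<^sup>2"
      by (simp add: power_mult_distrib mult_ac)
    moreover have "P (gram v h)" if "P h" for h unfolding gram_def by (intro P that)
    ultimately show ?case using Suc by simp
  qed
  thus ?thesis unfolding tame_def by blast
qed

text \<open>The norms of \<open>(gram v ^^ j) f\<close> are log-convex in \<open>j\<close>, so that their rate of growth bounds the
  first ratio.\<close>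

lemma nsq_conv_tame:
  assumes "tame v L f" "L \<ge> 0"
  shows "nsq (conv v f) \<le> L * nsq f"
proof -
  define a where "a j = sqrt (nsq ((gram v ^^ j) f))" for j
  obtain C where C: "\<And>j. nsq ((gram v ^^ j) f) \<le> C * (L ^ j)\<^sup>2"
    using assms unfolding tame_def by auto
  have "C * (L ^ 0)\<^sup>2 \<ge> 0" using C[of 0] nsq_nonneg order_trans by blast
  hence C0: "C \<ge> 0" by simp
  have a1: "a 1 \<le> L * a 0"
  proof (rule log_convex_ratio_le[where C = "sqrt C"])
    show "a j \<ge> 0" for j by (simp add: a_def nsq_nonneg)
    show "a j \<le> sqrt C * L ^ j" for j
    proof -
      have "a j \<le> sqrt (C * (L ^ j)\<^sup>2)" unfolding a_def by (rule real_sqrt_le_mono[OF C])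
      also have "\<dots> = sqrt C * L ^ j" using \<open>L \<ge> 0\<close> by (simp add: real_sqrt_mult)
      finally show ?thesis .
    qed
    \<comment> \<open>Self-adjointness moves one factor across, \<open>|T h|^2 = <T^2 h, h>\<close>
      with \<open>T = gram v\<close>, and Cauchy-Schwarz gives log-convexity.\<close>
    show "(a (Suc j))\<^sup>2 \<le> a j * a (Suc (Suc j))" for j
    proof -
      define h where "h = (gram v ^^ j) f"
      have "nsq (gram v h) = ip (gram v h) (gram v h)" by (simp add: ip_self)
      also have "\<dots> = ip (gram v (gram v h)) h"
        by (simp add: ip_gram ip_commute[of "gram v h"] ip_commute[of "conv v h"])
      finally have eq: "nsq (gram v h) = ip (gram v (gram v h)) h" .
      have "nsq (gram v h) \<le> sqrt (nsq (gram v (gram v h)) * nsq h)"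
        unfolding eq by (rule real_le_rsqrt) (rule ip_cauchy)
      thus ?thesis by (simp add: a_def h_def nsq_nonneg real_sqrt_mult mult.commute)
    qed
    show "L \<ge> 0" by fact
  qed
  have "nsq (conv v f) = ip (gram v f) f" by (simp add: ip_gram ip_self)
  also have "\<dots> \<le> sqrt (nsq (gram v f) * nsq f)" by (rule real_le_rsqrt) (rule ip_cauchy)
  also have "\<dots> = a 1 * a 0" by (simp add: a_def real_sqrt_mult)
  also have "\<dots> \<le> L * a 0 * a 0" by (intro mult_right_mono a1) (simp add: a_def nsq_nonneg)
  also have "\<dots> = L * nsq f" by (simp add: a_def nsq_nonneg)
  finally show ?thesis .
qed

text \<open>Gram-Schmidt by induction on \<open>E\<close>. The second clause expresses in dual form
  that \<open>s\<close> lies in the span of \<open>E\<close>; the induction needs it to see that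
  correcting by the new direction \<open>u\<close> does not spoil the earlier orthogonality
  relations.\<close>

lemma orthogonal_remainder:
  assumes "finite E" "E \<subseteq> W"
    and add: "\<And>a b. a \<in> W \<Longrightarrow> b \<in> W \<Longrightarrow> (\<lambda>x. a x + b x) \<in> W"
    and scale: "\<And>a c. a \<in> W \<Longrightarrow> (\<lambda>x. c * a x) \<in> W"
    and zero: "(\<lambda>x. 0) \<in> W"
  shows "\<exists>s\<in>W. (\<forall>e\<in>E. ip (\<lambda>x. f x - s x) e = 0) \<and>
    (\<forall>h. (\<forall>e\<in>E. ip h e = 0) \<longrightarrow> ip h s = 0)"
  using assms(1,2)
proof (induction E arbitrary: f)
  case empty
  show ?case by (rule bexI[OF _ zero]) (simp add: ip_def)
next
  case (insert e E)
  obtain p where p: "p \<in> W" "\<And>d. d \<in> E \<Longrightarrow> ip (\<lambda>x. e x - p x) d = 0"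
    "\<And>h. (\<forall>d\<in>E. ip h d = 0) \<Longrightarrow> ip h p = 0"
    using insert.IH[of e] insert.prems by blast
  obtain s where s: "s \<in> W" "\<And>d. d \<in> E \<Longrightarrow> ip (\<lambda>x. f x - s x) d = 0"
    "\<And>h. (\<forall>d\<in>E. ip h d = 0) \<Longrightarrow> ip h s = 0"
    using insert.IH[of f] insert.prems by blast
  define u where "u x = e x - p x" for x
  have uW: "u \<in> W"
    using add[OF _ scale[OF p(1), of "-1"], of e] insert.prems by (simp add: u_def[abs_def])
  \<comment> \<open>If \<open>u\<close> has norm 0, then division by zero makes
    \<open>c = 0\<close>, which is right because everything is orthogonal to
    \<open>u\<close>.\<close>
  define c where "c = ip (\<lambda>x. f x - s x) u / nsq u"
  define t where "t x = s x + c * u x" for x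
  have tW: "t \<in> W" unfolding t_def using add s(1) scale uW by blast
  have split: "ip (\<lambda>x. f x - t x) h = ip (\<lambda>x. f x - s x) h - c * ip u h" for h
    by (simp add: t_def ip_diff ip_add ip_scale)
  have u_split: "ip h u = ip h e - ip h p" for h
    unfolding u_def by (subst (1 2 3) ip_commute) (rule ip_diff)
  have orthE: "ip (\<lambda>x. f x - t x) d = 0" if "d \<in> E" for d
    using p(2)[OF that] s(2)[OF that] by (simp add: split u_def[abs_def])
  have "ip (\<lambda>x. f x - t x) u = 0"
  proof (cases "nsq u = 0")
    case True thus ?thesis by (rule ip_eq_0)
  next
    case False
    thus ?thesis by (simp add: split c_def ip_self)
  qed
  moreover have "ip (\<lambda>x. f x - t x) p = 0" using p(3) orthE by blast
  ultimately have orthe: "ip (\<lambda>x. f x - t x) e = 0" by (simp add: u_split)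
  have "ip h t = 0" if h: "\<forall>d\<in>insert e E. ip h d = 0" for h
  proof -
    have "ip h u = 0" using h p(3) by (simp add: u_split)
    moreover have "ip h s = 0" using h s(3) by simp
    ultimately have "ip t h = 0" unfolding t_def by (simp add: ip_add ip_scale ip_commute[of _ h])
    thus ?thesis by (simp add: ip_commute)
  qed
  thus ?case using tW orthE orthe by blast
qed

end

section \<open>Functions orthogonal to the permutation representation\<close>

abbreviation alt :: "nat \<Rightarrow> (nat \<Rightarrow> nat) set" where "alt n \<equiv> carrier (alt_group n)"

lemma fin_perm_group_alt: "fin_perm_group (alt n)"
proof
  have "alt n \<subseteq> {p. p permutes {1..n}}" by (auto simp: alt_group_carrier)
  thus "finite (alt n)" by (rule finite_subset) (simp add: finite_permutations)
  show "id \<in> alt n" by (simp add: alt_group_carrier)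
  show "p \<circ> q \<in> alt n" if "p \<in> alt n" "q \<in> alt n" for p q
    using that by (metis alt_group_carrier alt_group_carrier' evenperm_comp permutes_compose)
  show "inv' p \<in> alt n" if "p \<in> alt n" for p using that by (rule alt_group_inv_closed)
  show "bij p" if "p \<in> alt n" for p using that by (auto simp: alt_group_carrier permutes_bij)
qed

interpretation alt: fin_perm_group "alt n" for n by (rule fin_perm_group_alt)

lemma alt_apply_mem: "p \<in> alt n \<Longrightarrow> i \<in> {1..n} \<Longrightarrow> p i \<in> {1..n}"
  unfolding alt_group_carrier by (metis permutes_in_image)

lemma alt_eq_iff: "p \<in> alt n \<Longrightarrow> p i = p j \<longleftrightarrow> i = j"
  using alt.bij_G bij_is_inj inj_eq by metis

lemma permutes_even_in_alt: "p permutes J \<Longrightarrow> evenperm p \<Longrightarrow> J \<subseteq> {1..n} \<Longrightarrow> p \<in> alt n"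
  by (simp add: alt_group_carrier permutes_subset)

lemma permutes_extend:
  assumes "finite J" "K \<subseteq> J" "inj_on f K" "f ` K \<subseteq> J"
  shows "\<exists>g. g permutes J \<and> (\<forall>k\<in>K. g k = f k)"
proof -
  have fin: "finite K" using assms finite_subset by blast
  have "card (J - K) = card (J - f ` K)"
    using assms fin by (simp add: card_Diff_subset card_image)
  then obtain h where h: "bij_betw h (J - K) (J - f ` K)"
    using finite_same_card_bij[of "J - K" "J - f ` K"] assms(1) by auto
  define g where "g x = (if x \<in> K then f x else if x \<in> J then h x else x)" for x
  have "bij_betw g K (f ` K)"
    using assms(3) by (auto simp: bij_betw_def g_def inj_on_def)
  moreover have "bij_betw g (J - K) (J - f ` K)"
    using h by (subst bij_betw_cong[of _ _ h]) (auto simp: g_def)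
  ultimately have "bij_betw g (K \<union> (J - K)) (f ` K \<union> (J - f ` K))"
    by (intro bij_betw_combine) auto
  moreover have "K \<union> (J - K) = J" "f ` K \<union> (J - f ` K) = J" using assms by auto
  ultimately have "bij_betw g J J" by simp
  hence "g permutes J" by (rule bij_imp_permutes) (use assms(2) in \<open>auto simp: g_def\<close>)
  thus ?thesis by (auto simp: g_def)
qed

text \<open>An extension of the wrong parity is corrected by a transposition of two points of
  \<open>J\<close> outside \<open>K\<close>; the summand 2 in the cardinality condition provides
  them.\<close>

lemma even_permutes_extend:
  assumes "finite J" "K \<subseteq> J" "inj_on f K" "f ` K \<subseteq> J" and card: "card K + 2 \<le> card J"
  shows "\<exists>g. g permutes J \<and> evenperm g \<and> (\<forall>k\<in>K. g k = f k)"
proof -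
  obtain g where g: "g permutes J" "\<forall>k\<in>K. g k = f k" using permutes_extend[OF assms(1-4)] by blast
  show ?thesis
  proof (cases "evenperm g")
    case True thus ?thesis using g by blast
  next
    case False
    have "card (J - K) \<ge> 2" using card assms by (simp add: card_Diff_subset finite_subset)
    then obtain B where "B \<subseteq> J - K" "card B = 2" by (meson obtain_subset_with_card_n)
    then obtain a b where ab: "a \<in> J - K" "b \<in> J - K" "a \<noteq> b" by (auto simp: card_2_iff)
    have tp: "transpose a b permutes J" using ab by (auto intro: permutes_swap_id)
    have "g \<circ> transpose a b permutes J" using permutes_compose[OF tp g(1)] .
    moreover have "evenperm (g \<circ> transpose a b)"
      using False ab g(1) tp assms(1)
      by (subst evenperm_comp) (auto simp: evenperm_swap permutes_imp_permutation)
    moreover have "\<forall>k\<in>K. (g \<circ> transpose a b) k = g k" using ab by (auto simp: transpose_def)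
    ultimately show ?thesis using g(2) by metis
  qed
qed

text \<open>The average over all \<^term>\<open>i' \<noteq> j'\<close> of the four-point identity expresses \<^term>\<open>R i j\<close> by
  \<^term>\<open>R j i\<close> with a coefficient of absolute value greater than 1.\<close>

lemma offdiag_zero:
  fixes R :: "'a \<Rightarrow> 'a \<Rightarrow> real"
  assumes "finite I" "card I \<ge> 4"
    and row: "\<And>i. i \<in> I \<Longrightarrow> (\<Sum>j\<in>I - {i}. R i j) = 0"
    and col: "\<And>j. j \<in> I \<Longrightarrow> (\<Sum>i\<in>I - {j}. R i j) = 0"
    and mix: "\<And>i j i' j'. {i, j, i', j'} \<subseteq> I \<Longrightarrow> distinct [i, j, i', j'] \<Longrightarrow>
      R i j - R i' j - R i j' + R i' j' = 0"
    and "i \<in> I" "j \<in> I" "i \<noteq> j"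
  shows "R i j = 0"
proof -
  define N where "N = real (card I)"
  have N: "N \<ge> 4" using assms(2) by (simp add: N_def)
  have key: "((N - 3) * N + 1) * R i j + R j i = 0" if ij: "i \<in> I" "j \<in> I" "i \<noteq> j" for i j
  proof -
    define I' where "I' = I - {i, j}"
    have fin: "finite I'" using assms(1) by (simp add: I'_def)
    have cI': "real (card I') = N - 2"
      using ij assms(1,2) by (simp add: I'_def N_def card_Diff_subset of_nat_diff)
    have cI'': "real (card (I' - {x})) = N - 3" if "x \<in> I'" for x
      using card_Suc_Diff1[OF fin that] cI' by linarith
    have notin: "i \<notin> I'" "j \<notin> I'" by (auto simp: I'_def)
    have colj: "(\<Sum>x\<in>I'. R x j) = - R i j"
    proof -
      have "I - {j} = insert i I'" using ij by (auto simp: I'_def)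
      thus ?thesis using col[OF ij(2)] fin notin by simp
    qed
    have coli: "(\<Sum>x\<in>I'. R x i) = - R j i"
    proof -
      have "I - {i} = insert j I'" using ij by (auto simp: I'_def)
      thus ?thesis using col[OF ij(1)] fin notin by simp
    qed
    have rowi: "(\<Sum>y\<in>I'. R i y) = - R i j"
    proof -
      have "I - {i} = insert j I'" using ij by (auto simp: I'_def)
      thus ?thesis using row[OF ij(1)] fin notin by simp
    qed
    have rowx: "(\<Sum>y\<in>I' - {x}. R x y) = - R x i - R x j" if "x \<in> I'" for x
    proof -
      have "I - {x} = insert i (insert j (I' - {x}))" using ij that by (auto simp: I'_def)
      moreover have "x \<in> I" using that by (simp add: I'_def)
      ultimately show ?thesis using row[of x] fin notin ij by simp
    qed
    have "(\<Sum>x\<in>I'. \<Sum>y\<in>I' - {x}. R i j - R x j - R i y + R x y) = 0"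
      by (intro sum.neutral ballI mix) (use ij in \<open>auto simp: I'_def\<close>)
    also have "(\<Sum>x\<in>I'. \<Sum>y\<in>I' - {x}. R i j - R x j - R i y + R x y) = (\<Sum>x\<in>I'. (N - 3) * R i j - (N - 3) * R x j - (- R i j - R i x) + (- R x i - R x j))"
    proof (intro sum.cong refl)
      fix x assume x: "x \<in> I'"
      have "(\<Sum>y\<in>I' - {x}. R i y) = - R i j - R i x"
        using rowi x fin by (simp add: sum_diff1)
      moreover have "(\<Sum>y\<in>I' - {x}. R i j - R x j) = (N - 3) * (R i j - R x j)"
        by (simp only: sum_constant cI''[OF x])
      ultimately show "(\<Sum>y\<in>I' - {x}. R i j - R x j - R i y + R x y) =
          (N - 3) * R i j - (N - 3) * R x j - (- R i j - R i x) + (- R x i - R x j)"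
        unfolding sum.distrib sum_subtractf rowx[OF x] by (simp add: right_diff_distrib)
    qed
    also have "\<dots> = (N - 2) * ((N - 3) * R i j) + (N - 3) * R i j + (N - 2) * R i j - R i j + R j i + R i j"
      by (simp add: sum.distrib sum_subtractf sum_negf sum_distrib_left[symmetric] colj coli rowi cI' algebra_simps)
    finally show ?thesis by (simp add: algebra_simps)
  qed
  define k where "k = (N - 3) * N + 1"
  have "(N - 3) * N \<ge> 1 * 4" using N by (intro mult_mono) auto
  hence k: "k \<ge> 5" by (simp add: k_def)
  have "k * R i j + R j i = 0" "k * R j i + R i j = 0"
    using key[OF assms(6,7,8)] key[OF assms(7,6)] assms(8) by (auto simp: k_def)
  hence eqs: "R j i = - (k * R i j)" "R i j = - (k * R j i)" by linarith+
  have "R i j = k * (k * R i j)" using eqs(2) unfolding eqs(1) by simp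
  hence "(k * k - 1) * R i j = 0" by (simp add: algebra_simps)
  moreover have "k * k - 1 \<noteq> 0" using k mult_mono[of 5 k 5 k] by simp
  ultimately show ?thesis by simp
qed

section \<open>Double transpositions\<close>

definition dtrans :: "nat set \<Rightarrow> (nat \<Rightarrow> nat) \<Rightarrow> bool"
  where "dtrans J s \<longleftrightarrow> (\<exists>a b c d. {a, b, c, d} \<subseteq> J \<and> distinct [a, b, c, d] \<and>
    s = transpose a b \<circ> transpose c d)"

lemma dtransI: "distinct [a, b, c, d] \<Longrightarrow> {a, b, c, d} \<subseteq> J \<Longrightarrow> dtrans J (transpose a b \<circ> transpose c d)"
  unfolding dtrans_def
  by (rule exI[of _ a], rule exI[of _ b], rule exI[of _ c], rule exI[of _ d]) simp

lemma dtrans_even: "dtrans J s \<Longrightarrow> evenperm s"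
  by (auto simp: dtrans_def evenperm_comp evenperm_swap permutation_swap_id)

lemma dtrans_permutes: "dtrans J s \<Longrightarrow> s permutes J"
  unfolding dtrans_def by (auto intro!: permutes_compose permutes_swap_id)

lemma dtrans_outside: "dtrans J s \<Longrightarrow> i \<notin> J \<Longrightarrow> s i = i"
  using dtrans_permutes permutes_not_in by metis

lemma dtrans_involution: "dtrans J s \<Longrightarrow> s \<circ> s = id"
  by (auto simp: dtrans_def fun_eq_iff transpose_def)

lemma dtrans_in_alt: "dtrans J s \<Longrightarrow> J \<subseteq> {1..n} \<Longrightarrow> s \<in> alt n"
  using permutes_even_in_alt dtrans_even dtrans_permutes by blast

lemma dtrans_commute:
  assumes "dtrans J s" "dtrans J' t" "J \<inter> J' = {}"
  shows "s \<circ> t = t \<circ> s"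
proof
  fix x
  have "s y \<in> J \<longleftrightarrow> y \<in> J" "t y \<in> J' \<longleftrightarrow> y \<in> J'" for y
    using dtrans_permutes assms permutes_in_image by metis+
  thus "(s \<circ> t) x = (t \<circ> s) x"
    using assms(3) dtrans_outside[OF assms(1)] dtrans_outside[OF assms(2)]
    by (metis IntI comp_apply empty_iff)
qed

lemma exists_two_outside:
  assumes "finite J" "card B + 2 \<le> card J" "finite B"
  shows "\<exists>e f. e \<in> J - B \<and> f \<in> J - B \<and> e \<noteq> (f :: 'a)"
proof -
  have "card J - card B \<le> card (J - B)" by (rule diff_card_le_card_Diff[OF assms(3)])
  hence "card (J - B) \<ge> 2" using assms(2) by simp
  then obtain D where "D \<subseteq> J - B" "card D = 2" by (meson obtain_subset_with_card_n)
  thus ?thesis by (auto simp: card_2_iff)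
qed

text \<open>An even permutation is a product of pairs of transpositions. A pair
  \<open>(a b)(c d)\<close>, even with overlapping supports, is \<open>(a b)(e f)\<close> times
  \<open>(e f)(c d)\<close> for two points \<open>e\<close>, \<open>f\<close> outside; at most four
  points are occupied, so six suffice.\<close>

lemma invariant_even_permutes:
  assumes "finite J" "card J \<ge> 6"
    and closed: "\<And>x s. x \<in> Y \<Longrightarrow> dtrans J s \<Longrightarrow> x \<circ> s \<in> Y"
    and inv: "\<And>x s. x \<in> Y \<Longrightarrow> dtrans J s \<Longrightarrow> F (x \<circ> s) = F x"
    and g: "g permutes J" "evenperm g" and "x \<in> Y"
  shows "F (x \<circ> g) = F x"
proof -
  have pair: "F (x \<circ> (transpose a b \<circ> transpose c d)) = F x \<and> x \<circ> (transpose a b \<circ> transpose c d) \<in> Y"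
    if x: "x \<in> Y" and abcd: "a \<in> J" "b \<in> J" "c \<in> J" "d \<in> J" "a \<noteq> b" "c \<noteq> d" for x a b c d
  proof -
    have "card {a, b, c, d} + 2 \<le> card J" using card_length[of "[a, b, c, d]"] assms(2) by simp
    then obtain e f where ef: "e \<in> J - {a, b, c, d}" "f \<in> J - {a, b, c, d}" "e \<noteq> f"
      using exists_two_outside[OF assms(1)] by (metis finite.emptyI finite_insert)
    have s: "dtrans J (transpose a b \<circ> transpose e f)" "dtrans J (transpose e f \<circ> transpose c d)"
      using abcd ef by (auto intro!: dtransI)
    have "transpose a b \<circ> transpose c d = (transpose a b \<circ> transpose e f) \<circ> (transpose e f \<circ> transpose c d)"
      by (simp add: fun_eq_iff)
    hence "x \<circ> (transpose a b \<circ> transpose c d) =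
        (x \<circ> (transpose a b \<circ> transpose e f)) \<circ> (transpose e f \<circ> transpose c d)"
      by (simp add: comp_assoc)
    thus ?thesis using inv[OF x s(1)] closed[OF x s(1)] inv[OF _ s(2)] closed[OF _ s(2)] by metis
  qed
  obtain xs where xs: "\<forall>(a, b)\<in>set xs. a \<noteq> b \<and> a \<in> J \<and> b \<in> J" "apply_transps xs = g"
    using permutes_from_transpositions[OF g(1) assms(1)] by blast
  have "even (length xs)" using evenperm_apply_transps_iff[of xs] xs g(2) by fastforce
  hence "F (x \<circ> apply_transps xs) = F x" using xs(1) \<open>x \<in> Y\<close>
  proof (induction "length xs" arbitrary: xs x rule: less_induct)
    case less
    show ?case
    proof (cases xs)
      case Nil thus ?thesis by simp
    next
      case (Cons p ys)
      then obtain q zs where xs_eq: "xs = p # q # zs" using less.prems(1) by (cases ys) auto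
      obtain a b c d where pq: "p = (a, b)" "q = (c, d)" by (cases p; cases q) auto
      define y where "y = x \<circ> (transpose a b \<circ> transpose c d)"
      have y: "F y = F x" "y \<in> Y" unfolding y_def using pair[OF less.prems(3)] less.prems(2) xs_eq pq by auto
      have "F (y \<circ> apply_transps zs) = F y" by (rule less.hyps) (use less.prems xs_eq y in auto)
      thus ?thesis using y by (simp add: xs_eq pq y_def comp_assoc)
    qed
  qed
  thus ?thesis by (simp add: xs)
qed

text \<open>Orthogonality to the matrix coefficients of the permutation representation, that is, to those of
  the trivial and the standard representation.\<close>

definition V2 :: "nat \<Rightarrow> ((nat \<Rightarrow> nat) \<Rightarrow> real) \<Rightarrow> bool"
  where "V2 n r \<longleftrightarrow> (\<forall>i\<in>{1..n}. \<forall>j\<in>{1..n}. (\<Sum>x | x \<in> alt n \<and> x i = j. r x) = 0)"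

text \<open>As \<open>s\<close> and \<open>t\<close> are commuting involutions, this is
  orthogonality of \<open>r\<close> to the point masses antisymmetrized under both \<open>s\<close>
  and \<open>t\<close>. It is the form in which the orthogonal complement of those functions is met
  later.\<close>

definition mixed_differences_vanish :: "nat \<Rightarrow> ((nat \<Rightarrow> nat) \<Rightarrow> real) \<Rightarrow> bool"
  where "mixed_differences_vanish n r \<longleftrightarrow> (\<forall>J J' s t x. J \<union> J' \<subseteq> {1..n} \<longrightarrow> J \<inter> J' = {} \<longrightarrow>
    dtrans J s \<longrightarrow> dtrans J' t \<longrightarrow> x \<in> alt n \<longrightarrow>
    r x - r (x \<circ> s) - r (x \<circ> t) + r (x \<circ> s \<circ> t) = 0)"

lemma sum_filter_right:
  assumes "g \<in> alt n" "g \<circ> g = id"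
  shows "(\<Sum>x | x \<in> alt n \<and> Q x. F (x \<circ> g)) = (\<Sum>x | x \<in> alt n \<and> Q (x \<circ> g). F x :: real)"
proof -
  have gg: "x \<circ> g \<circ> g = x" for x :: "nat \<Rightarrow> nat" using assms by (simp add: comp_assoc)
  have "(\<Sum>x | x \<in> alt n \<and> Q x. F (x \<circ> g)) = (\<Sum>x\<in>alt n. if Q (x \<circ> g \<circ> g) then F (x \<circ> g) else 0)"
    unfolding gg by (rule sum.inter_filter[OF alt.finite_G])
  also have "\<dots> = (\<Sum>x\<in>alt n. if Q (x \<circ> g) then F x else 0)"
    by (rule alt.sum_right[OF assms(1)])
  also have "\<dots> = (\<Sum>x | x \<in> alt n \<and> Q (x \<circ> g). F x)"
    by (rule sum.inter_filter[OF alt.finite_G, symmetric])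
  finally show ?thesis .
qed

text \<open>Summing over the images \<^term>\<open>b\<close> of a new point turns a sum with one more prescribed value
  into one with one value less.\<close>

lemma sum_prescribe_point:
  assumes b: "b \<in> {1..n}" and I: "finite I"
    and cover: "\<And>x. x \<in> alt n \<Longrightarrow> Q x \<Longrightarrow> inv' x b \<in> I"
  shows "(\<Sum>q\<in>I. \<Sum>x | x \<in> alt n \<and> Q x \<and> x q = b. r x) = (\<Sum>x | x \<in> alt n \<and> Q x. r x :: real)"
proof -
  have fin: "finite {x. x \<in> alt n \<and> Q x}" using alt.finite_G by simp
  have "(\<Sum>q\<in>I. \<Sum>x | x \<in> alt n \<and> Q x \<and> x q = b. r x) =
      (\<Sum>q\<in>I. \<Sum>x | x \<in> alt n \<and> Q x. if x q = b then r x else 0)"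
    using fin by (intro sum.cong refl sum.mono_neutral_cong_left) auto
  also have "\<dots> = (\<Sum>x | x \<in> alt n \<and> Q x. \<Sum>q\<in>I. if x q = b then r x else 0)" by (rule sum.swap)
  also have "\<dots> = (\<Sum>x | x \<in> alt n \<and> Q x. r x)"
  proof (intro sum.cong refl)
    fix x assume "x \<in> {x. x \<in> alt n \<and> Q x}"
    hence x: "x \<in> alt n" "inv' x b \<in> I" using cover by auto
    have "(\<Sum>q\<in>I. if x q = b then r x else 0) = (\<Sum>q\<in>I. if q = inv' x b then r x else 0)"
      using alt.inv_comp_apply[OF x(1)] by (intro sum.cong refl) auto
    thus "(\<Sum>q\<in>I. if x q = b then r x else 0) = r x" using x I by simp
  qed
  finally show ?thesis .
qed

text \<open>Sums of \<open>r\<close> over the permutations with a given number of prescribed values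
  vanish by induction on that number. With \<open>m\<close> values kept fixed, the sums
  \<open>R p q\<close> with two further prescribed values form an array indexed by distinct points:
  its row and column sums have one prescription less and vanish, and the mixed differences give the
  four-point identity, so that \<open>offdiag_zero\<close> applies.\<close>

lemma partial_sums_step:
  assumes mix: "mixed_differences_vanish n r" and n: "m + 8 \<le> n"
    and IH: "\<And>K \<phi>. K \<subseteq> {1..n} \<Longrightarrow> card K = Suc m \<Longrightarrow> inj_on \<phi> K \<Longrightarrow> \<phi> ` K \<subseteq> {1..n} \<Longrightarrow>
      (\<Sum>x | x \<in> alt n \<and> (\<forall>k\<in>K. x k = \<phi> k). r x) = 0"
    and K: "K \<subseteq> {1..n}" "card K = Suc (Suc m)" "inj_on \<phi> K" "\<phi> ` K \<subseteq> {1..n}"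
  shows "(\<Sum>x | x \<in> alt n \<and> (\<forall>k\<in>K. x k = \<phi> k). r x) = 0"
proof -
  have finK: "finite K" using K(1) finite_subset by blast
  obtain i K1 where K1: "K = insert i K1" "i \<notin> K1" "card K1 = Suc m" using K(2) by (metis card_Suc_eq)
  obtain j M where M: "K1 = insert j M" "j \<notin> M" "card M = m" using K1(3) by (metis card_Suc_eq)
  define a b where "a = \<phi> i" and "b = \<phi> j"
  have ij: "i \<noteq> j" "i \<notin> M" "j \<notin> M" "i \<in> {1..n}" "j \<in> {1..n}" "M \<subseteq> {1..n}" "finite M"
    using K1 M K(1) finK by auto
  have ab: "a \<noteq> b" "a \<in> {1..n}" "b \<in> {1..n}" "a \<notin> \<phi> ` M" "b \<notin> \<phi> ` M"
    using K K1 M ij by (auto simp: a_def b_def inj_on_def)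
  define Q where "Q x \<longleftrightarrow> (\<forall>k\<in>M. x k = \<phi> k)" for x
  define R where "R p q = (\<Sum>x | x \<in> alt n \<and> (Q x \<and> x p = a) \<and> x q = b. r x)" for p q
  define I where "I = {1..n} - M"
  have "card I = n - m" using ij M by (simp add: I_def card_Diff_subset)
  hence cI: "card I \<ge> 8" using n by linarith
  have pre: "inv' x c \<in> I" if "x \<in> alt n" "Q x" "c \<in> {1..n}" "c \<notin> \<phi> ` M" for x c
  proof -
    have "inv' x c \<in> {1..n}" using that alt_apply_mem alt.inv_G by blast
    moreover have "inv' x c \<notin> M" using that alt.inv_comp_apply(2)[OF that(1), of c] by (metis Q_def imageI)
    ultimately show ?thesis by (simp add: I_def)
  qed
  have one: "(\<Sum>x | x \<in> alt n \<and> Q x \<and> x p = c. r x) = 0"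
    if "p \<in> I" "c \<in> {1..n}" "c \<notin> \<phi> ` M" for p c
  proof -
    have "(\<Sum>x | x \<in> alt n \<and> (\<forall>k\<in>insert p M. x k = (\<phi>(p := c)) k). r x) = 0"
    proof (rule IH)
      show "inj_on (\<phi>(p := c)) (insert p M)"
        using that K(3) K1 M by (auto simp: inj_on_def I_def image_iff)
      show "(\<phi>(p := c)) ` insert p M \<subseteq> {1..n}"
        using that K(4) K1 M by (auto simp: I_def)
    qed (use that ij M in \<open>auto simp: I_def\<close>)
    moreover have "{x. x \<in> alt n \<and> (\<forall>k\<in>insert p M. x k = (\<phi>(p := c)) k)} = {x. x \<in> alt n \<and> Q x \<and> x p = c}"
      using that by (auto simp: Q_def I_def)
    ultimately show ?thesis by simp
  qed
  have "R i j = 0"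
  proof (rule offdiag_zero[of I])
    show "finite I" "i \<in> I" "j \<in> I" "i \<noteq> j" "card I \<ge> 4"
      using ij cI by (auto simp: I_def)
    show "(\<Sum>q\<in>I - {p}. R p q) = 0" if p: "p \<in> I" for p
    proof -
      have "(\<Sum>q\<in>I - {p}. R p q) = (\<Sum>x | x \<in> alt n \<and> Q x \<and> x p = a. r x)"
        unfolding R_def
      proof (rule sum_prescribe_point)
        show "inv' x b \<in> I - {p}" if "x \<in> alt n" "Q x \<and> x p = a" for x
          using pre[of x b] that ab alt.inv_comp_apply(2)[OF that(1), of b] by auto
      qed (use ab \<open>finite I\<close> in auto)
      thus ?thesis using one[OF p] ab by simp
    qed
    show "(\<Sum>p\<in>I - {q}. R p q) = 0" if q: "q \<in> I" for q
    proof -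
      have "(\<Sum>p\<in>I - {q}. R p q) =
          (\<Sum>p\<in>I - {q}. \<Sum>x | x \<in> alt n \<and> (Q x \<and> x q = b) \<and> x p = a. r x)"
        unfolding R_def by (simp add: conj_ac)
      also have "\<dots> = (\<Sum>x | x \<in> alt n \<and> Q x \<and> x q = b. r x)"
      proof (rule sum_prescribe_point)
        show "inv' x a \<in> I - {q}" if "x \<in> alt n" "Q x \<and> x q = b" for x
          using pre[of x a] that ab alt.inv_comp_apply(2)[OF that(1), of a] by auto
      qed (use ab \<open>finite I\<close> in auto)
      finally show ?thesis using one[OF q] ab by simp
    qed
    show "R i j - R i' j - R i j' + R i' j' = 0"
      if sub: "{i, j, i', j'} \<subseteq> I" and dist: "distinct [i, j, i', j']" for i j i' j'
    proof -
      have c4: "card {i, j, i', j'} = 4" using dist by simp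
      \<comment> \<open>The points \<open>p\<close>, \<open>p'\<close>, \<open>q\<close>,
        \<open>q'\<close> only serve to make the transpositions of \<open>i\<close>,
        \<open>i'\<close> and of \<open>j\<close>, \<open>j'\<close> even. With \<open>i\<close>,
        \<open>j\<close>, \<open>i'\<close>, \<open>j'\<close> eight points outside \<open>M\<close>
        are needed, whence \<open>m + 8 \<le> n\<close>.\<close>
      then obtain p p' where p: "p \<in> I - {i, j, i', j'}" "p' \<in> I - {i, j, i', j'}" "p \<noteq> p'"
        using exists_two_outside[OF \<open>finite I\<close>, of "{i, j, i', j'}"] cI c4 by auto
      have c6: "card {i, j, i', j', p, p'} = 6"
        using distinct_card[of "[i, j, i', j', p, p']"] dist p by auto
      then obtain q q' where q: "q \<in> I - {i, j, i', j', p, p'}" "q' \<in> I - {i, j, i', j', p, p'}" "q \<noteq> q'"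
        using exists_two_outside[OF \<open>finite I\<close>, of "{i, j, i', j', p, p'}"] cI c6 by auto
      define s t where "s = transpose i i' \<circ> transpose p p'" and "t = transpose j j' \<circ> transpose q q'"
      define J J' where "J = {i, i', p, p'}" and "J' = {j, j', q, q'}"
      have J: "dtrans J s" "dtrans J' t" "J \<inter> J' = {}" "J \<union> J' \<subseteq> {1..n}" "J \<inter> M = {}" "J' \<inter> M = {}"
        using p q dist sub by (auto simp: s_def t_def J_def J'_def I_def intro!: dtransI)
      have st: "s \<in> alt n" "t \<in> alt n" using J dtrans_in_alt by auto
      have inv: "s \<circ> s = id" "t \<circ> t = id" using J dtrans_involution by auto
      have comm: "s \<circ> t = t \<circ> s" using J dtrans_commute by blast
      have stst: "s \<circ> t \<circ> (s \<circ> t) = id"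
        by (metis comm comp_assoc comp_id inv)
      have val: "s i = i'" "s j = j" "t i = i" "t j = j'" using p q dist by (auto simp: s_def t_def transpose_def)
      have fixM: "s k = k" "t k = k" if "k \<in> M" for k
        using J that dtrans_outside by (metis IntI empty_iff)+
      define A where "A = {x. x \<in> alt n \<and> (Q x \<and> x i = a) \<and> x j = b}"
      have "0 = (\<Sum>x\<in>A. r x - r (x \<circ> s) - r (x \<circ> t) + r (x \<circ> s \<circ> t))"
        using mix J by (intro sum.neutral[symmetric] ballI) (auto simp: mixed_differences_vanish_def A_def)
      also have "\<dots> = (\<Sum>x\<in>A. r x) - (\<Sum>x\<in>A. r (x \<circ> s)) - (\<Sum>x\<in>A. r (x \<circ> t)) + (\<Sum>x\<in>A. r (x \<circ> (s \<circ> t)))"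
        by (simp add: sum.distrib sum_subtractf comp_assoc)
      also have "(\<Sum>x\<in>A. r (x \<circ> s)) = R i' j"
        unfolding A_def R_def using sum_filter_right[OF st(1) inv(1), where Q = "\<lambda>x. (Q x \<and> x i = a) \<and> x j = b" and F = r]
        by (simp add: Q_def val fixM)
      also have "(\<Sum>x\<in>A. r (x \<circ> t)) = R i j'"
        unfolding A_def R_def using sum_filter_right[OF st(2) inv(2), where Q = "\<lambda>x. (Q x \<and> x i = a) \<and> x j = b" and F = r]
        by (simp add: Q_def val fixM)
      also have "(\<Sum>x\<in>A. r (x \<circ> (s \<circ> t))) = R i' j'"
        unfolding A_def R_def
        using sum_filter_right[OF alt.comp_G[OF st] stst, where Q = "\<lambda>x. (Q x \<and> x i = a) \<and> x j = b" and F = r] fun_cong[OF comm, of j] 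
        by (simp add: Q_def val fixM)
      finally show ?thesis by (simp add: R_def A_def)
    qed
  qed
  moreover have "{x. x \<in> alt n \<and> (\<forall>k\<in>K. x k = \<phi> k)} = {x. x \<in> alt n \<and> (Q x \<and> x i = a) \<and> x j = b}"
    using K1 M by (auto simp: Q_def a_def b_def)
  ultimately show ?thesis by (simp add: R_def)
qed

text \<open>Starting from \<open>V2\<close>, three induction steps reach four prescribed values, the
  size of the support \<open>J\<close> of a double transposition \<open>s\<close>; the last step has
  \<open>m = 2\<close> and needs \<open>n \<ge> 10\<close>. The difference
  \<open>F y = r (y \<circ> s) - r y\<close> does not change under even permutations of the
  complement of \<open>J\<close>, so it depends only on the values of \<open>y\<close> on
  \<open>J\<close>. Its sum over all \<open>y\<close> with given values there is a difference of two
  vanishing sums, hence \<open>F = 0\<close>. So \<open>r\<close> is invariant under double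
  transpositions and constant, and \<open>V2\<close> makes the constant 0.\<close>

lemma V2_mixed_zero:
  assumes V2: "V2 n r" and mix: "mixed_differences_vanish n r" and n: "n \<ge> 10" and "x \<in> alt n"
  shows "r x = 0"
proof -
  have one: "(\<Sum>x | x \<in> alt n \<and> (\<forall>k\<in>K. x k = \<phi> k). r x) = 0"
    if "K \<subseteq> {1..n}" "card K = Suc 0" "inj_on \<phi> K" "\<phi> ` K \<subseteq> {1..n}" for K \<phi>
  proof -
    obtain i where "K = {i}" using \<open>card K = Suc 0\<close> by (metis card_1_singletonE One_nat_def)
    thus ?thesis using V2 that unfolding V2_def by auto
  qed
  have two: "(\<Sum>x | x \<in> alt n \<and> (\<forall>k\<in>K. x k = \<phi> k). r x) = 0"
    if "K \<subseteq> {1..n}" "card K = Suc (Suc 0)" "inj_on \<phi> K" "\<phi> ` K \<subseteq> {1..n}" for K \<phi>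
    by (rule partial_sums_step[OF mix _ one]) (use n that in auto)
  have three: "(\<Sum>x | x \<in> alt n \<and> (\<forall>k\<in>K. x k = \<phi> k). r x) = 0"
    if "K \<subseteq> {1..n}" "card K = Suc (Suc (Suc 0))" "inj_on \<phi> K" "\<phi> ` K \<subseteq> {1..n}" for K \<phi>
    by (rule partial_sums_step[OF mix _ two]) (use n that in auto)
  have four: "(\<Sum>x | x \<in> alt n \<and> (\<forall>k\<in>K. x k = \<phi> k). r x) = 0"
    if "K \<subseteq> {1..n}" "card K = Suc (Suc (Suc (Suc 0)))" "inj_on \<phi> K" "\<phi> ` K \<subseteq> {1..n}" for K \<phi>
    by (rule partial_sums_step[OF mix _ three]) (use n that in auto)
  have step: "r (x \<circ> s) = r x" if x: "x \<in> alt n" and s: "dtrans {1..n} s" for x s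
  proof -
    obtain a b c d where abcd: "{a, b, c, d} \<subseteq> {1..n}" "distinct [a, b, c, d]"
      "s = transpose a b \<circ> transpose c d" using s unfolding dtrans_def by blast
    define J C where "J = {a, b, c, d}" and "C = {1..n} - J"
    have J: "dtrans J s" "J \<subseteq> {1..n}" "card J = 4" "finite J"
      using abcd by (auto simp: J_def intro!: dtransI)
    have C: "finite C" "card C \<ge> 6" "C \<subseteq> {1..n}" "J \<inter> C = {}" "J \<union> C \<subseteq> {1..n}"
      using J n by (auto simp: C_def card_Diff_subset)
    have s_alt: "s \<in> alt n" using J dtrans_in_alt by blast
    have sJ: "s k \<in> J \<longleftrightarrow> k \<in> J" "s (s k) = k" for k
      using permutes_in_image[OF dtrans_permutes[OF J(1)]] dtrans_involution[OF J(1)] by (auto simp: fun_eq_iff)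
    define F where "F y = r (y \<circ> s) - r y" for y
    have F_inv: "F (y \<circ> g) = F y" if y: "y \<in> alt n" and g: "g permutes C" "evenperm g" for y g
    proof (rule invariant_even_permutes[OF C(1,2) _ _ g y])
      fix z t assume z: "z \<in> alt n" and t: "dtrans C t"
      show "z \<circ> t \<in> alt n" using z t C(3) alt.comp_G dtrans_in_alt by blast
      have "r z - r (z \<circ> s) - r (z \<circ> t) + r (z \<circ> s \<circ> t) = 0"
        using mix J(1) C(4,5) z t unfolding mixed_differences_vanish_def by blast
      moreover have "z \<circ> s \<circ> t = z \<circ> t \<circ> s"
        using dtrans_commute[OF J(1) t C(4)] by (simp add: comp_assoc)
      ultimately show "F (z \<circ> t) = F z" by (simp add: F_def)
    qed
    define A where "A = {y. y \<in> alt n \<and> (\<forall>k\<in>J. y k = x k)}"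
    have "x \<in> A" using x by (simp add: A_def)
    moreover have "finite A" using alt.finite_G by (simp add: A_def)
    ultimately have cA: "card A \<noteq> 0" by auto
    have "F y = F x" if "y \<in> A" for y
    proof -
      define g where "g = inv' x \<circ> y"
      have y: "y \<in> alt n" using that by (simp add: A_def)
      have g_alt: "g \<in> alt n" using x y alt.inv_G alt.comp_G by (simp add: g_def)
      have "g k = k" if "k \<in> J" for k
        using \<open>y \<in> A\<close> that alt.inv_comp_apply[OF x] by (simp add: A_def g_def)
      hence "g permutes C"
        using g_alt permutes_superset[of g "{1..n}" C] by (auto simp: alt_group_carrier C_def)
      moreover have "evenperm g" using g_alt by (simp add: alt_group_carrier)
      ultimately have "F (x \<circ> g) = F x" using F_inv x by blast
      moreover have "x \<circ> g = y" unfolding g_def by (rule alt.inv_comp_cancel(2)[OF x])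
      ultimately show ?thesis by simp
    qed
    hence "real (card A) * F x = (\<Sum>y\<in>A. F y)" by simp
    also have "\<dots> = (\<Sum>y\<in>A. r (y \<circ> s)) - (\<Sum>y\<in>A. r y)" by (simp add: F_def sum_subtractf)
    also have "(\<Sum>y\<in>A. r (y \<circ> s)) = (\<Sum>y | y \<in> alt n \<and> (\<forall>k\<in>J. y k = (x \<circ> s) k). r y)"
    proof -
      have "(\<Sum>y\<in>A. r (y \<circ> s)) = (\<Sum>y | y \<in> alt n \<and> (\<forall>k\<in>J. (y \<circ> s) k = x k). r y)"
        unfolding A_def
        by (rule sum_filter_right[OF s_alt dtrans_involution[OF J(1)], where Q = "\<lambda>y. \<forall>k\<in>J. y k = x k"])
      moreover have "(\<forall>k\<in>J. (y \<circ> s) k = x k) \<longleftrightarrow> (\<forall>k\<in>J. y k = (x \<circ> s) k)" for y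
        using sJ by (metis comp_apply)
      ultimately show ?thesis by simp
    qed
    also have "\<dots> = 0"
    proof (rule four)
      have "x \<circ> s \<in> alt n" using x s_alt alt.comp_G by blast
      thus "inj_on (x \<circ> s) J" "(x \<circ> s) ` J \<subseteq> {1..n}"
        using J(2) alt_apply_mem by (blast intro: inj_onI dest: alt_eq_iff[THEN iffD1])+
    qed (use J in auto)
    also have "(\<Sum>y\<in>A. r y) = 0"
      unfolding A_def
    proof (rule four)
      show "inj_on x J" "x ` J \<subseteq> {1..n}"
        using x J(2) alt_apply_mem by (blast intro: inj_onI dest: alt_eq_iff[THEN iffD1])+
    qed (use J in auto)
    finally show ?thesis using cA by (simp add: F_def)
  qed
  have const: "r y = r id" if "y \<in> alt n" for y
  proof -
    have "r (id \<circ> y) = r id"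
    proof (rule invariant_even_permutes[where J = "{1..n}" and Y = "alt n"])
      show "z \<circ> s \<in> alt n" if "z \<in> alt n" "dtrans {1..n} s" for z s
        using that alt.comp_G dtrans_in_alt by blast
      show "y permutes {1..n}" "evenperm y" using that by (auto simp: alt_group_carrier)
      show "r (z \<circ> s) = r z" if "z \<in> alt n" "dtrans {1..n} s" for z s using that by (rule step)
      show "id \<in> alt n" by (rule alt.id_G)
    qed (use n in simp_all)
    thus ?thesis by simp
  qed
  define B where "B = {y. y \<in> alt n \<and> y 1 = 1}"
  have "id \<in> B" "finite B" using alt.id_G alt.finite_G by (auto simp: B_def)
  hence "card B \<noteq> 0" by auto
  have "(\<Sum>y\<in>B. r y) = 0" using V2 n unfolding V2_def B_def by auto
  moreover have "(\<Sum>y\<in>B. r y) = real (card B) * r id"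
    using const by (simp add: B_def)
  ultimately have "r id = 0" using \<open>card B \<noteq> 0\<close> by simp
  thus ?thesis using const assms(4) by simp
qed

section \<open>Contraction by convolution\<close>

lemma comp_commute_pairs:
  assumes "f \<circ> h = h \<circ> f" "f \<circ> k = k \<circ> f" "g \<circ> h = h \<circ> g" "g \<circ> k = k \<circ> g"
  shows "f \<circ> g \<circ> (h \<circ> k) = h \<circ> k \<circ> (f \<circ> g)"
proof -
  have "f \<circ> g \<circ> (h \<circ> k) = f \<circ> (g \<circ> h) \<circ> k" by (simp only: comp_assoc)
  also have "\<dots> = (f \<circ> h) \<circ> (g \<circ> k)" by (simp only: assms(3) comp_assoc)
  also have "\<dots> = h \<circ> (f \<circ> k) \<circ> g" by (simp only: assms(1,4) comp_assoc)
  also have "\<dots> = h \<circ> k \<circ> (f \<circ> g)" by (simp only: assms(2) comp_assoc)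
  finally show ?thesis .
qed

context fin_perm_group
begin

lemma tame_zero:
  assumes "\<And>x. x \<in> G \<Longrightarrow> f x = 0" "L \<ge> 0"
  shows "tame v L f"
proof (rule tame_invariant_class[where P = "\<lambda>h. \<forall>x\<in>G. h x = 0"])
  show conv0: "\<forall>x\<in>G. conv v h x = 0" if "\<forall>x\<in>G. h x = 0" for v h
    using that by (auto simp: conv_def comp_G inv_G intro!: sum.neutral)
  show "nsq (conv u h) \<le> L * nsq h" if "\<forall>x\<in>G. h x = 0" for u h
    using conv0[OF that] that by (simp add: nsq_def)
qed (use assms in auto)

text \<open>Commuting involutions act by right translation and split a function into common
  eigenfunctions.\<close>

lemma tame_by_involutions:
  assumes "\<And>z. z \<in> set zs \<Longrightarrow> z \<in> G" "\<And>z. z \<in> set zs \<Longrightarrow> z \<circ> z = id"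
    and "\<And>z z'. z \<in> set zs \<Longrightarrow> z' \<in> set zs \<Longrightarrow> z \<circ> z' = z' \<circ> z"
    and "\<And>z y. z \<in> set zs \<Longrightarrow> y \<in> A \<Longrightarrow> z \<circ> y = y \<circ> z"
    and "\<And>h. (\<forall>y\<in>A. \<forall>x\<in>G. h (x \<circ> y) = - h x) \<Longrightarrow>
      (\<forall>z\<in>set zs. \<exists>e\<in>{1, -1}. \<forall>x\<in>G. h (x \<circ> z) = e * h x) \<Longrightarrow> tame v L h"
    and "\<forall>y\<in>A. \<forall>x\<in>G. f (x \<circ> y) = - f x"
  shows "tame v L f"
  using assms
proof (induction zs)
  case Nil
  show ?case by (rule Nil.prems(5)) (use Nil.prems(6) in auto)
next
  case (Cons z zs)
  have z: "z \<in> G" "z \<circ> z = id" using Cons.prems(1,2)[of z, OF list.set_intros(1)] .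
  show ?case
  proof (rule Cons.IH)
    fix h :: "('b \<Rightarrow> 'b) \<Rightarrow> real" assume hA: "\<forall>y\<in>A. \<forall>x\<in>G. h (x \<circ> y) = - h x"
      and hz: "\<forall>z\<in>set zs. \<exists>e\<in>{1, -1}. \<forall>x\<in>G. h (x \<circ> z) = e * h x"
    \<comment> \<open>These are the symmetric (\<open>c = 1\<close>) and antisymmetric
      (\<open>c = -1\<close>) halves of \<open>h\<close> under \<open>z\<close>. Commutativity lets
      both inherit the eigenvalues already arranged and the antisymmetry under
      \<open>A\<close>.\<close>
    have part: "tame v L (\<lambda>x. 1/2 * h x + c/2 * h (x \<circ> z))" if c: "c = 1 \<or> c = -1" for c
    proof (rule Cons.prems(5))
      show "\<forall>y\<in>A. \<forall>x\<in>G. 1/2 * h (x \<circ> y) + c/2 * h (x \<circ> y \<circ> z) = - (1/2 * h x + c/2 * h (x \<circ> z))"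
      proof (intro ballI)
        fix y x assume yx: "y \<in> A" "x \<in> G"
        have "z \<circ> y = y \<circ> z" by (rule Cons.prems(4)) (use yx in auto)
        hence "x \<circ> y \<circ> z = (x \<circ> z) \<circ> y" by (simp only: comp_assoc)
        thus "1/2 * h (x \<circ> y) + c/2 * h (x \<circ> y \<circ> z) = - (1/2 * h x + c/2 * h (x \<circ> z))"
          using hA yx comp_G[OF yx(2) z(1)] by simp
      qed
      show "\<forall>w\<in>set (z # zs). \<exists>e\<in>{1, -1}. \<forall>x\<in>G.
          1/2 * h (x \<circ> w) + c/2 * h (x \<circ> w \<circ> z) = e * (1/2 * h x + c/2 * h (x \<circ> z))"
      proof
        fix w assume w: "w \<in> set (z # zs)"
        show "\<exists>e\<in>{1, -1}. \<forall>x\<in>G.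
          1/2 * h (x \<circ> w) + c/2 * h (x \<circ> w \<circ> z) = e * (1/2 * h x + c/2 * h (x \<circ> z))"
        proof (cases "w = z")
          case True
          have "x \<circ> z \<circ> z = x" for x :: "'b \<Rightarrow> 'b" by (simp only: comp_assoc z(2) comp_id)
          thus ?thesis using c True by (intro bexI[of _ c]) auto
        next
          case False
          hence "w \<in> set zs" using w by simp
          then obtain e where e: "e \<in> {1, -1}" "\<forall>x\<in>G. h (x \<circ> w) = e * h x" using hz by blast
          have "z \<circ> w = w \<circ> z" by (rule Cons.prems(3)) (use w in auto)
          hence "x \<circ> w \<circ> z = (x \<circ> z) \<circ> w" for x :: "'b \<Rightarrow> 'b" by (simp only: comp_assoc)
          thus ?thesis using e comp_G[OF _ z(1)]
            by (intro bexI[of _ e]) (auto simp: algebra_simps)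
        qed
      qed
    qed
    have "tame v L (\<lambda>x. (1/2 * h x + 1/2 * h (x \<circ> z)) + (1/2 * h x + (-1)/2 * h (x \<circ> z)))"
      by (intro tame_add part) auto
    thus "tame v L h" by simp
  next
    show "w \<in> G" "w \<circ> w = id" if "w \<in> set zs" for w
      by (rule Cons.prems(1), use that in simp, rule Cons.prems(2), use that in simp)
    show "w \<circ> w' = w' \<circ> w" if "w \<in> set zs" "w' \<in> set zs" for w w'
      by (rule Cons.prems(3)) (use that in simp_all)
    show "w \<circ> y = y \<circ> w" if "w \<in> set zs" "y \<in> A" for w y
      by (rule Cons.prems(4)) (use that in simp_all)
  qed (rule Cons.prems(6))
qed

end

text \<open>Unimodality and symmetry of the binomial coefficients. It reduces a set of unknown size,
  of blocks or of points in an orbit, to the worst case of size 2.\<close>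

lemma choose_two_le:
  assumes "2 \<le> s" "s + 2 \<le> r"
  shows "r choose 2 \<le> r choose s"
proof (cases "2 * s \<le> r")
  case True thus ?thesis using assms by (intro binomial_mono)
next
  case False
  hence "r choose 2 \<le> r choose (r - s)" using assms by (intro binomial_mono) auto
  thus ?thesis using binomial_symmetric[of s r] assms by simp
qed

lemma transpose_conj: "inj h \<Longrightarrow> h \<circ> transpose a b = transpose (h a) (h b) \<circ> h"
  by (auto simp: fun_eq_iff transpose_def inj_eq)

text \<open>Permuting the blocks moves the set of blocks with sign +1 to any other set of the same size;
  as the number of blocks is odd, such sets are never complementary, so the translates are
  orthogonal.\<close>

lemma pattern_bound:
  fixes a b :: "nat \<Rightarrow> nat" and \<sigma> :: "nat \<Rightarrow> real"
  defines "\<tau> l \<equiv> transpose (a l) (b l)"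
  assumes "odd r" and ab: "inj_on a {..<r}" "inj_on b {..<r}" "a ` {..<r} \<inter> b ` {..<r} = {}"
    "a ` {..<r} \<union> b ` {..<r} \<subseteq> {1..n}"
    and \<sigma>: "\<And>l. l < r \<Longrightarrow> \<sigma> l = 1 \<or> \<sigma> l = -1"
    and P: "\<And>l m x. l < r \<Longrightarrow> m < r \<Longrightarrow> x \<in> alt n \<Longrightarrow> f (x \<circ> (\<tau> l \<circ> \<tau> m)) = \<sigma> l * \<sigma> m * f x"
    and s: "2 \<le> card {l. l < r \<and> \<sigma> l = 1}" "card {l. l < r \<and> \<sigma> l = 1} + 2 \<le> r"
  shows "real (r choose 2) * alt.nsq n (alt.conv n v f) \<le> real (card (alt n)) * alt.nsq n v * alt.nsq n f"
proof -
  define S where "S = {l. l < r \<and> \<sigma> l = 1}"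
  define I where "I = {Q. Q \<subseteq> {..<r} \<and> card Q = card S}"
  have finI: "finite I" unfolding I_def by simp
  have cI: "card I = r choose card S" unfolding I_def by (simp add: n_subsets)
  define sg :: "nat set \<Rightarrow> nat \<Rightarrow> real" where "sg Q k = (if k \<in> Q then 1 else -1)" for Q k
  have block: "\<exists>h\<in>alt n. \<forall>k<r. \<forall>k'<r. \<forall>x\<in>alt n.
      f ((x \<circ> (\<tau> k \<circ> \<tau> k')) \<circ> h) = sg Q k * sg Q k' * f (x \<circ> h)" if Q: "Q \<in> I" for Q
  proof -
    have "\<exists>\<phi>. bij_betw \<phi> S Q"
      using Q by (intro finite_same_card_bij) (auto simp: S_def I_def finite_subset)
    then obtain \<phi> where \<phi>: "bij_betw \<phi> S Q" by blast
    obtain \<rho> where \<rho>: "\<rho> permutes {..<r}" "\<forall>k\<in>S. \<rho> k = \<phi> k"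
      using permutes_extend[of "{..<r}" S \<phi>] \<phi> Q
      by (auto simp: S_def I_def bij_betw_def)
    have \<rho>S: "\<rho> l \<in> Q \<longleftrightarrow> l \<in> S" for l
    proof -
      have "\<rho> ` S = Q" using \<phi> \<rho>(2) by (auto simp: bij_betw_def)
      thus ?thesis using permutes_inj[OF \<rho>(1)] by (metis inj_image_mem_iff)
    qed
    \<comment> \<open>\<open>h\<close> applies the same \<open>\<rho>\<close> to the points
      \<open>a l\<close> and to the points \<open>b l\<close>, so its sign is a square and
      \<open>h\<close> is even.\<close>
    define h where "h = map_permutation {..<r} a \<rho> \<circ> map_permutation {..<r} b \<rho>"
    have mp: "map_permutation {..<r} a \<rho> permutes a ` {..<r}" "map_permutation {..<r} b \<rho> permutes b ` {..<r}"
      using ab \<rho> by (auto intro!: map_permutation_permutes simp: bij_betw_def)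
    have ev: "evenperm h"
      unfolding h_def using mp[THEN permutes_imp_permutation[rotated]] \<rho> ab
      by (subst evenperm_comp) (auto simp: evenperm_map_permutation)
    have "h permutes {1..n}"
      unfolding h_def using mp ab(4) by (intro permutes_compose) (auto intro: permutes_subset)
    hence h_alt: "h \<in> alt n" using ev by (simp add: alt_group_carrier)
    have \<rho>r: "\<rho> l < r \<longleftrightarrow> l < r" for l using permutes_in_image[OF \<rho>(1)] by simp
    have ha: "h (a l) = a (\<rho> l)" and hb: "h (b l) = b (\<rho> l)" if "l < r" for l
    proof -
      have "a l \<notin> b ` {..<r}" using ab that by auto
      hence "map_permutation {..<r} b \<rho> (a l) = a l" using permutes_not_in[OF mp(2)] by blast
      thus "h (a l) = a (\<rho> l)" using that ab by (simp add: h_def map_permutation_apply)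
      have "b (\<rho> l) \<notin> a ` {..<r}" using ab that \<rho>r by blast
      hence "map_permutation {..<r} a \<rho> (b (\<rho> l)) = b (\<rho> l)" using permutes_not_in[OF mp(1)] by blast
      thus "h (b l) = b (\<rho> l)" using that ab by (simp add: h_def map_permutation_apply)
    qed
    have conj: "\<tau> (\<rho> l) \<circ> h = h \<circ> \<tau> l" if "l < r" for l
      using transpose_conj[of h "a l" "b l"] permutes_inj[OF \<open>h permutes {1..n}\<close>] ha[OF that] hb[OF that]
      by (simp add: \<tau>_def)
    have "f ((x \<circ> (\<tau> k \<circ> \<tau> k')) \<circ> h) = sg Q k * sg Q k' * f (x \<circ> h)"
      if k: "k < r" "k' < r" and x: "x \<in> alt n" for k k' x
    proof -
      obtain l l' where l: "k = \<rho> l" "k' = \<rho> l'" using permutes_surj[OF \<rho>(1)] by (metis surjD)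
      have lr: "l < r" "l' < r" using k l \<rho>r by auto
      have "(x \<circ> (\<tau> k \<circ> \<tau> k')) \<circ> h = x \<circ> (\<tau> k \<circ> (\<tau> k' \<circ> h))" by (simp add: comp_assoc)
      also have "\<dots> = x \<circ> ((\<tau> k \<circ> h) \<circ> \<tau> l')" using conj[OF lr(2)] l by (simp add: comp_assoc)
      also have "\<dots> = (x \<circ> h) \<circ> (\<tau> l \<circ> \<tau> l')" using conj[OF lr(1)] l by (simp add: comp_assoc)
      finally have "f ((x \<circ> (\<tau> k \<circ> \<tau> k')) \<circ> h) = \<sigma> l * \<sigma> l' * f (x \<circ> h)"
        using P[OF lr alt.comp_G[OF x h_alt]] by simp
      moreover have "sg Q k = \<sigma> l" "sg Q k' = \<sigma> l'"
        using \<rho>S[of l] \<rho>S[of l'] lr \<sigma>[OF lr(1)] \<sigma>[OF lr(2)]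
        unfolding sg_def l S_def mem_Collect_eq by argo+
      ultimately show ?thesis by simp
    qed
    thus ?thesis using h_alt by blast
  qed
  then obtain h where h: "\<And>Q. Q \<in> I \<Longrightarrow> h Q \<in> alt n"
    and hf: "\<And>Q k k' x. Q \<in> I \<Longrightarrow> k < r \<Longrightarrow> k' < r \<Longrightarrow> x \<in> alt n \<Longrightarrow>
      f ((x \<circ> (\<tau> k \<circ> \<tau> k')) \<circ> h Q) = sg Q k * sg Q k' * f (x \<circ> h Q)"
    by (metis (no_types))
  \<comment> \<open>Only products of two blocks are even, so a sign pattern is visible only up to a
    global sign. Two different sets could be confused only if they were complementary, which would
    force \<open>r = 2 * card S\<close>.\<close>
  have sep: "\<exists>k<r. \<exists>k'<r. sg Q k * sg Q k' * (sg Q' k * sg Q' k') = -1"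
    if Q: "Q \<in> I" "Q' \<in> I" "Q \<noteq> Q'" for Q Q'
  proof (rule ccontr)
    assume neg: "\<not> ?thesis"
    have agree: "(k \<in> Q \<longleftrightarrow> k \<in> Q') \<longleftrightarrow> (k' \<in> Q \<longleftrightarrow> k' \<in> Q')" if "k < r" "k' < r" for k k'
    proof (rule ccontr)
      assume "\<not> ?thesis"
      hence "sg Q k * sg Q k' * (sg Q' k * sg Q' k') = -1" by (auto simp: sg_def)
      thus False using neg that by blast
    qed
    obtain k where k: "k < r" "(k \<in> Q) \<noteq> (k \<in> Q')" using Q by (auto simp: I_def)
    have "Q' = {..<r} - Q" using agree[OF k(1)] k(2) Q by (auto simp: I_def)
    moreover have "finite Q" "Q \<subseteq> {..<r}" using Q finite_subset[of Q "{..<r}"] by (auto simp: I_def)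
    ultimately have "card Q' = r - card Q" by (simp only: card_Diff_subset card_lessThan)
    moreover have "card Q = card S" "card Q' = card S" using Q by (auto simp: I_def)
    moreover have "card S \<le> r" using s by (simp add: S_def)
    ultimately have "r = 2 * card S" by linarith
    thus False using \<open>odd r\<close> by simp
  qed
  have \<tau>_alt: "\<tau> k \<circ> \<tau> k' \<in> alt n" if "k < r" "k' < r" for k k'
  proof -
    have "a k \<noteq> b k" "a k' \<noteq> b k'" "{a k, b k, a k', b k'} \<subseteq> {1..n}" using ab that by auto
    thus ?thesis unfolding alt_group_carrier \<tau>_def
      by (auto intro!: permutes_compose permutes_swap_id simp: evenperm_comp evenperm_swap permutation_swap_id)
  qed
  have "real (card I) * alt.nsq n (alt.conv n v f) \<le> real (card (alt n)) * alt.nsq n v * alt.nsq n f"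
  proof (rule alt.nsq_conv_orth_translates[OF finI h])
    fix Q Q' assume Q: "Q \<in> I" "Q' \<in> I" "Q \<noteq> Q'"
    obtain k k' where k: "k < r" "k' < r" "sg Q k * sg Q k' * (sg Q' k * sg Q' k') = -1"
      using sep[OF Q] by blast
    define F F' where "F x = f (x \<circ> h Q)" and "F' x = f (x \<circ> h Q')" for x
    \<comment> \<open>The substitution
      \<open>x \<mapsto> x \<circ> (\<tau> k \<circ> \<tau> k')\<close> multiplies the two
      translates by signs of product -1, so the inner product equals its own negative.\<close>
    have "alt.ip n F F' = (\<Sum>x\<in>alt n. F (x \<circ> (\<tau> k \<circ> \<tau> k')) * F' (x \<circ> (\<tau> k \<circ> \<tau> k')))"
      unfolding alt.ip_def by (rule alt.sum_right[OF \<tau>_alt[OF k(1,2)], symmetric])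
    also have "\<dots> = (\<Sum>x\<in>alt n. (sg Q k * sg Q k' * (sg Q' k * sg Q' k')) * (F x * F' x))"
      by (intro sum.cong refl) (simp add: F_def F'_def hf[OF Q(1) k(1,2)] hf[OF Q(2) k(1,2)])
    also have "\<dots> = - alt.ip n F F'"
      unfolding k(3) by (simp add: alt.ip_def sum_negf)
    finally have "alt.ip n F F' = 0" by simp
    thus "alt.ip n (\<lambda>x. f (x \<circ> h Q)) (\<lambda>x. f (x \<circ> h Q')) = 0" by (simp add: F_def[abs_def] F'_def[abs_def])
  qed
  moreover have "r choose 2 \<le> card I" unfolding cI using s by (intro choose_two_le) (auto simp: S_def)
  ultimately show ?thesis
    by (meson alt.nsq_nonneg mult_right_mono of_nat_mono order_trans)
qed

text \<open>The two double transpositions become the first four of \<open>r\<close> disjoint blocks.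
  Antisymmetry gives \<open>\<sigma> 0 * \<sigma> 1 = -1\<close> and
  \<open>\<sigma> 2 * \<sigma> 3 = -1\<close>, so every common eigenfunction has at least two blocks
  of each sign; this excludes the patterns that have few translates.\<close>

lemma tame_mixed_difference:
  assumes r: "odd r" "4 \<le> r" "2 * r \<le> n"
    and cs: "distinct [c1, c2, c3, c4, c5, c6, c7, c8]" "{c1, c2, c3, c4, c5, c6, c7, c8} \<subseteq> {1..n}"
    and f: "\<And>x. x \<in> alt n \<Longrightarrow> f (x \<circ> (transpose c1 c2 \<circ> transpose c3 c4)) = - f x"
      "\<And>x. x \<in> alt n \<Longrightarrow> f (x \<circ> (transpose c5 c6 \<circ> transpose c7 c8)) = - f x"
  shows "alt.tame n v (real (card (alt n)) * alt.nsq n v / real (r choose 2)) f"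
proof -
  define L where "L = real (card (alt n)) * alt.nsq n v / real (r choose 2)"
  have L: "L \<ge> 0" by (simp add: L_def alt.nsq_nonneg)
  have r2: "real (r choose 2) > 0" using r by (simp add: zero_less_binomial_iff)
  define C where "C = [c1, c2, c3, c4, c5, c6, c7, c8]"
  define ps where "ps = C @ sorted_list_of_set ({1..n} - set C)"
  have ps: "distinct ps" "set ps = {1..n}" using cs by (auto simp: ps_def C_def)
  hence len: "length ps = n" using distinct_card by fastforce
  define a b where "a l = ps ! (2 * l)" and "b l = ps ! (2 * l + 1)" for l
  have nth: "ps ! i = ps ! j \<longleftrightarrow> i = j" if "i < n" "j < n" for i j
    using ps(1) len that by (simp add: nth_eq_iff_index_eq)
  have ab: "inj_on a {..<r}" "inj_on b {..<r}" "a ` {..<r} \<inter> b ` {..<r} = {}"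
    "a ` {..<r} \<union> b ` {..<r} \<subseteq> {1..n}"
  proof -
    show "inj_on a {..<r}" "inj_on b {..<r}"
      using r by (auto simp: inj_on_def a_def b_def nth)
    show "a ` {..<r} \<inter> b ` {..<r} = {}"
    proof -
      have "a l \<noteq> b m" if "l < r" "m < r" for l m
        using nth[of "2 * l" "2 * m + 1"] that r by (simp add: a_def b_def) presburger
      thus ?thesis by blast
    qed
    show "a ` {..<r} \<union> b ` {..<r} \<subseteq> {1..n}"
      unfolding ps(2)[symmetric] using r len by (auto simp: a_def b_def intro!: nth_mem)
  qed
  define \<tau> where "\<tau> l = transpose (a l) (b l)" for l
  have \<tau>_comm: "\<tau> l \<circ> \<tau> m = \<tau> m \<circ> \<tau> l" if "l < r" "m < r" for l m
  proof (cases "l = m")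
    case False
    have "a l \<noteq> a m" "b l \<noteq> b m" "a l \<noteq> b m" "b l \<noteq> a m"
      using ab that False by (auto simp: inj_on_def)
    thus ?thesis unfolding \<tau>_def by (intro swap_id_independent)
  qed simp
  have \<tau>\<tau>: "\<tau> l \<circ> \<tau> l = id" for l by (simp add: \<tau>_def)
  have \<tau>_alt: "\<tau> k \<circ> \<tau> k' \<in> alt n" if "k < r" "k' < r" for k k'
  proof -
    have "a k \<noteq> b k" "a k' \<noteq> b k'" "{a k, b k, a k', b k'} \<subseteq> {1..n}" using ab that by auto
    thus ?thesis unfolding alt_group_carrier \<tau>_def
      by (auto intro!: permutes_compose permutes_swap_id simp: evenperm_comp evenperm_swap permutation_swap_id)
  qed
  have four: "\<tau> l \<circ> \<tau> m \<circ> (\<tau> p \<circ> \<tau> q) = \<tau> p \<circ> \<tau> q \<circ> (\<tau> l \<circ> \<tau> m)"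
    if "l < r" "m < r" "p < r" "q < r" for l m p q
    using that by (intro comp_commute_pairs \<tau>_comm)
  have r_gt: "0 < r" "1 < r" "2 < r" "3 < r" using r by auto
  have first: "\<tau> 0 = transpose c1 c2" "\<tau> 1 = transpose c3 c4" "\<tau> 2 = transpose c5 c6" "\<tau> 3 = transpose c7 c8"
    by (simp_all add: \<tau>_def a_def b_def ps_def C_def)
  define zs where "zs = map (\<lambda>l. \<tau> 0 \<circ> \<tau> l) [0..<r]"
  have zs: "set zs = (\<lambda>l. \<tau> 0 \<circ> \<tau> l) ` {..<r}" by (auto simp: zs_def)
  define A where "A = {\<tau> 0 \<circ> \<tau> 1, \<tau> 2 \<circ> \<tau> 3}"
  have "alt.tame n v L f"
  proof (rule alt.tame_by_involutions[of zs n A])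
    show "z \<in> alt n" if "z \<in> set zs" for z using that \<tau>_alt r_gt by (auto simp: zs)
    show "z \<circ> z = id" if z: "z \<in> set zs" for z
    proof -
      obtain l where l: "l < r" "z = \<tau> 0 \<circ> \<tau> l" using z by (auto simp: zs)
      have "z \<circ> z = \<tau> 0 \<circ> \<tau> l \<circ> (\<tau> l \<circ> \<tau> 0)" unfolding l(2) by (simp only: \<tau>_comm[OF r_gt(1) l(1)])
      also have "\<dots> = \<tau> 0 \<circ> (\<tau> l \<circ> \<tau> l) \<circ> \<tau> 0" by (simp only: comp_assoc)
      also have "\<dots> = id" by (simp only: \<tau>\<tau> comp_id)
      finally show ?thesis .
    qed
    show "z \<circ> z' = z' \<circ> z" if "z \<in> set zs" "z' \<in> set zs" for z z'
      using that four r_gt by (auto simp: zs simp del: comp_apply)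
    show "z \<circ> y = y \<circ> z" if "z \<in> set zs" "y \<in> A" for z y
      using that four r_gt by (auto simp: zs A_def)
    show "\<forall>y\<in>A. \<forall>x\<in>alt n. f (x \<circ> y) = - f x" using f first by (auto simp: A_def)
    fix h :: "(nat \<Rightarrow> nat) \<Rightarrow> real" assume hA: "\<forall>y\<in>A. \<forall>x\<in>alt n. h (x \<circ> y) = - h x"
      and hz: "\<forall>z\<in>set zs. \<exists>e\<in>{1, -1}. \<forall>x\<in>alt n. h (x \<circ> z) = e * h x"
    show "alt.tame n v L h"
    proof (cases "\<forall>x\<in>alt n. h x = 0")
      case True thus ?thesis using L by (intro alt.tame_zero) auto
    next
      case False
      then obtain x0 where x0: "x0 \<in> alt n" "h x0 \<noteq> 0" by blast
      \<comment> \<open>A single transposition leaves A_n, so the sign of block \<open>l\<close> is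
        measured relative to block 0.\<close>
      have "\<exists>e. l < r \<longrightarrow> (e = 1 \<or> e = -1) \<and> (\<forall>x\<in>alt n. h (x \<circ> (\<tau> 0 \<circ> \<tau> l)) = e * h x)" for l
      proof (cases "l < r")
        case True
        hence "\<tau> 0 \<circ> \<tau> l \<in> set zs" unfolding zs by blast
        thus ?thesis using hz by blast
      qed simp
      then obtain \<sigma> where "\<And>l. l < r \<longrightarrow> (\<sigma> l = 1 \<or> \<sigma> l = -1) \<and>
          (\<forall>x\<in>alt n. h (x \<circ> (\<tau> 0 \<circ> \<tau> l)) = \<sigma> l * h x)" by metis
      then obtain \<sigma> where \<sigma>: "\<And>l. l < r \<Longrightarrow> \<sigma> l = 1 \<or> \<sigma> l = (-1 :: real)"
        and h\<sigma>: "\<And>l x. l < r \<Longrightarrow> x \<in> alt n \<Longrightarrow> h (x \<circ> (\<tau> 0 \<circ> \<tau> l)) = \<sigma> l * h x" by blast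
      have P: "h (x \<circ> (\<tau> l \<circ> \<tau> m)) = \<sigma> l * \<sigma> m * h x" if "l < r" "m < r" "x \<in> alt n" for l m x
      proof -
        have "(\<tau> l \<circ> \<tau> 0) \<circ> (\<tau> 0 \<circ> \<tau> m) = \<tau> l \<circ> (\<tau> 0 \<circ> \<tau> 0) \<circ> \<tau> m" by (simp only: comp_assoc)
        hence "\<tau> l \<circ> \<tau> m = (\<tau> 0 \<circ> \<tau> l) \<circ> (\<tau> 0 \<circ> \<tau> m)"
          by (simp only: \<tau>\<tau> comp_id \<tau>_comm[OF that(1) r_gt(1)])
        hence "x \<circ> (\<tau> l \<circ> \<tau> m) = (x \<circ> (\<tau> 0 \<circ> \<tau> l)) \<circ> (\<tau> 0 \<circ> \<tau> m)"
          by (simp only: comp_assoc)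
        thus ?thesis
          using h\<sigma>[OF that(2) alt.comp_G[OF that(3) \<tau>_alt[OF r_gt(1) that(1)]]] h\<sigma>[OF that(1,3)] by simp
      qed
      have "h (x0 \<circ> (\<tau> 0 \<circ> \<tau> 1)) = - h x0" "h (x0 \<circ> (\<tau> 2 \<circ> \<tau> 3)) = - h x0"
        using hA x0 by (auto simp: A_def)
      hence "\<sigma> 0 * \<sigma> 1 * h x0 = -1 * h x0" "\<sigma> 2 * \<sigma> 3 * h x0 = -1 * h x0"
        using P[OF r_gt(1,2) x0(1)] P[OF r_gt(3,4) x0(1)] by (simp_all del: comp_apply)
      hence opp: "\<sigma> 0 * \<sigma> 1 = -1" "\<sigma> 2 * \<sigma> 3 = -1"
        by (simp_all only: mult_right_cancel[OF x0(2)])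
      define S S' where "S = {l. l < r \<and> \<sigma> l = 1}" and "S' = {l. l < r \<and> \<sigma> l = -1}"
      have "S \<union> S' = {..<r}" "S \<inter> S' = {}" using \<sigma> by (auto simp: S_def S'_def)
      hence sum: "card S + card S' = r"
        by (metis card_Un_disjoint card_lessThan finite_Un finite_lessThan)
      have two: "2 \<le> card T" if T: "\<exists>i\<in>{0, 1}. i \<in> T" "\<exists>j\<in>{2, 3}. j \<in> T" "T \<subseteq> {..<r}" for T
      proof -
        obtain i where i: "i \<in> {0, 1}" "i \<in> T" using T(1) by (rule bexE)
        obtain j where j: "j \<in> {2, 3}" "j \<in> T" using T(2) by (rule bexE)
        have "finite T" using T(3) finite_lessThan by (rule finite_subset)
        hence "card {i, j} \<le> card T" using i j by (intro card_mono) simp_all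
        moreover have "i \<noteq> j" using i(1) j(1) by auto
        ultimately show ?thesis by simp
      qed
      have "\<exists>i\<in>{0, 1}. i \<in> S" "\<exists>i\<in>{2, 3}. i \<in> S" "\<exists>i\<in>{0, 1}. i \<in> S'" "\<exists>i\<in>{2, 3}. i \<in> S'"
        using opp \<sigma>[OF r_gt(1)] \<sigma>[OF r_gt(2)] \<sigma>[OF r_gt(3)] \<sigma>[OF r_gt(4)] r_gt
        by (auto simp: S_def S'_def)
      moreover have "S \<subseteq> {..<r}" "S' \<subseteq> {..<r}" by (auto simp: S_def S'_def)
      ultimately have "2 \<le> card S" "2 \<le> card S'" using two[of S] two[of S'] by simp_all
      hence card: "2 \<le> card S" "card S + 2 \<le> r" using sum by auto
      show ?thesis
      proof (rule alt.tame_invariant_class[where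
            P = "\<lambda>g. \<forall>l<r. \<forall>m<r. \<forall>x\<in>alt n. g (x \<circ> (\<tau> l \<circ> \<tau> m)) = \<sigma> l * \<sigma> m * g x"])
        fix u g assume g: "\<forall>l<r. \<forall>m<r. \<forall>x\<in>alt n. g (x \<circ> (\<tau> l \<circ> \<tau> m)) = \<sigma> l * \<sigma> m * g x"
        show "\<forall>l<r. \<forall>m<r. \<forall>x\<in>alt n. alt.conv n u g (x \<circ> (\<tau> l \<circ> \<tau> m)) = \<sigma> l * \<sigma> m * alt.conv n u g x"
        proof (intro allI impI ballI)
          fix l m x assume lm: "l < r" "m < r" and x: "x \<in> alt n"
          have "alt.conv n u g (x \<circ> (\<tau> l \<circ> \<tau> m)) = alt.conv n u (\<lambda>x. g (x \<circ> (\<tau> l \<circ> \<tau> m))) x"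
            by (rule alt.conv_right[symmetric])
          also have "\<dots> = alt.conv n u (\<lambda>x. (\<sigma> l * \<sigma> m) * g x) x"
            by (rule alt.conv_cong) (use g lm x in auto)
          finally show "alt.conv n u g (x \<circ> (\<tau> l \<circ> \<tau> m)) = \<sigma> l * \<sigma> m * alt.conv n u g x"
            by (simp add: alt.conv_scale)
        qed
      next
        fix u g assume u: "alt.nsq n u = alt.nsq n v"
          and g: "\<forall>l<r. \<forall>m<r. \<forall>x\<in>alt n. g (x \<circ> (\<tau> l \<circ> \<tau> m)) = \<sigma> l * \<sigma> m * g x"
        have "real (r choose 2) * alt.nsq n (alt.conv n u g) \<le> real (card (alt n)) * alt.nsq n u * alt.nsq n g"
          by (rule pattern_bound[OF r(1) ab \<sigma>]) (use g card in \<open>auto simp: \<tau>_def S_def\<close>)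
        thus "alt.nsq n (alt.conv n u g) \<le> L * alt.nsq n g"
          using r2 u by (simp add: L_def field_simps)
      qed (use P L in auto)
    qed
  qed
  thus ?thesis by (simp add: L_def)
qed

lemma V2_add: "V2 n f \<Longrightarrow> V2 n g \<Longrightarrow> V2 n (\<lambda>x. f x + g x)"
  by (simp add: V2_def sum.distrib)

lemma V2_scale: "V2 n f \<Longrightarrow> V2 n (\<lambda>x. c * f x)"
  by (simp add: V2_def sum_distrib_left[symmetric])

text \<open>The orthogonal complement in \<^const>\<open>V2\<close> of the mixed differences of point masses is zero, so
  that every function in \<^const>\<open>V2\<close> is a combination of tame functions.\<close>

theorem nsq_conv_V2:
  assumes V2: "V2 n f" and r: "odd r" "5 \<le> r" "2 * r \<le> n"
  shows "real (r choose 2) * alt.nsq n (alt.conv n v f) \<le> real (card (alt n)) * alt.nsq n v * alt.nsq n f"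
proof -
  define L where "L = real (card (alt n)) * alt.nsq n v / real (r choose 2)"
  have L: "L \<ge> 0" by (simp add: L_def alt.nsq_nonneg)
  have r2: "real (r choose 2) > 0" using r by (simp add: zero_less_binomial_iff)
  define W where "W = {h. V2 n h \<and> alt.tame n v L h}"
  define \<delta> where "\<delta> h x = (of_bool (x = h) :: real)" for h x :: "nat \<Rightarrow> nat"
  define D where "D s t h x = \<delta> h x - \<delta> h (x \<circ> s) - \<delta> h (x \<circ> t) + \<delta> h (x \<circ> s \<circ> t)" for s t h x :: "nat \<Rightarrow> nat"
  define good where "good s t \<longleftrightarrow> (\<exists>J J'. J \<union> J' \<subseteq> {1..n} \<and> J \<inter> J' = {} \<and> dtrans J s \<and> dtrans J' t)" for s t
  define E where "E = {D s t h | s t h. s \<in> alt n \<and> t \<in> alt n \<and> h \<in> alt n \<and> good s t}"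
  have "E \<subseteq> (\<lambda>(s, t, h). D s t h) ` (alt n \<times> alt n \<times> alt n)"
    unfolding E_def by (force intro: rev_image_eqI)
  hence finE: "finite E" by (rule finite_subset) (simp add: alt.finite_G)
  have D_W: "D s t h \<in> W" if st: "s \<in> alt n" "t \<in> alt n" "h \<in> alt n" "good s t" for s t h
  proof -
    obtain J J' where J: "J \<union> J' \<subseteq> {1..n}" "J \<inter> J' = {}" "dtrans J s" "dtrans J' t"
      using st(4) unfolding good_def by blast
    have comm: "s \<circ> t = t \<circ> s" using dtrans_commute J by blast
    have invo: "s \<circ> s = id" "t \<circ> t = id" using dtrans_involution J by auto
    have cancel: "x \<circ> s \<circ> s = x" "x \<circ> t \<circ> t = x" "x \<circ> t \<circ> s = x \<circ> s \<circ> t" for x :: "nat \<Rightarrow> nat"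
      by (simp_all only: comp_assoc invo comp_id comm)
    have Ds: "D s t h (x \<circ> s) = - D s t h x" for x unfolding D_def by (simp add: cancel)
    have Dt: "D s t h (x \<circ> t) = - D s t h x" for x
      unfolding D_def by (simp add: cancel(3)) (simp add: cancel)
    have V2D: "V2 n (D s t h)" unfolding V2_def
    proof (intro ballI)
      fix i j assume "i \<in> {1..n}" "j \<in> {1..n}"
      \<comment> \<open>Every point \<open>i\<close> lies outside \<open>J\<close> or outside
        \<open>J'\<close>. The involution that fixes \<open>i\<close> preserves the condition
        \<open>x i = j\<close> and negates \<open>D s t h\<close>, so the sum vanishes.\<close>
      have anti: "(\<Sum>x | x \<in> alt n \<and> x i = j. D s t h x) = 0"
        if w: "w \<in> alt n" "w \<circ> w = id" "w i = i" "\<And>x. D s t h (x \<circ> w) = - D s t h x" for w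
      proof -
        have "(\<Sum>x | x \<in> alt n \<and> x i = j. D s t h (x \<circ> w)) = (\<Sum>x | x \<in> alt n \<and> x i = j. D s t h x)"
          using sum_filter_right[OF w(1,2), where Q = "\<lambda>x. x i = j" and F = "D s t h"] w(3) by simp
        thus ?thesis by (simp add: w(4) sum_negf)
      qed
      show "(\<Sum>x | x \<in> alt n \<and> x i = j. D s t h x) = 0"
      proof (cases "i \<in> J")
        case True
        hence "t i = i" using J dtrans_outside by blast
        thus ?thesis using anti[OF st(2) invo(2)] Dt by blast
      next
        case False
        hence "s i = i" using J dtrans_outside by blast
        thus ?thesis using anti[OF st(1) invo(1)] Ds by blast
      qed
    qed
    obtain c1 c2 c3 c4 where c: "{c1, c2, c3, c4} \<subseteq> J" "distinct [c1, c2, c3, c4]"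
      "s = transpose c1 c2 \<circ> transpose c3 c4" using J(3) unfolding dtrans_def by blast
    obtain c5 c6 c7 c8 where c': "{c5, c6, c7, c8} \<subseteq> J'" "distinct [c5, c6, c7, c8]"
      "t = transpose c5 c6 \<circ> transpose c7 c8" using J(4) unfolding dtrans_def by blast
    have "alt.tame n v L (D s t h)"
      unfolding L_def
    proof (rule tame_mixed_difference)
      have "{c1, c2, c3, c4} \<inter> {c5, c6, c7, c8} = {}" using c(1) c'(1) J(2) by blast
      thus "distinct [c1, c2, c3, c4, c5, c6, c7, c8]" using c(2) c'(2) by auto
      show "{c1, c2, c3, c4, c5, c6, c7, c8} \<subseteq> {1..n}" using c(1) c'(1) J(1) by blast
      show "D s t h (x \<circ> (transpose c1 c2 \<circ> transpose c3 c4)) = - D s t h x"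
        "D s t h (x \<circ> (transpose c5 c6 \<circ> transpose c7 c8)) = - D s t h x" for x
        using Ds Dt c(3) c'(3) by auto
    qed (use r in auto)
    thus ?thesis using V2D by (simp add: W_def)
  qed
  obtain g where g: "g \<in> W" "\<forall>e\<in>E. alt.ip n (\<lambda>x. f x - g x) e = 0"
  proof -
    have "\<exists>s\<in>W. (\<forall>e\<in>E. alt.ip n (\<lambda>x. f x - s x) e = 0) \<and>
        (\<forall>h. (\<forall>e\<in>E. alt.ip n h e = 0) \<longrightarrow> alt.ip n h s = 0)"
    proof (rule alt.orthogonal_remainder[OF finE])
      show "E \<subseteq> W" using D_W by (auto simp: E_def)
      show "(\<lambda>x. a x + b x) \<in> W" if "a \<in> W" "b \<in> W" for a b
        using that V2_add alt.tame_add by (auto simp: W_def)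
      show "(\<lambda>x. c * a x) \<in> W" if "a \<in> W" for a c
        using that V2_scale alt.tame_scale by (auto simp: W_def)
      show "(\<lambda>x. 0) \<in> W" using alt.tame_zero L by (auto simp: W_def V2_def)
    qed
    thus thesis using that by blast
  qed
  define q where "q x = f x - g x" for x
  have V2g: "V2 n g" using g by (simp add: W_def)
  have V2q: "V2 n q"
    using V2_add[OF V2 V2_scale[OF V2g, of "-1"]] by (simp add: q_def[abs_def])
  \<comment> \<open>Since \<open>s\<close>, \<open>t\<close> and \<open>s \<circ> t\<close> are
    involutions, the inner product of \<open>q\<close> with \<open>D s t h\<close> is exactly the
    mixed difference of \<open>q\<close> at \<open>h\<close>.\<close>
  have "mixed_differences_vanish n q"
    unfolding mixed_differences_vanish_def
  proof (intro allI impI)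
    fix J J' s t h assume J: "J \<union> J' \<subseteq> {1..n}" "J \<inter> J' = {}" "dtrans J s" "dtrans J' t" and h: "h \<in> alt n"
    have st: "s \<in> alt n" "t \<in> alt n" using J dtrans_in_alt by auto
    have "good s t" unfolding good_def using J by blast
    hence "alt.ip n q (D s t h) = 0" using g(2) st h by (auto simp: E_def q_def[abs_def])
    have comm: "s \<circ> t = t \<circ> s" using dtrans_commute J by blast
    have invo: "s \<circ> s = id" "t \<circ> t = id" using dtrans_involution J by auto
    have cancel: "x \<circ> s \<circ> s = x" "x \<circ> t \<circ> t = x" "x \<circ> t \<circ> s = x \<circ> s \<circ> t" for x :: "nat \<Rightarrow> nat"
      by (simp_all only: comp_assoc invo comp_id comm)
    have point: "(\<Sum>x\<in>alt n. q x * \<delta> h (x \<circ> w)) = q (h \<circ> w)"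
      if w: "w \<in> alt n" "\<And>x :: nat \<Rightarrow> nat. x \<circ> w \<circ> w = x" for w
    proof -
      have "(\<Sum>x\<in>alt n. q x * \<delta> h (x \<circ> w)) = (\<Sum>x\<in>alt n. if x = h \<circ> w then q x else 0)"
        by (intro sum.cong refl) (use w(2) in \<open>auto simp: \<delta>_def simp del: comp_apply\<close>)
      thus ?thesis using alt.comp_G[OF h w(1)] alt.finite_G by simp
    qed
    have "alt.ip n q (D s t h) = (\<Sum>x\<in>alt n. q x * \<delta> h (x \<circ> id)) - (\<Sum>x\<in>alt n. q x * \<delta> h (x \<circ> s)) -
        (\<Sum>x\<in>alt n. q x * \<delta> h (x \<circ> t)) + (\<Sum>x\<in>alt n. q x * \<delta> h (x \<circ> (s \<circ> t)))"
      by (simp add: alt.ip_def D_def algebra_simps sum.distrib sum_subtractf comp_assoc)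
    also have "\<dots> = q (h \<circ> id) - q (h \<circ> s) - q (h \<circ> t) + q (h \<circ> (s \<circ> t))"
    proof -
      have "x \<circ> (s \<circ> t) \<circ> (s \<circ> t) = x" for x :: "nat \<Rightarrow> nat"
        using cancel by (metis comp_assoc)
      thus ?thesis
        using point[OF alt.id_G] point[OF st(1)] point[OF st(2)] point[OF alt.comp_G[OF st]] cancel by simp
    qed
    finally show "q h - q (h \<circ> s) - q (h \<circ> t) + q (h \<circ> s \<circ> t) = 0"
      using \<open>alt.ip n q (D s t h) = 0\<close> by (simp add: comp_assoc)
  qed
  hence "q x = 0" if "x \<in> alt n" for x using V2_mixed_zero[OF V2q] r that by simp
  hence eq: "f x = g x" if "x \<in> alt n" for x using that by (simp add: q_def)
  have "alt.nsq n (alt.conv n v f) = alt.nsq n (alt.conv n v g)"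
    unfolding alt.nsq_def using alt.conv_cong[of n f g] eq by (intro sum.cong) auto
  also have "\<dots> \<le> L * alt.nsq n g" by (rule alt.nsq_conv_tame) (use g L in \<open>auto simp: W_def\<close>)
  also have "alt.nsq n g = alt.nsq n f" unfolding alt.nsq_def using eq by (intro sum.cong) auto
  finally show ?thesis using r2 by (simp add: L_def field_simps)
qed

section \<open>Products with a full cycle\<close>

text \<open>An n-cycle without its list: the order divides n and the orbit of 1 is everything.
  Properties invariant under \<open>c\<close> then spread from the point 1 to all points.\<close>

definition full_cycle :: "nat \<Rightarrow> (nat \<Rightarrow> nat) \<Rightarrow> bool"
  where "full_cycle n c \<longleftrightarrow> c \<in> alt n \<and> c ^^ n = id \<and> (\<forall>i\<in>{1..n}. \<exists>k. (c ^^ k) 1 = i)"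

lemma funpow_in_alt: "c \<in> alt n \<Longrightarrow> c ^^ k \<in> alt n"
  by (induction k) (auto intro: alt.comp_G alt.id_G simp del: comp_apply)

lemma full_cycle_funpow_induct:
  assumes "full_cycle n c" "P 1" "\<And>i. i \<in> {1..n} \<Longrightarrow> P i \<Longrightarrow> P (c i)" "i \<in> {1..n}"
  shows "P i"
proof -
  have c: "c \<in> alt n" using assms(1) by (simp add: full_cycle_def)
  obtain k where k: "(c ^^ k) 1 = i" using assms(1,4) unfolding full_cycle_def by blast
  have "1 \<in> {1..n}" using assms(4) by auto
  hence "(c ^^ k) 1 \<in> {1..n} \<and> P ((c ^^ k) 1)" for k
    using assms(2,3) alt_apply_mem[OF c] by (induction k) auto
  thus ?thesis using k by metis
qed

lemma full_cycle_no_fixed_point: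
  assumes "full_cycle n c" "n \<ge> 2" "i \<in> {1..n}"
  shows "c i \<noteq> i"
proof -
  have c: "c \<in> alt n" using assms(1) by (simp add: full_cycle_def)
  have "c 1 \<noteq> 1"
  proof
    assume "c 1 = 1"
    have "2 = (1 :: nat)"
      by (rule full_cycle_funpow_induct[OF assms(1), where P = "\<lambda>i. i = 1"])
        (use assms(2) \<open>c 1 = 1\<close> in auto)
    thus False by simp
  qed
  thus ?thesis
    by (rule full_cycle_funpow_induct[OF assms(1), where P = "\<lambda>i. c i \<noteq> i"])
      (use assms(3) alt_eq_iff[OF c] in auto)
qed

lemma sum_filter_translate:
  assumes "g \<in> alt n"
  shows "(\<Sum>x | x \<in> alt n \<and> Q (x \<circ> g). F (x \<circ> g)) = (\<Sum>x | x \<in> alt n \<and> Q x. F x :: real)"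
proof -
  have "(\<Sum>x | x \<in> alt n \<and> Q (x \<circ> g). F (x \<circ> g)) = (\<Sum>x\<in>alt n. if Q (x \<circ> g) then F (x \<circ> g) else 0)"
    by (rule sum.inter_filter[OF alt.finite_G])
  also have "\<dots> = (\<Sum>x\<in>alt n. if Q x then F x else 0)" by (rule alt.sum_right[OF assms])
  also have "\<dots> = (\<Sum>x | x \<in> alt n \<and> Q x. F x)"
    by (rule sum.inter_filter[OF alt.finite_G, symmetric])
  finally show ?thesis .
qed

text \<open>The standard representation has no nonzero vector fixed by a full cycle.\<close>

lemma V2_cycle_invariant:
  assumes c: "full_cycle n c" and inv: "\<And>x. x \<in> alt n \<Longrightarrow> f (x \<circ> c) = f x"
    and sum: "(\<Sum>x\<in>alt n. f x) = 0"
  shows "V2 n f"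
  unfolding V2_def
proof (intro ballI)
  fix i j assume i: "i \<in> {1..n}" and j: "j \<in> {1..n}"
  have c_alt: "c \<in> alt n" using c by (simp add: full_cycle_def)
  define D where "D i = (\<Sum>x | x \<in> alt n \<and> x i = j. f x)" for i
  have step: "D (c i) = D i" for i
  proof -
    have "D (c i) = (\<Sum>x | x \<in> alt n \<and> (x \<circ> c) i = j. f (x \<circ> c))"
      unfolding D_def comp_apply by (intro sum.cong) (use inv in \<open>auto simp: comp_def\<close>)
    also have "\<dots> = D i"
      unfolding D_def by (rule sum_filter_translate[OF c_alt, where Q = "\<lambda>x. x i = j"])
    finally show ?thesis .
  qed
  have const: "D k = D 1" if "k \<in> {1..n}" for k
    by (rule full_cycle_funpow_induct[OF c, where P = "\<lambda>k. D k = D 1"]) (use step that in auto)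
  have "(\<Sum>k\<in>{1..n}. \<Sum>x | x \<in> alt n \<and> True \<and> x k = j. f x) = (\<Sum>x | x \<in> alt n \<and> True. f x)"
    by (rule sum_prescribe_point) (use j alt_apply_mem alt.inv_G in blast)+
  hence "(\<Sum>k\<in>{1..n}. D k) = 0" using sum by (simp add: D_def)
  moreover have "(\<Sum>k\<in>{1..n}. D k) = (\<Sum>k\<in>{1..n}. D 1)" by (intro sum.cong refl const)
  ultimately have "D 1 = 0" using i by auto
  thus "(\<Sum>x | x \<in> alt n \<and> x i = j. f x) = 0" using const[OF i] by (simp add: D_def)
qed

section \<open>Powers of a subset of the alternating group\<close>

abbreviation prods :: "nat \<Rightarrow> (nat \<Rightarrow> nat) set \<Rightarrow> nat \<Rightarrow> (nat \<Rightarrow> nat) set"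
  where "prods n B k \<equiv> set_power (alt_group n) B k"

lemma foldr_comp_append: "foldr (\<circ>) (xs @ ys) id = foldr (\<circ>) xs id \<circ> foldr (\<circ>) ys id"
proof (induction xs)
  case Nil thus ?case by (simp add: fun_eq_iff)
next
  case (Cons x xs)
  thus ?case by (simp only: append_Cons foldr.simps comp_apply comp_assoc)
qed

lemma prods_alt_def: "prods n B k = {foldr (\<circ>) bs id | bs. length bs = k \<and> set bs \<subseteq> B}"
  by (simp add: set_power_def alt_group_mult alt_group_one)

lemma prods_0: "id \<in> prods n B 0" by (auto simp: prods_alt_def)

lemma prods_1: "a \<in> B \<Longrightarrow> a \<in> prods n B 1"
  unfolding prods_alt_def by (rule CollectI, rule exI[of _ "[a]"]) simp

lemma prods_mult: "a \<in> prods n B j \<Longrightarrow> b \<in> prods n B k \<Longrightarrow> a \<circ> b \<in> prods n B (j + k)"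
proof -
  assume "a \<in> prods n B j" "b \<in> prods n B k"
  then obtain xs ys where "a = foldr (\<circ>) xs id" "length xs = j" "set xs \<subseteq> B"
    "b = foldr (\<circ>) ys id" "length ys = k" "set ys \<subseteq> B" unfolding prods_alt_def by blast
  hence "a \<circ> b = foldr (\<circ>) (xs @ ys) id" "length (xs @ ys) = j + k" "set (xs @ ys) \<subseteq> B"
    by (simp_all only: foldr_comp_append length_append set_append Un_subset_iff)
  thus ?thesis unfolding prods_alt_def by blast
qed

lemma prods_Suc: "b \<in> prods n B (Suc k) \<Longrightarrow> \<exists>a\<in>B. \<exists>z\<in>prods n B k. b = a \<circ> z"
proof -
  assume "b \<in> prods n B (Suc k)"
  then obtain bs where bs: "b = foldr (\<circ>) bs id" "length bs = Suc k" "set bs \<subseteq> B"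
    unfolding prods_alt_def by blast
  then obtain a zs where a: "bs = a # zs" by (cases bs) auto
  have "foldr (\<circ>) zs id \<in> prods n B k" using bs a unfolding prods_alt_def by auto
  moreover have "b = a \<circ> foldr (\<circ>) zs id" using bs a by simp
  ultimately show ?thesis using bs a by auto
qed

lemma prods_subset: "B \<subseteq> alt n \<Longrightarrow> prods n B k \<subseteq> alt n"
proof (induction k)
  case 0
  thus ?case using alt.id_G by (auto simp: prods_alt_def)
next
  case (Suc k)
  show ?case
  proof
    fix b assume "b \<in> prods n B (Suc k)"
    then obtain a z where "a \<in> B" "z \<in> prods n B k" "b = a \<circ> z" using prods_Suc by blast
    thus "b \<in> alt n" using Suc alt.comp_G by blast
  qed
qed

lemma prods_mono: "A \<subseteq> B \<Longrightarrow> prods n A k \<subseteq> prods n B k"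
  unfolding prods_alt_def by blast

lemma prods_inv:
  assumes "B \<subseteq> alt n" "\<And>b. b \<in> B \<Longrightarrow> inv' b \<in> B" "z \<in> prods n B k"
  shows "inv' z \<in> prods n B k"
  using assms(3)
proof (induction k arbitrary: z)
  case 0 thus ?case by (auto simp: prods_alt_def)
next
  case (Suc k)
  then obtain a y where ay: "a \<in> B" "y \<in> prods n B k" "z = a \<circ> y" using prods_Suc by blast
  have "inv' z = inv' y \<circ> inv' a"
    unfolding ay(3) by (rule alt.inv_of_comp) (use ay assms(1) prods_subset in blast)+
  moreover have "inv' y \<circ> inv' a \<in> prods n B (k + 1)"
    using Suc.IH[OF ay(2)] prods_1 assms(2) ay(1) by (intro prods_mult) auto
  ultimately show ?case by (simp only: Suc_eq_plus1)
qed

lemma nsq_indicator: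
  assumes "S \<subseteq> alt n"
  shows "alt.nsq n (\<lambda>x. of_bool (x \<in> S) / real (card S)) = 1 / real (card S)"
    and "S \<noteq> {} \<Longrightarrow> (\<Sum>x\<in>alt n. of_bool (x \<in> S) / real (card S)) = 1"
proof -
  have fin: "finite S" using assms alt.finite_G finite_subset by blast
  have card: "(\<Sum>x\<in>alt n. of_bool (x \<in> S)) = real (card S)"
    using assms alt.finite_G by (simp add: Int_absorb1 Int_absorb2)
  have sq: "(of_bool b)\<^sup>2 = (of_bool b :: real)" for b by simp
  have "alt.nsq n (\<lambda>x. of_bool (x \<in> S) / real (card S)) = (\<Sum>x\<in>alt n. of_bool (x \<in> S)) / (real (card S))\<^sup>2"
    by (simp only: alt.nsq_def power_divide sq sum_divide_distrib)
  also have "\<dots> = 1 / real (card S)" unfolding card by (simp add: power2_eq_square)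
  finally show "alt.nsq n (\<lambda>x. of_bool (x \<in> S) / real (card S)) = 1 / real (card S)" .
  show "(\<Sum>x\<in>alt n. of_bool (x \<in> S) / real (card S)) = 1" if "S \<noteq> {}"
    using card fin that by (simp only: sum_divide_distrib[symmetric]) simp
qed

lemma nsq_minus_mean:
  assumes "(\<Sum>x\<in>alt n. q x) = 1"
  shows "alt.nsq n (\<lambda>x. q x - 1 / real (card (alt n))) \<le> alt.nsq n q"
proof -
  define g where "g = real (card (alt n))"
  have g: "g > 0" using alt.card_G_pos by (simp add: g_def)
  have "alt.nsq n (\<lambda>x. q x - 1 / g) = (\<Sum>x\<in>alt n. (q x)\<^sup>2 - 2 / g * q x + 1 / g\<^sup>2)"
    unfolding alt.nsq_def by (intro sum.cong refl) (simp add: power2_diff power_divide)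
  also have "\<dots> = alt.nsq n q - 2 / g * 1 + g * (1 / g\<^sup>2)"
    unfolding sum.distrib sum_subtractf sum_distrib_left[symmetric] assms
    by (simp add: alt.nsq_def g_def)
  also have "\<dots> = alt.nsq n q - 1 / g" using g by (simp add: power2_eq_square)
  finally show ?thesis using g by (simp add: g_def)
qed

text \<open>Averaging the uniform measure on \<open>S\<close> over the cycle puts it into the span of the constants and
  \<^const>\<open>V2\<close>, where convolution with \<open>S\<close> contracts; so almost all of the group lies in
  \<open>S^(j+1) \<langle>c\<rangle>\<close>.\<close>

lemma card_not_in_product_with_cycle:
  assumes c: "full_cycle n c" and S: "S \<subseteq> alt n" "S \<noteq> {}" and n: "n \<ge> 1"
    and r: "odd r" "5 \<le> r" "2 * r \<le> n"
  defines "g \<equiv> real (card (alt n))"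
  shows "real (card {x \<in> alt n. \<not> (\<exists>z\<in>prods n S (Suc j). \<exists>i. x = z \<circ> c ^^ i)}) \<le>
    g\<^sup>2 * ((g / (real (r choose 2) * real (card S))) ^ j / real (card S))"
proof -
  have c_alt: "c \<in> alt n" and c_pow: "c ^^ n = id" using c by (auto simp: full_cycle_def)
  have finS: "finite S" using S alt.finite_G finite_subset by blast
  have s: "real (card S) > 0" using finS S by (simp add: card_gt_0_iff)
  have g: "g > 0" using alt.card_G_pos by (simp add: g_def)
  define v where "v x = (of_bool (x \<in> S) / real (card S) :: real)" for x
  have nsq_v: "alt.nsq n v = 1 / real (card S)" and sum_v: "(\<Sum>x\<in>alt n. v x) = 1"
    using nsq_indicator[OF S(1)] S(2) by (auto simp: v_def[abs_def])
  define q where "q x = (\<Sum>i<n. v (x \<circ> c ^^ i)) / real n" for x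
  have q_c: "q (x \<circ> c) = q x" for x
  proof -
    define F where "F i = v (x \<circ> c ^^ i)" for i
    have "x \<circ> c \<circ> c ^^ i = x \<circ> c ^^ Suc i" for i by (simp only: comp_assoc funpow.simps(2))
    hence "(\<Sum>i<n. v (x \<circ> c \<circ> c ^^ i)) = (\<Sum>i<n. F (Suc i))" by (simp only: F_def)
    also have "F 0 + (\<Sum>i<n. F (Suc i)) = (\<Sum>i<n. F i) + F n"
      using sum.lessThan_Suc_shift[of F n] sum.lessThan_Suc[of F n] by simp
    hence "(\<Sum>i<n. F (Suc i)) = (\<Sum>i<n. F i)" by (simp add: F_def c_pow)
    finally show ?thesis by (simp add: q_def F_def)
  qed
  have sum_q: "(\<Sum>x\<in>alt n. q x) = 1"
  proof -
    have "(\<Sum>x\<in>alt n. q x) = (\<Sum>i<n. \<Sum>x\<in>alt n. v (x \<circ> c ^^ i)) / real n"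
      unfolding q_def sum_divide_distrib[symmetric] by (subst sum.swap) (rule refl)
    also have "\<dots> = (\<Sum>i<n. 1) / real n"
      using alt.sum_right[OF funpow_in_alt[OF c_alt], of v] by (simp only: sum_v)
    finally show ?thesis using n by simp
  qed
  \<comment> \<open>By Cauchy-Schwarz an average of translates has at most the norm of one of them,
    so averaging over the cycle keeps the initial bound \<open>1 / card S\<close>.\<close>
  have nsq_q: "alt.nsq n q \<le> 1 / real (card S)"
  proof -
    have "(q x)\<^sup>2 \<le> (\<Sum>i<n. (v (x \<circ> c ^^ i))\<^sup>2) / real n" for x
    proof -
      have "(\<Sum>i<n. 1 * v (x \<circ> c ^^ i))\<^sup>2 \<le> (\<Sum>i<n. 1\<^sup>2) * (\<Sum>i<n. (v (x \<circ> c ^^ i))\<^sup>2)"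
        by (rule Cauchy_Schwarz_ineq_sum)
      hence "(\<Sum>i<n. v (x \<circ> c ^^ i))\<^sup>2 / (real n)\<^sup>2 \<le> real n * (\<Sum>i<n. (v (x \<circ> c ^^ i))\<^sup>2) / (real n)\<^sup>2"
        by (intro divide_right_mono) auto
      thus ?thesis using n by (simp add: q_def power_divide power2_eq_square)
    qed
    hence "alt.nsq n q \<le> (\<Sum>x\<in>alt n. (\<Sum>i<n. (v (x \<circ> c ^^ i))\<^sup>2) / real n)"
      unfolding alt.nsq_def by (intro sum_mono)
    also have "\<dots> = (\<Sum>i<n. \<Sum>x\<in>alt n. (v (x \<circ> c ^^ i))\<^sup>2) / real n"
      unfolding sum_divide_distrib[symmetric] by (subst sum.swap) (rule refl)
    also have "\<dots> = (\<Sum>i<n. alt.nsq n v) / real n"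
      using alt.sum_right[OF funpow_in_alt[OF c_alt], of "\<lambda>x. (v x)\<^sup>2"] by (simp only: alt.nsq_def)
    finally show ?thesis using n nsq_v by simp
  qed
  define Q where "Q j = (alt.conv n v ^^ j) q" for j
  define f where "f j x = Q j x - 1 / g" for j x
  define \<rho> where "\<rho> = g / (real (r choose 2) * real (card S))"
  have r2: "real (r choose 2) > 0" using r by (simp add: zero_less_binomial_iff)
  have \<rho>: "\<rho> \<ge> 0" using g by (simp add: \<rho>_def)
  have Q_Suc: "Q (Suc j) = alt.conv n v (Q j)" for j by (simp add: Q_def)
  have Q: "Q j (x \<circ> c) = Q j x \<and> (\<Sum>x\<in>alt n. Q j x) = 1" for j x
  proof (induction j arbitrary: x)
    case 0 show ?case using q_c sum_q by (simp only: Q_def funpow_0)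
  next
    case (Suc j)
    have "(\<lambda>x. Q j (x \<circ> c)) = Q j" using Suc by (simp add: fun_eq_iff del: comp_apply)
    hence "Q (Suc j) (x \<circ> c) = Q (Suc j) x" unfolding Q_Suc by (metis alt.conv_right)
    moreover have "(\<Sum>x\<in>alt n. Q (Suc j) x) = 1" using Suc by (simp only: Q_Suc alt.sum_conv sum_v)
    ultimately show ?case ..
  qed
  have V2f: "V2 n (f j)" for j
  proof (rule V2_cycle_invariant[OF c])
    show "f j (x \<circ> c) = f j x" for x using Q by (simp add: f_def)
    show "(\<Sum>x\<in>alt n. f j x) = 0" using Q g by (simp add: f_def sum_subtractf g_def)
  qed
  have f_Suc: "f (Suc j) = alt.conv n v (f j)" for j
  proof
    fix x
    have "alt.conv n v (f j) x = alt.conv n v (Q j) x - (\<Sum>y\<in>alt n. v y) * (1 / g)"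
      unfolding alt.conv_def f_def by (simp add: right_diff_distrib sum_subtractf sum_distrib_right sum_divide_distrib)
    thus "f (Suc j) x = alt.conv n v (f j) x" by (simp add: f_def Q_Suc sum_v)
  qed
  have nsq_f: "alt.nsq n (f j) \<le> \<rho> ^ j * (1 / real (card S))" for j
  proof (induction j)
    case 0
    have "alt.nsq n (f 0) \<le> alt.nsq n q"
      using nsq_minus_mean[OF sum_q] by (simp add: f_def[abs_def] Q_def g_def)
    thus ?case using nsq_q by simp
  next
    case (Suc j)
    have "real (r choose 2) * alt.nsq n (f (Suc j)) \<le> g * (1 / real (card S)) * alt.nsq n (f j)"
      using nsq_conv_V2[OF V2f r, of v j] by (simp add: f_Suc nsq_v g_def)
    hence "alt.nsq n (f (Suc j)) \<le> \<rho> * alt.nsq n (f j)"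
      using r2 s by (simp add: \<rho>_def field_simps)
    also have "\<dots> \<le> \<rho> * (\<rho> ^ j * (1 / real (card S)))" using Suc \<rho> by (rule mult_left_mono)
    finally show ?case by simp
  qed
  have supp: "\<exists>z\<in>prods n S (Suc j). \<exists>i. x = z \<circ> c ^^ i" if "x \<in> alt n" "Q j x \<noteq> 0" for x j
    using that
  proof (induction j arbitrary: x)
    case 0
    hence "\<exists>i<n. v (x \<circ> c ^^ i) \<noteq> 0" by (auto simp: Q_def q_def intro: ccontr)
    then obtain i where i: "x \<circ> c ^^ i \<in> S" "i < n" by (auto simp: v_def split: if_splits)
    have "c ^^ i \<circ> c ^^ (n - i) = id"
      using c_pow i(2) by (simp only: funpow_add[symmetric] le_add_diff_inverse less_imp_le)
    hence "x = (x \<circ> c ^^ i) \<circ> c ^^ (n - i)" by (simp only: comp_assoc comp_id)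
    moreover have "x \<circ> c ^^ i \<in> prods n S (Suc 0)" using prods_1[OF i(1)] by simp
    ultimately show ?case by blast
  next
    case (Suc j)
    have "\<exists>y\<in>alt n. v y * Q j (inv' y \<circ> x) \<noteq> 0"
    proof (rule ccontr)
      assume "\<not> ?thesis"
      hence "Q (Suc j) x = 0" unfolding Q_Suc alt.conv_def by (intro sum.neutral) blast
      thus False using Suc.prems by simp
    qed
    then obtain y where y: "y \<in> alt n" "y \<in> S" "Q j (inv' y \<circ> x) \<noteq> 0" by (auto simp: v_def split: if_splits)
    then obtain z i where zi: "z \<in> prods n S (Suc j)" "inv' y \<circ> x = z \<circ> c ^^ i"
      using Suc.IH[of "inv' y \<circ> x"] Suc.prems(1) alt.comp_G alt.inv_G by blast
    have "x = y \<circ> (inv' y \<circ> x)" by (rule alt.inv_comp_cancel(2)[OF y(1), symmetric])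
    hence "x = (y \<circ> z) \<circ> c ^^ i" unfolding zi(2) by (simp only: comp_assoc)
    moreover have "y \<circ> z \<in> prods n S (Suc (Suc j))"
      using prods_mult[OF prods_1[OF y(2)] zi(1)] by simp
    ultimately show ?case by blast
  qed
  define U where "U = {x \<in> alt n. \<not> (\<exists>z\<in>prods n S (Suc j). \<exists>i. x = z \<circ> c ^^ i)}"
  have zero: "Q j x = 0" if "x \<in> U" for x
    using that supp[of x j] unfolding U_def by blast
  \<comment> \<open>On \<open>U\<close> the density \<open>Q j\<close> vanishes, so
    \<open>f j\<close> equals \<open>-1/g\<close> there and the small norm of \<open>f j\<close>
    limits the size of \<open>U\<close>.\<close>
  have "real (card U) * (1 / g)\<^sup>2 = (\<Sum>x\<in>U. (1 / g)\<^sup>2)" by simp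
  also have "\<dots> = (\<Sum>x\<in>U. (f j x)\<^sup>2)"
    by (intro sum.cong refl) (simp add: zero f_def power_divide)
  also have "\<dots> \<le> alt.nsq n (f j)"
    unfolding alt.nsq_def by (intro sum_mono2 alt.finite_G) (auto simp: U_def)
  also have "\<dots> \<le> \<rho> ^ j / real (card S)" using nsq_f by simp
  finally have "real (card U) \<le> g\<^sup>2 * (\<rho> ^ j / real (card S))"
    using g by (simp add: power_divide field_simps)
  thus ?thesis by (simp add: U_def \<rho>_def)
qed

section \<open>The conjugacy class of a full cycle\<close>

lemma alt_two_transitive:
  assumes "n \<ge> 4" "{a, b, a', b'} \<subseteq> {1..n}" "a \<noteq> b" "a' \<noteq> b'"
  shows "\<exists>h\<in>alt n. h a = a' \<and> h b = b'"
proof -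
  define f where "f x = (if x = a then a' else b')" for x
  have "\<exists>g. g permutes {1..n} \<and> evenperm g \<and> (\<forall>k\<in>{a, b}. g k = f k)"
    by (rule even_permutes_extend) (use assms in \<open>auto simp: f_def\<close>)
  then obtain g where "g permutes {1..n}" "evenperm g" "\<forall>k\<in>{a, b}. g k = f k" by blast
  thus ?thesis using assms by (intro bexI[of _ g]) (auto simp: f_def alt_group_carrier)
qed

lemma of_bool_sum_inverse:
  assumes "x \<in> alt n" "j \<in> {1..n}"
  shows "(\<Sum>k\<in>{1..n}. of_bool (x k = j) * F k) = (F (inv' x j) :: real)"
proof -
  have "(\<Sum>k\<in>{1..n}. of_bool (x k = j) * F k) = (\<Sum>k\<in>{1..n}. if k = inv' x j then F k else 0)"
    using alt.inv_comp_apply[OF assms(1)] by (intro sum.cong refl) auto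
  moreover have "inv' x j \<in> {1..n}" using assms alt_apply_mem alt.inv_G by blast
  ultimately show ?thesis by simp
qed

text \<open>Double transitivity makes the pair \<open>(x i, x j)\<close> uniform on the
  \<open>n (n - 1)\<close> ordered pairs of distinct points.\<close>

lemma alt_pair_count:
  assumes n: "n \<ge> 4" and ij: "i \<in> {1..n}" "j \<in> {1..n}" "i \<noteq> j" and ab: "a \<in> {1..n}" "b \<in> {1..n}" "a \<noteq> b"
  shows "(\<Sum>x\<in>alt n. of_bool (x i = a \<and> x j = b)) = real (card (alt n)) / (real n * (real n - 1))"
proof -
  define N where "N a b = (\<Sum>x\<in>alt n. of_bool (x i = a \<and> x j = b) :: real)" for a b
  have const: "N a' b' = N a b" if a'b': "a' \<in> {1..n}" "b' \<in> {1..n} - {a'}" for a' b'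
  proof -
    obtain h where h: "h \<in> alt n" "h a = a'" "h b = b'"
      using alt_two_transitive[OF n, of a b a' b'] ab a'b' by auto
    have "N a' b' = (\<Sum>x\<in>alt n. of_bool ((h \<circ> x) i = a' \<and> (h \<circ> x) j = b'))"
      unfolding N_def by (rule alt.sum_left[OF h(1), symmetric])
    also have "\<dots> = N a b"
    proof -
      have "(h \<circ> x) i = a' \<longleftrightarrow> x i = a" "(h \<circ> x) j = b' \<longleftrightarrow> x j = b" for x :: "nat \<Rightarrow> nat"
        using alt_eq_iff[OF h(1), of "x i" a] alt_eq_iff[OF h(1), of "x j" b] h(2,3) by simp_all
      thus ?thesis by (simp only: N_def)
    qed
    finally show ?thesis .
  qed
  have one: "(\<Sum>b'\<in>{1..n} - {a'}. of_bool (x i = a' \<and> x j = b')) = (of_bool (x i = a') :: real)"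
    if x: "x \<in> alt n" for x a'
  proof (cases "x i = a'")
    case True
    hence "x j \<in> {1..n} - {a'}" using alt_apply_mem[OF x ij(2)] alt_eq_iff[OF x] ij(3) by auto
    moreover have "(\<Sum>b'\<in>{1..n} - {a'}. of_bool (x i = a' \<and> x j = b')) =
        (\<Sum>b'\<in>{1..n} - {a'}. if x j = b' then 1 else (0 :: real))"
      using True by (intro sum.cong refl) auto
    ultimately show ?thesis using True by (simp add: sum.delta)
  qed simp
  have "(\<Sum>a'\<in>{1..n}. \<Sum>b'\<in>{1..n} - {a'}. N a' b') =
      (\<Sum>a'\<in>{1..n}. \<Sum>x\<in>alt n. \<Sum>b'\<in>{1..n} - {a'}. of_bool (x i = a' \<and> x j = b'))"
    unfolding N_def by (intro sum.cong refl) (rule sum.swap)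
  also have "\<dots> = (\<Sum>a'\<in>{1..n}. \<Sum>x\<in>alt n. of_bool (x i = a'))"
    by (intro sum.cong refl one)
  also have "\<dots> = (\<Sum>x\<in>alt n. \<Sum>a'\<in>{1..n}. of_bool (x i = a'))" by (rule sum.swap)
  also have "\<dots> = (\<Sum>x\<in>alt n. 1)"
  proof (intro sum.cong refl)
    fix x assume "x \<in> alt n"
    hence "x i \<in> {1..n}" using ij alt_apply_mem by blast
    moreover have "(\<Sum>a'\<in>{1..n}. of_bool (x i = a')) = (\<Sum>a'\<in>{1..n}. if x i = a' then 1 else (0 :: real))"
      by (intro sum.cong refl) auto
    ultimately show "(\<Sum>a'\<in>{1..n}. of_bool (x i = a')) = (1 :: real)" by (simp add: sum.delta)
  qed
  finally have "(\<Sum>a'\<in>{1..n}. \<Sum>b'\<in>{1..n} - {a'}. N a' b') = real (card (alt n))" by simp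
  moreover have "(\<Sum>a'\<in>{1..n}. \<Sum>b'\<in>{1..n} - {a'}. N a' b') = (\<Sum>a'\<in>{1..n}. \<Sum>b'\<in>{1..n} - {a'}. N a b)"
    by (intro sum.cong refl const)
  moreover have "(\<Sum>a'\<in>{1..n}. \<Sum>b'\<in>{1..n} - {a'}. N a b) = (\<Sum>a'\<in>{1..n}. (real n - 1) * N a b)"
    by (intro sum.cong refl) (use n in \<open>simp add: of_nat_diff\<close>)
  ultimately have "real n * (real n - 1) * N a b = real (card (alt n))" by simp
  thus ?thesis using n by (simp add: N_def field_simps)
qed

lemma alt_point_count:
  assumes n: "n \<ge> 4" and ia: "i \<in> {1..n}" "a \<in> {1..n}"
  shows "(\<Sum>x\<in>alt n. of_bool (x i = a)) = real (card (alt n)) / real n"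
proof -
  obtain j where j: "j \<in> {1..n}" "j \<noteq> i"
  proof (cases "i = 1")
    case True thus thesis using that[of 2] n by auto
  next
    case False thus thesis using that[of 1] n by auto
  qed
  have one: "of_bool (x i = a) = (\<Sum>b\<in>{1..n} - {a}. of_bool (x i = a \<and> x j = b) :: real)" if x: "x \<in> alt n" for x
  proof (cases "x i = a")
    case True
    hence "x j \<in> {1..n} - {a}" using alt_apply_mem[OF x j(1)] alt_eq_iff[OF x] j(2) by auto
    moreover have "(\<Sum>b\<in>{1..n} - {a}. of_bool (x i = a \<and> x j = b)) =
        (\<Sum>b\<in>{1..n} - {a}. if x j = b then 1 else (0 :: real))"
      using True by (intro sum.cong refl) auto
    ultimately show ?thesis using True by (simp add: sum.delta)
  qed simp
  have "(\<Sum>x\<in>alt n. of_bool (x i = a)) =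
      (\<Sum>x\<in>alt n. \<Sum>b\<in>{1..n} - {a}. of_bool (x i = a \<and> x j = b) :: real)"
    by (intro sum.cong refl one)
  also have "\<dots> = (\<Sum>b\<in>{1..n} - {a}. \<Sum>x\<in>alt n. of_bool (x i = a \<and> x j = b))" by (rule sum.swap)
  also have "\<dots> = (\<Sum>b\<in>{1..n} - {a}. real (card (alt n)) / (real n * (real n - 1)))"
    by (intro sum.cong refl alt_pair_count) (use n ia j in auto)
  also have "\<dots> = real (card (alt n)) / real n"
    using n ia by (simp add: of_nat_diff)
  finally show ?thesis .
qed

text \<open>The uniform probability measure on the conjugacy class of \<open>c\<close>, written as
  an average over conjugating elements so that sums over the class become sums over the
  group.\<close>

definition class_weight :: "nat \<Rightarrow> (nat \<Rightarrow> nat) \<Rightarrow> (nat \<Rightarrow> nat) \<Rightarrow> real"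
  where "class_weight n c a = (\<Sum>x\<in>alt n. of_bool (x \<circ> c \<circ> inv' x = a)) / real (card (alt n))"

definition num_fixed :: "nat \<Rightarrow> (nat \<Rightarrow> nat) \<Rightarrow> real"
  where "num_fixed n x = (\<Sum>k\<in>{1..n}. of_bool (x k = k))"

lemma num_fixed_bounds: "num_fixed n x \<ge> 0" "num_fixed n x \<le> real n"
proof -
  show "num_fixed n x \<ge> 0" unfolding num_fixed_def by (intro sum_nonneg) auto
  have "num_fixed n x \<le> (\<Sum>k\<in>{1..n}. 1)" unfolding num_fixed_def by (intro sum_mono) auto
  thus "num_fixed n x \<le> real n" by simp
qed

lemma class_weight_nonneg: "class_weight n c a \<ge> 0"
  unfolding class_weight_def by (intro divide_nonneg_nonneg sum_nonneg) auto

lemma sum_class_weight: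
  assumes "c \<in> alt n"
  shows "(\<Sum>a\<in>alt n. class_weight n c a * F a) = (\<Sum>x\<in>alt n. F (x \<circ> c \<circ> inv' x)) / real (card (alt n))"
proof -
  have "(\<Sum>a\<in>alt n. class_weight n c a * F a) =
      (\<Sum>a\<in>alt n. \<Sum>x\<in>alt n. of_bool (x \<circ> c \<circ> inv' x = a) * F a) / real (card (alt n))"
    unfolding class_weight_def by (simp add: sum_divide_distrib[symmetric] sum_distrib_right[symmetric])
  also have "(\<Sum>a\<in>alt n. \<Sum>x\<in>alt n. of_bool (x \<circ> c \<circ> inv' x = a) * F a) =
      (\<Sum>x\<in>alt n. \<Sum>a\<in>alt n. of_bool (x \<circ> c \<circ> inv' x = a) * F a)" by (rule sum.swap)
  also have "\<dots> = (\<Sum>x\<in>alt n. F (x \<circ> c \<circ> inv' x))"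
  proof (intro sum.cong refl)
    fix x assume "x \<in> alt n"
    hence m: "x \<circ> c \<circ> inv' x \<in> alt n" using assms alt.comp_G alt.inv_G by blast
    have "(\<Sum>a\<in>alt n. of_bool (x \<circ> c \<circ> inv' x = a) * F a) =
        (\<Sum>a\<in>alt n. if a = x \<circ> c \<circ> inv' x then F a else 0)"
      by (intro sum.cong refl) (auto simp del: comp_apply)
    thus "(\<Sum>a\<in>alt n. of_bool (x \<circ> c \<circ> inv' x = a) * F a) = F (x \<circ> c \<circ> inv' x)"
      using m alt.finite_G by simp
  qed
  finally show ?thesis .
qed

text \<open>A permutation conjugating \<open>c\<close> to \<open>a\<close> is determined by the image of the point 1.\<close>

lemma class_weight_le:
  assumes c: "full_cycle n c" and n: "n \<ge> 1"
  shows "class_weight n c a \<le> real n / real (card (alt n))"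
proof -
  define E where "E = {x \<in> alt n. x \<circ> c \<circ> inv' x = a}"
  have c_alt: "c \<in> alt n" using c by (simp add: full_cycle_def)
  have comm: "x (c k) = a (x k)" if "x \<in> E" for x k
  proof -
    have "x \<in> alt n" "x \<circ> c \<circ> inv' x = a" using that by (auto simp: E_def)
    hence "a (x k) = x (c (inv' x (x k)))" by (metis comp_apply)
    thus ?thesis using alt.inv_comp_apply(1)[OF \<open>x \<in> alt n\<close>] by simp
  qed
  have "inj_on (\<lambda>x. x 1) E"
  proof (rule inj_onI)
    fix x y assume xy: "x \<in> E" "y \<in> E" "x 1 = y 1"
    have eq: "x k = y k" if "k \<in> {1..n}" for k
      by (rule full_cycle_funpow_induct[OF c, where P = "\<lambda>k. x k = y k"])
        (use xy comm[OF xy(1)] comm[OF xy(2)] that in auto)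
    show "x = y"
    proof
      fix k show "x k = y k"
      proof (cases "k \<in> {1..n}")
        case False
        thus ?thesis using xy by (auto simp: E_def alt_group_carrier permutes_not_in)
      qed (rule eq)
    qed
  qed
  moreover have "(\<lambda>x. x 1) ` E \<subseteq> {1..n}"
  proof
    fix y assume "y \<in> (\<lambda>x. x 1) ` E"
    then obtain x where "x \<in> alt n" "y = x 1" by (auto simp: E_def)
    thus "y \<in> {1..n}" using alt_apply_mem[of x n 1] n by simp
  qed
  ultimately have "card E \<le> n" using card_inj_on_le[of _ E "{1..n}"] by simp
  moreover have "(\<Sum>x\<in>alt n. of_bool (x \<circ> c \<circ> inv' x = a)) = real (card E)"
    unfolding E_def using alt.finite_G by (simp add: Int_def)
  ultimately show ?thesis
    unfolding class_weight_def by (intro divide_right_mono) auto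
qed

lemma sum_class_weight_one: "c \<in> alt n \<Longrightarrow> (\<Sum>a\<in>alt n. class_weight n c a) = 1"
  using sum_class_weight[of c n "\<lambda>_. 1"] alt.card_G_pos[of n] by simp

text \<open>Maximum times total mass. Convolution with the class thus contracts like convolution
  with a set of at least \<open>|G| / n\<close> elements.\<close>

lemma nsq_class_weight:
  assumes c: "full_cycle n c" and n: "n \<ge> 1"
  shows "alt.nsq n (class_weight n c) \<le> real n / real (card (alt n))"
proof -
  have c_alt: "c \<in> alt n" using c by (simp add: full_cycle_def)
  have "alt.nsq n (class_weight n c) \<le> (\<Sum>a\<in>alt n. real n / real (card (alt n)) * class_weight n c a)"
    unfolding alt.nsq_def power2_eq_square
    by (intro sum_mono mult_right_mono class_weight_le c n class_weight_nonneg)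
  also have "\<dots> = real n / real (card (alt n)) * (\<Sum>a\<in>alt n. class_weight n c a)"
    by (rule sum_distrib_left[symmetric])
  finally show ?thesis by (simp add: sum_class_weight_one[OF c_alt])
qed

text \<open>A random conjugate of a fixed-point-free cycle sends \<open>i\<close> to a uniformly
  distributed other point. The conjugate by \<open>x\<close> sends \<open>i\<close> to
  \<open>j\<close> when some \<open>k\<close> has \<open>x k = i\<close> and
  \<open>x (c k) = j\<close>, which reduces the count to pairs.\<close>

lemma class_weight_point:
  assumes c: "full_cycle n c" and n: "n \<ge> 4" and ij: "i \<in> {1..n}" "j \<in> {1..n}"
  shows "(\<Sum>a\<in>alt n. class_weight n c a * of_bool (a i = j)) = (if i = j then 0 else 1 / (real n - 1))"
proof -
  have c_alt: "c \<in> alt n" using c by (simp add: full_cycle_def)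
  define g where "g = real (card (alt n))"
  have g: "g > 0" using alt.card_G_pos by (simp add: g_def)
  have nofix: "c k \<noteq> k" if "k \<in> {1..n}" for k using full_cycle_no_fixed_point[OF c _ that] n by simp
  have "(\<Sum>a\<in>alt n. class_weight n c a * of_bool (a i = j)) =
      (\<Sum>x\<in>alt n. of_bool ((x \<circ> c \<circ> inv' x) i = j)) / g"
    unfolding g_def by (rule sum_class_weight[OF c_alt])
  also have "(\<Sum>x\<in>alt n. of_bool ((x \<circ> c \<circ> inv' x) i = j)) =
      (\<Sum>x\<in>alt n. \<Sum>k\<in>{1..n}. of_bool (x k = i \<and> x (c k) = j) :: real)"
  proof (intro sum.cong refl)
    fix x assume x: "x \<in> alt n"
    have "(\<Sum>k\<in>{1..n}. of_bool (x k = i \<and> x (c k) = j)) =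
        (\<Sum>k\<in>{1..n}. of_bool (x k = i) * of_bool (x (c k) = j) :: real)" by (simp add: of_bool_conj)
    also have "\<dots> = of_bool (x (c (inv' x i)) = j)" by (rule of_bool_sum_inverse[OF x ij(1)])
    finally show "of_bool ((x \<circ> c \<circ> inv' x) i = j) = (\<Sum>k\<in>{1..n}. of_bool (x k = i \<and> x (c k) = j) :: real)"
      by simp
  qed
  also have "\<dots> = (\<Sum>k\<in>{1..n}. \<Sum>x\<in>alt n. of_bool (x k = i \<and> x (c k) = j))" by (rule sum.swap)
  also have "\<dots> = (\<Sum>k\<in>{1..n}. if i = j then 0 else g / (real n * (real n - 1)))"
  proof (intro sum.cong refl)
    fix k assume k: "k \<in> {1..n}"
    show "(\<Sum>x\<in>alt n. of_bool (x k = i \<and> x (c k) = j)) = (if i = j then 0 else g / (real n * (real n - 1)))"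
    proof (cases "i = j")
      case True
      have "\<not> (x k = i \<and> x (c k) = j)" if "x \<in> alt n" for x
        using True nofix[OF k] alt_eq_iff[OF that, of k "c k"] by auto
      hence "(\<Sum>x\<in>alt n. of_bool (x k = i \<and> x (c k) = j)) = (0 :: real)" by (intro sum.neutral) auto
      thus ?thesis using True by (simp only: simp_thms if_True)
    next
      case False
      thus ?thesis unfolding g_def
        using alt_pair_count[OF n k alt_apply_mem[OF c_alt k] _ ij False] nofix[OF k] by auto
    qed
  qed
  also have "(\<Sum>k\<in>{1..n}. if i = j then 0 else g / (real n * (real n - 1))) / g =
      (if i = j then 0 else 1 / (real n - 1))"
    using g n by (cases "i = j") simp_all
  finally show ?thesis .
qed

text \<open>Equivalently, \<open>num_fixed - 1\<close> is an eigenfunction with eigenvalue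
  \<open>-1 / (n - 1)\<close>: the points fixed by \<open>z\<close> contribute nothing and every
  other point contributes \<open>1 / (n - 1)\<close>.\<close>

lemma conv_class_weight_num_fixed:
  assumes c: "full_cycle n c" and n: "n \<ge> 4" and z: "z \<in> alt n"
  shows "alt.conv n (class_weight n c) (num_fixed n) z = (real n - num_fixed n z) / (real n - 1)"
proof -
  have "alt.conv n (class_weight n c) (num_fixed n) z =
      (\<Sum>y\<in>alt n. \<Sum>k\<in>{1..n}. class_weight n c y * of_bool (y k = z k))"
    unfolding alt.conv_def num_fixed_def sum_distrib_left
  proof (intro sum.cong refl)
    fix y k assume y: "y \<in> alt n"
    have "(inv' y \<circ> z) k = k \<longleftrightarrow> y k = z k" using alt.inv_comp_apply[OF y] by (metis comp_apply)
    thus "class_weight n c y * of_bool ((inv' y \<circ> z) k = k) = class_weight n c y * of_bool (y k = z k)"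
      by simp
  qed
  also have "\<dots> = (\<Sum>k\<in>{1..n}. \<Sum>y\<in>alt n. class_weight n c y * of_bool (y k = z k))"
    by (rule sum.swap)
  also have "\<dots> = (\<Sum>k\<in>{1..n}. (1 - of_bool (z k = k)) / (real n - 1))"
  proof (intro sum.cong refl)
    fix k assume k: "k \<in> {1..n}"
    show "(\<Sum>y\<in>alt n. class_weight n c y * of_bool (y k = z k)) = (1 - of_bool (z k = k)) / (real n - 1)"
      unfolding class_weight_point[OF c n k alt_apply_mem[OF z k]] by auto
  qed
  also have "\<dots> = (real n - num_fixed n z) / (real n - 1)"
    unfolding num_fixed_def by (simp add: sum_divide_distrib[symmetric] sum_subtractf)
  finally show ?thesis .
qed

text \<open>The uniform measure on the class has Fourier coefficient \<open>-1/(n-1)\<close> at the standard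
  representation, whose character is \<open>num_fixed - 1\<close>.\<close>

lemma V2_class_weight:
  assumes c: "full_cycle n c" and n: "n \<ge> 4"
  shows "V2 n (\<lambda>x. class_weight n c x - (2 - num_fixed n x) / real (card (alt n)))"
  unfolding V2_def
proof (intro ballI)
  fix i j assume ij: "i \<in> {1..n}" "j \<in> {1..n}"
  define g where "g = real (card (alt n))"
  have g: "g > 0" using alt.card_G_pos by (simp add: g_def)
  have filter: "(\<Sum>x | x \<in> alt n \<and> x i = j. F x) = (\<Sum>x\<in>alt n. F x * of_bool (x i = j))" for F :: "_ \<Rightarrow> real"
  proof -
    have "(\<Sum>x | x \<in> alt n \<and> x i = j. F x) = (\<Sum>x\<in>alt n. if x i = j then F x else 0)"
      by (rule sum.inter_filter[OF alt.finite_G])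
    also have "\<dots> = (\<Sum>x\<in>alt n. F x * of_bool (x i = j))" by (intro sum.cong refl) auto
    finally show ?thesis .
  qed
  have fixed: "(\<Sum>x\<in>alt n. num_fixed n x * of_bool (x i = j)) =
      (if i = j then 2 * g / real n else (real n - 2) * g / (real n * (real n - 1)))"
  proof -
    have "(\<Sum>x\<in>alt n. num_fixed n x * of_bool (x i = j)) =
        (\<Sum>x\<in>alt n. \<Sum>k\<in>{1..n}. of_bool (x i = j \<and> x k = k))"
      unfolding num_fixed_def sum_distrib_right
      by (intro sum.cong refl) (simp add: of_bool_conj mult.commute)
    also have "\<dots> = (\<Sum>k\<in>{1..n}. \<Sum>x\<in>alt n. of_bool (x i = j \<and> x k = k))" by (rule sum.swap)
    also have "\<dots> = (\<Sum>k\<in>{1..n}. if k = i then (if i = j then g / real n else 0)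
        else if k = j then 0 else g / (real n * (real n - 1)))"
    proof (intro sum.cong refl)
      fix k assume k: "k \<in> {1..n}"
      consider "k = i" "i = j" | "k = i" "i \<noteq> j" | "k \<noteq> i" "k = j" | "k \<noteq> i" "k \<noteq> j" by blast
      thus "(\<Sum>x\<in>alt n. of_bool (x i = j \<and> x k = k)) = (if k = i then (if i = j then g / real n else 0)
        else if k = j then 0 else g / (real n * (real n - 1)))"
      proof cases
        case 1
        thus ?thesis using alt_point_count[OF n ij] by (simp add: g_def)
      next
        case 2
        have "(\<Sum>x\<in>alt n. of_bool (x i = j \<and> x k = k)) = (0 :: real)"
          by (intro sum.neutral) (use 2 in auto)
        thus ?thesis using 2 by (simp only: simp_thms if_True if_False)
      next
        case 3
        have "\<not> (x i = j \<and> x k = k)" if "x \<in> alt n" for x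
          using 3 alt_eq_iff[OF that, of i k] by auto
        hence "(\<Sum>x\<in>alt n. of_bool (x i = j \<and> x k = k)) = (0 :: real)" by (intro sum.neutral) auto
        thus ?thesis using 3 by (simp only: simp_thms if_True if_False)
      next
        case 4
        thus ?thesis using alt_pair_count[OF n ij(1) k _ ij(2) k] by (simp add: g_def)
      qed
    qed
    also have "\<dots> = (if i = j then 2 * g / real n else (real n - 2) * g / (real n * (real n - 1)))"
    proof (cases "i = j")
      case True
      have "(\<Sum>k\<in>{1..n}. if k = i then (if i = j then g / real n else 0)
          else if k = j then 0 else g / (real n * (real n - 1))) =
        g / real n + (\<Sum>k\<in>{1..n} - {i}. g / (real n * (real n - 1)))"
        using True ij by (subst sum.remove[of _ i]) (auto intro!: sum.cong)
      also have "\<dots> = 2 * g / real n" using n ij by (simp add: of_nat_diff)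
      finally show ?thesis using True by simp
    next
      case False
      have "(\<Sum>k\<in>{1..n}. if k = i then (if i = j then g / real n else 0)
          else if k = j then 0 else g / (real n * (real n - 1))) =
        (\<Sum>k\<in>{1..n} - {i, j}. g / (real n * (real n - 1)))"
        using False by (intro sum.mono_neutral_cong_right) auto
      also have "\<dots> = real (card ({1..n} - {i, j})) * (g / (real n * (real n - 1)))" by simp
      also have "real (card ({1..n} - {i, j})) = real n - 2"
        using n ij False by (simp add: card_Diff_subset of_nat_diff)
      finally show ?thesis using False by simp
    qed
    finally show ?thesis .
  qed
  have "(\<Sum>x | x \<in> alt n \<and> x i = j. class_weight n c x - (2 - num_fixed n x) / g) =
      (\<Sum>x\<in>alt n. class_weight n c x * of_bool (x i = j)) -
      (2 * (\<Sum>x\<in>alt n. of_bool (x i = j)) - (\<Sum>x\<in>alt n. num_fixed n x * of_bool (x i = j))) / g"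
    unfolding filter
    by (simp add: left_diff_distrib sum_subtractf diff_divide_distrib sum_distrib_left sum_divide_distrib)
  also have "\<dots> = 0"
    unfolding class_weight_point[OF c n ij] alt_point_count[OF n ij] fixed g_def[symmetric]
    using g n by (cases "i = j") (simp_all add: field_simps)
  finally show "(\<Sum>x | x \<in> alt n \<and> x i = j. class_weight n c x - (2 - num_fixed n x) / real (card (alt n))) = 0"
    by (simp add: g_def)
qed

text \<open>Left translation only changes the prescribed value \<open>j\<close>, so
  \<open>V2\<close> is invariant under it and hence under convolution.\<close>

lemma V2_conv: assumes "V2 n f" shows "V2 n (alt.conv n v f)"
  unfolding V2_def
proof (intro ballI)
  fix i j assume ij: "i \<in> {1..n}" "j \<in> {1..n}"
  have inner: "(\<Sum>x | x \<in> alt n \<and> x i = j. f (inv' y \<circ> x)) = 0" if y: "y \<in> alt n" for y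
  proof -
    have "(\<Sum>x | x \<in> alt n \<and> x i = j. f (inv' y \<circ> x)) =
        (\<Sum>x\<in>alt n. if x i = j then f (inv' y \<circ> x) else 0)"
      by (rule sum.inter_filter[OF alt.finite_G])
    also have "\<dots> = (\<Sum>x\<in>alt n. if (inv' y \<circ> x) i = inv' y j then f (inv' y \<circ> x) else 0)"
      using alt_eq_iff[OF alt.inv_G[OF y]] by simp
    also have "\<dots> = (\<Sum>x\<in>alt n. if x i = inv' y j then f x else 0)"
      by (rule alt.sum_left[OF alt.inv_G[OF y]])
    also have "\<dots> = (\<Sum>x | x \<in> alt n \<and> x i = inv' y j. f x)"
      by (rule sum.inter_filter[OF alt.finite_G, symmetric])
    also have "\<dots> = 0"
      using assms ij alt_apply_mem[OF alt.inv_G[OF y] ij(2)] unfolding V2_def by blast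
    finally show ?thesis .
  qed
  have "(\<Sum>x | x \<in> alt n \<and> x i = j. alt.conv n v f x) =
      (\<Sum>y\<in>alt n. v y * (\<Sum>x | x \<in> alt n \<and> x i = j. f (inv' y \<circ> x)))"
    unfolding alt.conv_def sum_distrib_left by (rule sum.swap)
  thus "(\<Sum>x | x \<in> alt n \<and> x i = j. alt.conv n v f x) = 0" using inner by simp
qed

text \<open>\<open>\<beta> k\<close> is the distribution of a product of \<open>k + 1\<close>
  independent random conjugates of \<open>c\<close>. Each factor misses \<open>B\<close> with
  probability at most \<open>\<eta>\<close>, and the first claim is the union bound.\<close>

lemma mass_outside_products:
  assumes c: "c \<in> alt n" and B: "B \<subseteq> alt n"
    and \<eta>: "real (card {x \<in> alt n. x \<circ> c \<circ> inv' x \<notin> B}) \<le> \<eta> * real (card (alt n))"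
  defines "\<beta> k \<equiv> (alt.conv n (class_weight n c) ^^ k) (class_weight n c)"
  shows "(\<Sum>z\<in>alt n. \<beta> k z * of_bool (z \<notin> prods n B (Suc k))) \<le> real (Suc k) * \<eta> \<and>
    (\<Sum>z\<in>alt n. \<beta> k z) = 1 \<and> (\<forall>z. \<beta> k z \<ge> 0)"
proof (induction k)
  define u where "u = class_weight n c"
  have g: "real (card (alt n)) > 0" using alt.card_G_pos by simp
  have base: "(\<Sum>z\<in>alt n. u z * of_bool (z \<notin> B)) \<le> \<eta>"
  proof -
    have "(\<Sum>z\<in>alt n. u z * of_bool (z \<notin> B)) =
        (\<Sum>x\<in>alt n. of_bool (x \<circ> c \<circ> inv' x \<notin> B)) / real (card (alt n))"
      unfolding u_def by (rule sum_class_weight[OF c])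
    also have "(\<Sum>x\<in>alt n. of_bool (x \<circ> c \<circ> inv' x \<notin> B)) =
        real (card {x \<in> alt n. x \<circ> c \<circ> inv' x \<notin> B})"
      using alt.finite_G by (simp add: Int_def)
    also have "real (card {x \<in> alt n. x \<circ> c \<circ> inv' x \<notin> B}) / real (card (alt n)) \<le> \<eta>"
      using \<eta> g by (simp only: divide_le_eq if_True)
    finally show ?thesis .
  qed
  {
    case 0
    have "of_bool (z \<notin> prods n B (Suc 0)) \<le> (of_bool (z \<notin> B) :: real)" for z
      using prods_1[of z B n] by auto
    hence "(\<Sum>z\<in>alt n. u z * of_bool (z \<notin> prods n B (Suc 0))) \<le> (\<Sum>z\<in>alt n. u z * of_bool (z \<notin> B))"
      unfolding u_def by (intro sum_mono mult_left_mono class_weight_nonneg)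
    thus ?case using base class_weight_nonneg sum_class_weight_one[OF c] by (simp add: \<beta>_def u_def)
  next
    case (Suc k)
    have \<beta>_Suc: "\<beta> (Suc k) = alt.conv n u (\<beta> k)" by (simp add: \<beta>_def u_def)
    define \<mu> where "\<mu> = (\<Sum>z\<in>alt n. \<beta> k z * of_bool (z \<notin> prods n B (Suc k)))"
    have nonneg: "\<beta> k z \<ge> 0" "u z \<ge> 0" for z using Suc class_weight_nonneg by (auto simp: u_def)
    have \<mu>: "\<mu> \<ge> 0" unfolding \<mu>_def using nonneg by (intro sum_nonneg) auto
    have inner: "(\<Sum>z\<in>alt n. \<beta> k (inv' y \<circ> z) * of_bool (z \<notin> prods n B (Suc (Suc k)))) \<le> \<mu> + of_bool (y \<notin> B)"
      if y: "y \<in> alt n" for y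
    proof (cases "y \<in> B")
      case True
      have "(\<Sum>z\<in>alt n. \<beta> k (inv' y \<circ> z) * of_bool (z \<notin> prods n B (Suc (Suc k)))) \<le>
          (\<Sum>z\<in>alt n. \<beta> k (inv' y \<circ> z) * of_bool (inv' y \<circ> z \<notin> prods n B (Suc k)))"
      proof (intro sum_mono mult_left_mono nonneg)
        fix z
        have "z \<in> prods n B (Suc (Suc k))" if "inv' y \<circ> z \<in> prods n B (Suc k)"
        proof -
          have "y \<circ> (inv' y \<circ> z) \<in> prods n B (1 + Suc k)" by (rule prods_mult[OF prods_1[OF True] that])
          thus ?thesis by (simp only: alt.inv_comp_cancel(2)[OF y] plus_1_eq_Suc)
        qed
        thus "of_bool (z \<notin> prods n B (Suc (Suc k))) \<le> (of_bool (inv' y \<circ> z \<notin> prods n B (Suc k)) :: real)"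
          by auto
      qed
      also have "\<dots> = \<mu>"
        unfolding \<mu>_def by (rule alt.sum_left[OF alt.inv_G[OF y]])
      finally show ?thesis using True by simp
    next
      case False
      have "(\<Sum>z\<in>alt n. \<beta> k (inv' y \<circ> z) * of_bool (z \<notin> prods n B (Suc (Suc k)))) \<le>
          (\<Sum>z\<in>alt n. \<beta> k (inv' y \<circ> z) * 1)"
        by (intro sum_mono mult_left_mono nonneg) auto
      also have "\<dots> = (\<Sum>z\<in>alt n. \<beta> k z)"
        using alt.sum_left[OF alt.inv_G[OF y], of "\<beta> k"] by simp
      finally show ?thesis using Suc \<mu> False by simp
    qed
    have "(\<Sum>z\<in>alt n. \<beta> (Suc k) z * of_bool (z \<notin> prods n B (Suc (Suc k)))) =
        (\<Sum>z\<in>alt n. \<Sum>y\<in>alt n. u y * (\<beta> k (inv' y \<circ> z) * of_bool (z \<notin> prods n B (Suc (Suc k)))))"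
      unfolding \<beta>_Suc alt.conv_def sum_distrib_right by (simp only: mult.assoc)
    also have "\<dots> = (\<Sum>y\<in>alt n. u y * (\<Sum>z\<in>alt n. \<beta> k (inv' y \<circ> z) * of_bool (z \<notin> prods n B (Suc (Suc k)))))"
      unfolding sum_distrib_left by (rule sum.swap)
    also have "\<dots> \<le> (\<Sum>y\<in>alt n. u y * (\<mu> + of_bool (y \<notin> B)))"
      by (intro sum_mono mult_left_mono inner nonneg)
    also have "\<dots> = \<mu> + (\<Sum>y\<in>alt n. u y * of_bool (y \<notin> B))"
      unfolding distrib_left sum.distrib sum_distrib_right[symmetric]
      using sum_class_weight_one[OF c] by (simp add: u_def)
    also have "\<dots> \<le> real (Suc (Suc k)) * \<eta>"
      using Suc base by (simp add: \<mu>_def algebra_simps)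
    finally have 1: "(\<Sum>z\<in>alt n. \<beta> (Suc k) z * of_bool (z \<notin> prods n B (Suc (Suc k)))) \<le> real (Suc (Suc k)) * \<eta>" .
    have 2: "(\<Sum>z\<in>alt n. \<beta> (Suc k) z) = 1"
      unfolding \<beta>_Suc alt.sum_conv using Suc sum_class_weight_one[OF c] by (simp add: u_def)
    have 3: "\<forall>z. \<beta> (Suc k) z \<ge> 0"
      unfolding \<beta>_Suc alt.conv_def using nonneg by (auto intro!: sum_nonneg)
    show ?case using 1 2 3 by blast
  }
qed

text \<open>Four random conjugates suffice. The part \<open>w\<close> of the class measure in
  \<open>V2\<close> has squared norm at most \<open>4 n^2 / g\<close>, and each of three
  convolutions contributes a factor \<open>16 / n\<close>, leaving \<open>2^14 / (n g)\<close>; for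
  \<open>n \<ge> 2^20\<close> its total over any set is at most 1/8. If half of the group were
  missed, that half would have mass at least \<open>9/20 - 1/8\<close>, but the union bound allows
  only \<open>4/20\<close>.\<close>

lemma half_covered:
  assumes c: "full_cycle n c" and n: "n \<ge> 2 ^ 20" and r: "odd r" "5 \<le> r" "2 * r \<le> n"
    and r2: "(real n)\<^sup>2 / 16 \<le> real (r choose 2)"
    and B: "B \<subseteq> alt n" and \<eta>: "20 * card {x \<in> alt n. x \<circ> c \<circ> inv' x \<notin> B} \<le> card (alt n)"
  shows "card (alt n) < 2 * card (prods n B 4)"
proof (rule ccontr)
  assume neg: "\<not> card (alt n) < 2 * card (prods n B 4)"
  define g where "g = real (card (alt n))"
  have g: "g > 0" using alt.card_G_pos by (simp add: g_def)
  have n4: "n \<ge> 4" and n_real: "real n \<ge> 2 ^ 20"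
    using n by (simp, metis of_nat_le_iff of_nat_numeral of_nat_power)
  have c_alt: "c \<in> alt n" using c by (simp add: full_cycle_def)
  define u where "u = class_weight n c"
  define w where "w x = u x - (2 - num_fixed n x) / g" for x
  have V2w: "V2 n w" using V2_class_weight[OF c n4] by (simp add: w_def[abs_def] u_def g_def)
  have nsq_u: "alt.nsq n u \<le> real n / g" using nsq_class_weight[OF c] n4 by (simp add: u_def g_def)
  have contract: "alt.nsq n (alt.conv n u f) \<le> 16 / real n * alt.nsq n f" if "V2 n f" for f
  proof -
    have "(real n)\<^sup>2 / 16 * alt.nsq n (alt.conv n u f) \<le> real (r choose 2) * alt.nsq n (alt.conv n u f)"
      by (intro mult_right_mono r2 alt.nsq_nonneg)
    also have "\<dots> \<le> g * alt.nsq n u * alt.nsq n f" unfolding g_def by (rule nsq_conv_V2[OF that r])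
    also have "\<dots> \<le> g * (real n / g) * alt.nsq n f"
      using g by (intro mult_right_mono mult_left_mono nsq_u alt.nsq_nonneg) auto
    finally show ?thesis using g n4 by (simp add: power2_eq_square field_simps)
  qed
  define w1 w2 w3 where "w1 = alt.conv n u w" and "w2 = alt.conv n u w1" and "w3 = alt.conv n u w2"
  have V2w12: "V2 n w1" "V2 n w2" using V2w V2_conv by (auto simp: w1_def w2_def)
  have nsq_w: "alt.nsq n w \<le> 4 * (real n)\<^sup>2 / g"
  proof -
    have "alt.nsq n (\<lambda>x. - 1 * ((2 - num_fixed n x) / g)) = (\<Sum>x\<in>alt n. (2 - num_fixed n x)\<^sup>2 / g\<^sup>2)"
      unfolding alt.nsq_def by (intro sum.cong refl) (simp only: power_mult_distrib power_divide, simp)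
    also have "\<dots> \<le> (\<Sum>x\<in>alt n. (real n)\<^sup>2 / g\<^sup>2)"
    proof (intro sum_mono divide_right_mono)
      fix x
      have "\<bar>2 - num_fixed n x\<bar> \<le> \<bar>real n\<bar>" using num_fixed_bounds[of n x] n4 by auto
      thus "(2 - num_fixed n x)\<^sup>2 \<le> (real n)\<^sup>2" by (rule power2_mono)
    qed simp
    also have "\<dots> = (real n)\<^sup>2 / g" using g by (simp add: g_def[symmetric] power2_eq_square)
    finally have part: "alt.nsq n (\<lambda>x. - 1 * ((2 - num_fixed n x) / g)) \<le> (real n)\<^sup>2 / g" .
    have "w = (\<lambda>x. u x + - 1 * ((2 - num_fixed n x) / g))" 
      by (rule ext) (unfold w_def, linarith)
    hence "alt.nsq n w \<le> 2 * alt.nsq n u + 2 * alt.nsq n (\<lambda>x. - 1 * ((2 - num_fixed n x) / g))"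
      using alt.nsq_add_le[of n u "\<lambda>x. - 1 * ((2 - num_fixed n x) / g)"] by (simp only:)
    also have "\<dots> \<le> 2 * (real n / g) + 2 * ((real n)\<^sup>2 / g)" using nsq_u part by linarith
    also have "\<dots> \<le> 2 * ((real n)\<^sup>2 / g) + 2 * ((real n)\<^sup>2 / g)"
    proof -
      have "real n * 1 \<le> real n * real n" using n4 by (intro mult_left_mono) auto
      hence "real n / g \<le> (real n)\<^sup>2 / g" using g by (simp add: power2_eq_square divide_right_mono)
      thus ?thesis by linarith
    qed
    finally show ?thesis by simp
  qed
  have "alt.nsq n w3 \<le> 16 / real n * alt.nsq n w2" unfolding w3_def by (rule contract[OF V2w12(2)])
  also have "\<dots> \<le> 16 / real n * (16 / real n * alt.nsq n w1)"
    unfolding w2_def by (intro mult_left_mono contract[OF V2w12(1)]) simp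
  also have "\<dots> \<le> 16 / real n * (16 / real n * (16 / real n * alt.nsq n w))"
    unfolding w1_def by (intro mult_left_mono contract[OF V2w]) simp_all
  also have "\<dots> \<le> 16 / real n * (16 / real n * (16 / real n * (4 * (real n)\<^sup>2 / g)))"
    by (intro mult_left_mono nsq_w) simp_all
  also have "\<dots> = 16384 / (real n * g)" using n4 g by (simp add: power2_eq_square field_simps)
  finally have nsq_w3: "alt.nsq n w3 \<le> 16384 / (real n * g)" .
  define F where "F x = num_fixed n x - 1" for x
  have sum_u: "(\<Sum>y\<in>alt n. u y) = 1" using sum_class_weight_one[OF c_alt] by (simp add: u_def)
  have conv_split: "alt.conv n u h z = 1 / g - t / (real n - 1) * F z / g + alt.conv n u p z"
    if z: "z \<in> alt n" and h: "\<And>x. x \<in> alt n \<Longrightarrow> h x = 1 / g + t * F x / g + p x" for h t p z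
  proof -
    have "alt.conv n u h z = alt.conv n u (\<lambda>x. (1 - t) / g + t / g * num_fixed n x + p x) z"
      by (rule alt.conv_cong[OF _ z]) (use g in \<open>simp add: h F_def field_simps\<close>)
    also have "\<dots> = (\<Sum>y\<in>alt n. u y) * ((1 - t) / g) + t / g * alt.conv n u (num_fixed n) z + alt.conv n u p z"
      unfolding alt.conv_add alt.conv_scale by (simp add: alt.conv_def sum_distrib_right sum_divide_distrib)
    also have "\<dots> = (1 - t) / g + t / g * ((real n - num_fixed n z) / (real n - 1)) + alt.conv n u p z"
      using conv_class_weight_num_fixed[OF c n4 z] sum_u by (simp add: u_def)
    also have "\<dots> = 1 / g - t / (real n - 1) * F z / g + alt.conv n u p z"
      using n4 g by (simp add: F_def field_simps)
    finally show ?thesis .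
  qed
  \<comment> \<open>Along the standard representation each further convolution multiplies by
    \<open>-a\<close>, so the coefficients of \<open>F\<close> are -1, \<open>a\<close>,
    \<open>-a^2\<close>, \<open>a^3\<close>.\<close>
  define a where "a = 1 / (real n - 1)"
  define \<beta> where "\<beta> k = (alt.conv n (class_weight n c) ^^ k) (class_weight n c)" for k
  have \<beta>_Suc: "\<beta> (Suc k) = alt.conv n u (\<beta> k)" for k by (simp add: \<beta>_def u_def)
  have \<beta>0: "\<beta> 0 x = 1 / g + (-1) * F x / g + w x" for x
    using g by (simp add: \<beta>_def u_def[symmetric] w_def F_def field_simps)
  have \<beta>1: "\<beta> 1 x = 1 / g + a * F x / g + w1 x" if "x \<in> alt n" for x
    using conv_split[OF that \<beta>0] \<beta>_Suc[of 0] by (simp add: a_def w1_def)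
  have \<beta>2: "\<beta> 2 x = 1 / g + (- (a * a)) * F x / g + w2 x" if "x \<in> alt n" for x
    using conv_split[OF that \<beta>1] \<beta>_Suc[of 1] by (simp add: a_def w2_def numeral_2_eq_2)
  have \<beta>3: "\<beta> 3 x = 1 / g + (a * a * a) * F x / g + w3 x" if "x \<in> alt n" for x
    using conv_split[OF that \<beta>2] \<beta>_Suc[of 2] by (simp add: a_def w3_def numeral_3_eq_3 numeral_2_eq_2)
  define W where "W = alt n - prods n B 4"
  have W: "finite W" "W \<subseteq> alt n" using alt.finite_G by (auto simp: W_def)
  have prods_sub: "prods n B 4 \<subseteq> alt n" using B by (rule prods_subset)
  have card_W: "real (card W) = g - real (card (prods n B 4))"
    unfolding W_def g_def using prods_sub alt.finite_G
    by (simp add: card_Diff_subset finite_subset card_mono of_nat_diff)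
  hence W_half: "real (card W) \<ge> g / 2" and W_le: "real (card W) \<le> g" using neg by (auto simp: g_def)
  have a: "0 \<le> a" "a * a * a \<le> 1 / 10"
  proof -
    show a0: "0 \<le> a" using n4 by (simp add: a_def)
    have a10: "a \<le> 1 / 10" using n_real by (simp add: a_def field_simps)
    have "a * a * a \<le> 1 * 1 * (1 / 10)" using a0 a10 by (intro mult_mono) auto
    thus "a * a * a \<le> 1 / 10" by simp
  qed
  have "real (card {x \<in> alt n. x \<circ> c \<circ> inv' x \<notin> B}) \<le> 1 / 20 * real (card (alt n))"
    using \<eta> of_nat_mono[OF \<eta>, where 'a = real] by simp
  from mass_outside_products[OF c_alt B this, of 3]
  have "(\<Sum>z\<in>alt n. \<beta> 3 z * of_bool (z \<notin> prods n B 4)) \<le> 4 * (1 / 20)"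
    by (simp add: \<beta>_def)
  also have "(\<Sum>z\<in>alt n. \<beta> 3 z * of_bool (z \<notin> prods n B 4)) = (\<Sum>z\<in>W. \<beta> 3 z)"
    using alt.finite_G unfolding W_def by (intro sum.mono_neutral_cong_right) auto
  finally have upper: "(\<Sum>z\<in>W. \<beta> 3 z) \<le> 1 / 5" by simp
  have "(\<Sum>z\<in>W. 9 / 10 / g + w3 z) \<le> (\<Sum>z\<in>W. \<beta> 3 z)"
  proof (rule sum_mono)
    fix z assume "z \<in> W"
    hence z: "z \<in> alt n" using W by blast
    have "- (1 / 10) \<le> a * a * a * F z"
    proof -
      have "(a * a * a) * (-1) \<le> a * a * a * F z"
        using a num_fixed_bounds[of n z] by (intro mult_left_mono) (auto simp: F_def)
      thus ?thesis using a(2) by linarith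
    qed
    hence "- (1 / 10) / g \<le> a * a * a * F z / g" using g by (intro divide_right_mono) auto
    moreover have "9 / 10 / g = 1 / g + - (1 / 10) / g" using g by (simp add: field_simps)
    ultimately show "9 / 10 / g + w3 z \<le> \<beta> 3 z" unfolding \<beta>3[OF z] by linarith
  qed
  also have "(\<Sum>z\<in>W. 9 / 10 / g + w3 z) = 9 / 10 * (real (card W) / g) + (\<Sum>z\<in>W. w3 z)"
    by (simp add: sum.distrib)
  finally have lower: "9 / 10 * (real (card W) / g) + (\<Sum>z\<in>W. w3 z) \<le> (\<Sum>z\<in>W. \<beta> 3 z)" .
  have "real (card W) / g \<ge> 1 / 2" using W_half g by (simp add: field_simps)
  moreover have "\<bar>\<Sum>z\<in>W. w3 z\<bar> \<le> 1 / 8"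
  proof (rule power2_le_imp_le[where y = "1 / 8 :: real"])
    have "(\<Sum>z\<in>W. 1 * w3 z)\<^sup>2 \<le> (\<Sum>z\<in>W. 1\<^sup>2) * (\<Sum>z\<in>W. (w3 z)\<^sup>2)" by (rule Cauchy_Schwarz_ineq_sum)
    also have "\<dots> \<le> g * alt.nsq n w3"
      using W W_le g unfolding alt.nsq_def
      by (intro mult_mono sum_mono2 alt.finite_G sum_nonneg) auto
    also have "\<dots> \<le> g * (16384 / (real n * g))" using g by (intro mult_left_mono nsq_w3) auto
    also have "\<dots> = 16384 / real n" using g by simp
    also have "\<dots> \<le> 1 / 64" using n_real by (simp add: field_simps)
    finally show "\<bar>\<Sum>z\<in>W. w3 z\<bar>\<^sup>2 \<le> (1 / 8)\<^sup>2" by (simp add: power2_eq_square)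
  qed simp
  ultimately show False using lower upper by linarith
qed

lemma prods_of_prods: "A \<subseteq> prods n B m \<Longrightarrow> z \<in> prods n A k \<Longrightarrow> z \<in> prods n B (k * m)"
proof (induction k arbitrary: z)
  case 0
  hence "z = id" by (auto simp: prods_alt_def)
  thus ?case using prods_0 by (simp only: mult_0)
next
  case (Suc k)
  then obtain a y where "a \<in> A" "y \<in> prods n A k" "z = a \<circ> y" using prods_Suc by blast
  hence "z \<in> prods n B (m + k * m)" using Suc.IH[OF Suc.prems(1)] Suc.prems(1) prods_mult by blast
  thus ?case by (simp only: mult_Suc)
qed

text \<open>If \<open>x = z \<circ> c ^^ i\<close>, then the power of \<open>c\<close> cancels in
  the conjugate of \<open>c\<close> by \<open>x\<close>, which becomes \<open>z c z^-1\<close>, a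
  product of \<open>(j + 1) + 1 + (j + 1) = 2 j + 3\<close> factors. Four such conjugates reach more
  than half of the group and eight reach all of it.\<close>

lemma large_degree_cover:
  assumes c: "full_cycle n c" and n: "n \<ge> 2 ^ 20" and r: "odd r" "5 \<le> r" "2 * r \<le> n"
    and r2: "(real n)\<^sup>2 / 16 \<le> real (r choose 2)"
    and S: "S \<subseteq> alt n" "c \<in> S"
  defines "g \<equiv> real (card (alt n))" and "B \<equiv> S \<union> inv' ` S"
  assumes bound: "20 * g * ((g / (real (r choose 2) * real (card S))) ^ j / real (card S)) \<le> 1"
  shows "prods n B (8 * (2 * j + 3)) = alt n"
proof -
  have c_alt: "c \<in> alt n" using c by (simp add: full_cycle_def)
  have B: "B \<subseteq> alt n" "c \<in> B" "S \<subseteq> B" "\<And>b. b \<in> B \<Longrightarrow> inv' b \<in> B"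
    using S alt.inv_G alt.inv_inv by (auto simp: B_def)
  define U where "U = {x \<in> alt n. \<not> (\<exists>z\<in>prods n S (Suc j). \<exists>i. x = z \<circ> c ^^ i)}"
  have g: "g > 0" using alt.card_G_pos by (simp add: g_def)
  have "real (card U) \<le> g\<^sup>2 * ((g / (real (r choose 2) * real (card S))) ^ j / real (card S))"
    unfolding U_def g_def by (rule card_not_in_product_with_cycle[OF c S(1) _ _ r]) (use S n in auto)
  also have "20 * \<dots> = g * (20 * g * ((g / (real (r choose 2) * real (card S))) ^ j / real (card S)))"
    by (simp add: power2_eq_square)
  also have "\<dots> \<le> g * 1" using g by (intro mult_left_mono bound) auto
  finally have U: "20 * card U \<le> card (alt n)" unfolding g_def by simp
  define A where "A = {x \<circ> c \<circ> inv' x | x. x \<in> alt n - U}"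
  have A_alt: "A \<subseteq> alt n" using c_alt alt.comp_G alt.inv_G unfolding A_def by blast
  have A_prods: "A \<subseteq> prods n B (2 * j + 3)"
  proof
    fix y assume "y \<in> A"
    then obtain x where x: "x \<in> alt n" "x \<notin> U" "y = x \<circ> c \<circ> inv' x" unfolding A_def by blast
    then obtain z i where zi: "z \<in> prods n S (Suc j)" "x = z \<circ> c ^^ i" unfolding U_def by blast
    have z: "z \<in> prods n B (Suc j)" using zi(1) prods_mono[OF B(3)] by blast
    have z_alt: "z \<in> alt n" using z prods_subset[OF B(1)] by blast
    have ci: "c ^^ i \<in> alt n" by (rule funpow_in_alt[OF c_alt])
    have comm: "c ^^ i \<circ> c = c \<circ> c ^^ i" by (simp add: fun_eq_iff funpow_swap1)
    have "y = z \<circ> c ^^ i \<circ> c \<circ> (inv' (c ^^ i) \<circ> inv' z)"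
      unfolding x(3) zi(2) by (simp only: alt.inv_of_comp[OF z_alt ci])
    also have "\<dots> = z \<circ> (c ^^ i \<circ> c) \<circ> inv' (c ^^ i) \<circ> inv' z" by (simp only: comp_assoc)
    also have "\<dots> = z \<circ> c \<circ> (c ^^ i \<circ> inv' (c ^^ i)) \<circ> inv' z" by (simp only: comm comp_assoc)
    also have "\<dots> = z \<circ> c \<circ> inv' z" by (simp only: alt.inv_comp(2)[OF ci] comp_id)
    finally have y: "y = z \<circ> c \<circ> inv' z" .
    have "z \<circ> c \<circ> inv' z \<in> prods n B (Suc j + 1 + Suc j)"
      by (intro prods_mult z prods_1 B(2) prods_inv[OF B(1,4)])
    thus "y \<in> prods n B (2 * j + 3)" unfolding y by (simp add: numeral_3_eq_3 mult_2 del: comp_apply)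
  qed
  have "{x \<in> alt n. x \<circ> c \<circ> inv' x \<notin> A} \<subseteq> U" unfolding A_def by blast
  moreover have "finite U" using alt.finite_G by (simp add: U_def)
  ultimately have "card {x \<in> alt n. x \<circ> c \<circ> inv' x \<notin> A} \<le> card U" by (rule card_mono[rotated])
  hence "20 * card {x \<in> alt n. x \<circ> c \<circ> inv' x \<notin> A} \<le> card (alt n)" using U by linarith
  hence half: "card (alt n) < 2 * card (prods n A 4)"
    by (rule half_covered[OF c n r r2 A_alt])
  define P where "P = prods n A 4"
  have P1: "P \<subseteq> alt n" unfolding P_def by (rule prods_subset[OF A_alt])
  have P2: "finite P" using P1 alt.finite_G by (rule finite_subset)
  note P = P1 P2
  have "alt n \<subseteq> prods n B (8 * (2 * j + 3))"
  proof
    fix x assume x: "x \<in> alt n"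
    define R where "R = (\<lambda>p. x \<circ> inv' p) ` P"
    have "inj_on (\<lambda>p. x \<circ> inv' p) P"
    proof (rule inj_onI)
      fix p q assume pq: "p \<in> P" "q \<in> P" "x \<circ> inv' p = x \<circ> inv' q"
      hence "inv' x \<circ> (x \<circ> inv' p) = inv' x \<circ> (x \<circ> inv' q)" by simp
      hence "inv' p = inv' q" by (simp only: alt.inv_comp_cancel(1)[OF x])
      thus "p = q" using pq P(1) alt.inv_inv by (metis subsetD)
    qed
    hence cR: "card R = card P" unfolding R_def by (rule card_image)
    have R: "R \<subseteq> alt n" unfolding R_def using x P(1) alt.comp_G alt.inv_G by blast
    \<comment> \<open>\<open>P\<close> and \<open>x P^-1\<close> each fill more than half of the
      group, so they meet and \<open>x\<close> is a product of two elements of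
      \<open>P\<close>.\<close>
    have "P \<inter> R \<noteq> {}"
    proof
      assume "P \<inter> R = {}"
      hence "card (P \<union> R) = card P + card R"
        using P(2) by (intro card_Un_disjoint) (auto simp: R_def)
      moreover have "card (P \<union> R) \<le> card (alt n)"
        using P(1) R alt.finite_G by (intro card_mono) auto
      ultimately show False using half cR by (simp add: P_def)
    qed
    then obtain p q where pq: "p \<in> P" "q \<in> P" "p = x \<circ> inv' q" by (auto simp: R_def simp del: comp_apply)
    have q: "q \<in> alt n" using pq P(1) by blast
    have "x = p \<circ> q" unfolding pq(3) by (simp only: comp_assoc alt.inv_comp(1)[OF q] comp_id)
    hence "x \<in> prods n A (4 + 4)" using pq(1,2) prods_mult unfolding P_def by blast
    thus "x \<in> prods n B (8 * (2 * j + 3))" using prods_of_prods[OF A_prods, of x "4 + 4"] by simp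
  qed
  thus ?thesis using prods_subset[OF B(1)] by blast
qed

section \<open>Large subgroups containing a full cycle\<close>

definition cyc3 :: "'a \<Rightarrow> 'a \<Rightarrow> 'a \<Rightarrow> 'a \<Rightarrow> 'a"
  where "cyc3 a b c = transpose a b \<circ> transpose b c"

lemma cyc3_conj: "inj x \<Longrightarrow> x \<circ> cyc3 a b c = cyc3 (x a) (x b) (x c) \<circ> x"
proof -
  assume x: "inj x"
  have "x \<circ> cyc3 a b c = (x \<circ> transpose a b) \<circ> transpose b c" by (simp only: cyc3_def comp_assoc)
  also have "\<dots> = transpose (x a) (x b) \<circ> (x \<circ> transpose b c)" by (simp only: transpose_conj[OF x] comp_assoc)
  also have "\<dots> = cyc3 (x a) (x b) (x c) \<circ> x" by (simp only: transpose_conj[OF x] cyc3_def comp_assoc)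
  finally show ?thesis .
qed

lemma cyc3_rotate: "distinct [a, b, c] \<Longrightarrow> cyc3 a b c = cyc3 b c a"
  by (auto simp: cyc3_def fun_eq_iff transpose_def)

lemma cyc3_apply:
  "distinct [a, b, c] \<Longrightarrow> cyc3 a b c a = b" "distinct [a, b, c] \<Longrightarrow> cyc3 a b c b = c"
  "distinct [a, b, c] \<Longrightarrow> cyc3 a b c c = a" "x \<notin> {a, b, c} \<Longrightarrow> cyc3 a b c x = x"
  by (auto simp: cyc3_def transpose_def)

lemma cyc3_inverse: "cyc3 a b c \<circ> cyc3 c b a = id"
  by (simp add: cyc3_def fun_eq_iff transpose_commute[of c b] transpose_commute[of b a])

lemma cyc3_in_alt: "distinct [a, b, c] \<Longrightarrow> {a, b, c} \<subseteq> {1..n} \<Longrightarrow> cyc3 a b c \<in> alt n"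
  unfolding cyc3_def alt_group_carrier
  by (auto intro!: permutes_compose permutes_swap_id simp: evenperm_comp evenperm_swap permutation_swap_id)

lemma transpose_product_adjacent: "c \<noteq> b \<Longrightarrow> a \<noteq> b \<Longrightarrow> transpose a b \<circ> transpose c b = cyc3 a b c"
  by (simp add: cyc3_def transpose_commute[of c b])

locale alt_subgroup =
  fixes n :: nat and H :: "(nat \<Rightarrow> nat) set"
  assumes H_alt: "H \<subseteq> alt n" and H_id: "id \<in> H"
    and H_comp: "x \<in> H \<Longrightarrow> y \<in> H \<Longrightarrow> x \<circ> y \<in> H"
    and H_inv: "x \<in> H \<Longrightarrow> inv' x \<in> H"
begin

lemma H_mem: "x \<in> H \<Longrightarrow> x \<in> alt n" using H_alt by blast

lemma finite_H: "finite H" using H_alt alt.finite_G finite_subset by blast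

lemma H_apply: "x \<in> H \<Longrightarrow> i \<in> {1..n} \<Longrightarrow> x i \<in> {1..n}"
  using H_mem alt_apply_mem by blast

lemma H_eq_iff: "x \<in> H \<Longrightarrow> x i = x j \<longleftrightarrow> i = j"
  using H_mem alt_eq_iff by blast

text \<open>Count the pairs \<open>(i, h)\<close> by their product \<open>x i \<circ> h\<close>.
  Pairs with equal products have indices in a common left coset of \<open>H\<close>, and
  \<open>h\<close> is determined by the index, so each product occurs at most \<open>s\<close>
  times.\<close>

lemma coset_packing:
  fixes x :: "'i \<Rightarrow> nat \<Rightarrow> nat"
  assumes "finite I" and x: "\<And>i. i \<in> I \<Longrightarrow> x i \<in> alt n"
    and s: "\<And>i. i \<in> I \<Longrightarrow> card {j \<in> I. inv' (x i) \<circ> x j \<in> H} \<le> s"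
  shows "card I * card H \<le> s * card (alt n)"
proof -
  define f :: "'i \<times> (nat \<Rightarrow> nat) \<Rightarrow> nat \<Rightarrow> nat" where "f p = x (fst p) \<circ> snd p" for p
  have f: "f p \<in> alt n" if "p \<in> I \<times> H" for p
    unfolding f_def using that x H_mem by (intro alt.comp_G) auto
  have fiber: "card {p \<in> I \<times> H. f p = y} \<le> s" for y
  proof (cases "\<exists>p\<in>I \<times> H. f p = y")
    case False
    hence "{p \<in> I \<times> H. f p = y} = {}" by blast
    thus ?thesis by (simp only: card.empty le0)
  next
    case True
    then obtain i h where ih: "i \<in> I" "h \<in> H" "x i \<circ> h = y" by (auto simp: f_def simp del: comp_apply)
    define J where "J = {j \<in> I. inv' (x i) \<circ> x j \<in> H}"
    have sub: "fst p \<in> J \<and> snd p = inv' (x (fst p)) \<circ> y" if p: "p \<in> I \<times> H" "f p = y" for p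
    proof -
      obtain j k where jk: "p = (j, k)" by (cases p)
      have j: "j \<in> I" "k \<in> H" "x j \<circ> k = y" using p jk by (auto simp: f_def simp del: comp_apply)
      have k: "k = inv' (x j) \<circ> y" unfolding j(3)[symmetric] by (rule alt.inv_comp_cancel(1)[OF x[OF j(1)], symmetric])
      have "x j \<circ> k \<circ> inv' k = x i \<circ> h \<circ> inv' k" using j ih by simp
      hence xj: "x j = x i \<circ> (h \<circ> inv' k)"
        by (simp only: comp_assoc alt.inv_comp(2)[OF H_mem[OF j(2)]] comp_id)
      have "inv' (x i) \<circ> x j = h \<circ> inv' k" unfolding xj by (rule alt.inv_comp_cancel(1)[OF x[OF ih(1)]])
      hence "inv' (x i) \<circ> x j \<in> H" using H_comp H_inv ih j by simp
      thus ?thesis using j k jk by (simp add: J_def)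
    qed
    have "inj_on fst {p \<in> I \<times> H. f p = y}"
    proof (rule inj_onI)
      fix p p' assume "p \<in> {p \<in> I \<times> H. f p = y}" "p' \<in> {p \<in> I \<times> H. f p = y}" "fst p = fst p'"
      thus "p = p'" using sub[of p] sub[of p'] by (simp add: prod_eq_iff)
    qed
    hence "card {p \<in> I \<times> H. f p = y} \<le> card J"
      using sub assms(1) by (intro card_inj_on_le[of fst]) (auto simp: J_def)
    also have "\<dots> \<le> s" unfolding J_def by (rule s[OF ih(1)])
    finally show ?thesis .
  qed
  have "I \<times> H = (\<Union>y\<in>alt n. {p \<in> I \<times> H. f p = y})" using f by blast
  hence "card (I \<times> H) = card (\<Union>y\<in>alt n. {p \<in> I \<times> H. f p = y})" by (rule arg_cong)
  also have "\<dots> \<le> (\<Sum>y\<in>alt n. card {p \<in> I \<times> H. f p = y})" by (rule card_UN_le[OF alt.finite_G])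
  also have "\<dots> \<le> (\<Sum>y\<in>alt n. s)" by (intro sum_mono fiber)
  finally show ?thesis by (simp add: card_cartesian_product mult.commute)
qed

lemma coset_packing_distinct:
  fixes x :: "'i \<Rightarrow> nat \<Rightarrow> nat"
  assumes "finite I" and x: "\<And>i. i \<in> I \<Longrightarrow> x i \<in> alt n"
    and "\<And>i j. i \<in> I \<Longrightarrow> j \<in> I \<Longrightarrow> inv' (x i) \<circ> x j \<in> H \<Longrightarrow> i = j"
  shows "card I * card H \<le> card (alt n)"
proof -
  have "card {j \<in> I. inv' (x i) \<circ> x j \<in> H} \<le> 1" if "i \<in> I" for i
  proof -
    have "{j \<in> I. inv' (x i) \<circ> x j \<in> H} \<subseteq> {i}" using assms(3) that by blast
    hence "card {j \<in> I. inv' (x i) \<circ> x j \<in> H} \<le> card {i}" by (intro card_mono) auto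
    thus ?thesis by simp
  qed
  thus ?thesis using coset_packing[OF assms(1) x, where s = 1] by simp
qed

definition has_cyc3 :: bool
  where "has_cyc3 \<longleftrightarrow> (\<exists>a b c. {a, b, c} \<subseteq> {1..n} \<and> distinct [a, b, c] \<and> cyc3 a b c \<in> H)"

lemma has_cyc3I: "{a, b, c} \<subseteq> {1..n} \<Longrightarrow> distinct [a, b, c] \<Longrightarrow> cyc3 a b c \<in> H \<Longrightarrow> has_cyc3"
  unfolding has_cyc3_def by blast

definition two_transitive :: bool
  where "two_transitive \<longleftrightarrow> (\<forall>a b a' b'. {a, b, a', b'} \<subseteq> {1..n} \<longrightarrow> a \<noteq> b \<longrightarrow> a' \<noteq> b' \<longrightarrow>
    (\<exists>x\<in>H. x a = a' \<and> x b = b'))"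

definition three_transitive :: bool
  where "three_transitive \<longleftrightarrow> (\<forall>a b c a' b' c'. {a, b, c, a', b', c'} \<subseteq> {1..n} \<longrightarrow>
    distinct [a, b, c] \<longrightarrow> distinct [a', b', c'] \<longrightarrow> (\<exists>x\<in>H. x a = a' \<and> x b = b' \<and> x c = c'))"

lemma cyc3_conj_mem:
  assumes "x \<in> H" "cyc3 a b c \<in> H"
  shows "cyc3 (x a) (x b) (x c) \<in> H"
proof -
  have x: "x \<in> alt n" by (rule H_mem[OF assms(1)])
  have "inj x" using alt.bij_G[OF x] by (rule bij_is_inj)
  hence "x \<circ> cyc3 a b c \<circ> inv' x = cyc3 (x a) (x b) (x c) \<circ> (x \<circ> inv' x)"
    by (simp only: cyc3_conj comp_assoc)
  also have "\<dots> = cyc3 (x a) (x b) (x c)" by (simp only: alt.inv_comp(2)[OF x] comp_id)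
  finally show ?thesis using H_comp H_inv assms by metis
qed

lemma cyc3_inverse_mem: "cyc3 a b c \<in> H \<Longrightarrow> cyc3 c b a \<in> H"
proof -
  assume m: "cyc3 a b c \<in> H"
  have "inv' (cyc3 a b c) \<circ> (cyc3 a b c \<circ> cyc3 c b a) = cyc3 c b a"
    by (rule alt.inv_comp_cancel(1)[OF H_mem[OF m]])
  hence "inv' (cyc3 a b c) = cyc3 c b a" by (simp only: cyc3_inverse comp_id)
  thus ?thesis using H_inv[OF m] by simp
qed

text \<open>Double transitivity moves the given 3-cycle to one through any ordered pair
  \<open>p\<close>, \<open>q\<close>, with no control over its third point. Conjugating 3-cycles
  through \<open>p\<close>, \<open>q\<close> and through \<open>q\<close>, \<open>r\<close> by one
  another yields the 3-cycle on \<open>p\<close>, \<open>q\<close>, \<open>r\<close>.\<close>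

lemma eq_alt_of_cyc3:
  assumes two: two_transitive and three: has_cyc3
  shows "H = alt n"
proof -
  obtain a b c where abc: "{a, b, c} \<subseteq> {1..n}" "distinct [a, b, c]" "cyc3 a b c \<in> H"
    using three unfolding has_cyc3_def by blast
  have some: "\<exists>u\<in>{1..n}. u \<noteq> p \<and> u \<noteq> q \<and> cyc3 p q u \<in> H" if pq: "p \<in> {1..n}" "q \<in> {1..n}" "p \<noteq> q" for p q
  proof -
    have "{a, b, p, q} \<subseteq> {1..n}" "a \<noteq> b" using abc pq by auto
    then obtain x where x: "x \<in> H" "x a = p" "x b = q" using two pq unfolding two_transitive_def by blast
    have "x c \<noteq> p" "x c \<noteq> q" "x c \<in> {1..n}" using abc x H_eq_iff[OF x(1)] H_apply[OF x(1)] by auto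
    thus ?thesis using cyc3_conj_mem[OF x(1) abc(3)] x by blast
  qed
  have all: "cyc3 p q r \<in> H" if pqr: "{p, q, r} \<subseteq> {1..n}" "distinct [p, q, r]" for p q r
  proof -
    obtain u where u: "u \<noteq> p" "u \<noteq> q" "cyc3 p q u \<in> H" using some[of p q] pqr by auto
    obtain v where v: "v \<noteq> q" "v \<noteq> r" "cyc3 q r v \<in> H" using some[of q r] pqr by auto
    consider "u = r" | "v = p" | "u \<noteq> r" "v \<noteq> p" "u = v" | "u \<noteq> r" "v \<noteq> p" "u \<noteq> v" by blast
    thus ?thesis
    proof cases
      case 1 thus ?thesis using u by simp
    next
      case 2 thus ?thesis using v cyc3_rotate[of p q r] pqr by simp
    next
      case 3
      have "cyc3 (cyc3 q r v p) (cyc3 q r v q) (cyc3 q r v u) \<in> H" by (rule cyc3_conj_mem[OF v(3) u(3)])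
      moreover have d: "distinct [q, r, v]" using v pqr by auto
      moreover have "cyc3 q r v p = p" by (rule cyc3_apply(4)) (use 3 pqr in auto)
      moreover have "cyc3 q r v u = q" unfolding 3(3) by (rule cyc3_apply(3)[OF d])
      moreover note cyc3_apply(1)[OF d]
      ultimately have "cyc3 p r q \<in> H" by simp
      hence "cyc3 q r p \<in> H" by (rule cyc3_inverse_mem)
      thus ?thesis using cyc3_rotate[of p q r] pqr by simp
    next
      case 4
      have "cyc3 (cyc3 q r v p) (cyc3 q r v q) (cyc3 q r v u) \<in> H" by (rule cyc3_conj_mem[OF v(3) u(3)])
      moreover have d: "distinct [q, r, v]" using v pqr by auto
      moreover have "cyc3 q r v p = p" by (rule cyc3_apply(4)) (use 4 pqr in auto)
      moreover have "cyc3 q r v u = u" by (rule cyc3_apply(4)) (use 4 u in auto)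
      moreover note cyc3_apply(1)[OF d]
      ultimately have D: "cyc3 p r u \<in> H" by simp
      have "cyc3 (cyc3 p r u p) (cyc3 p r u q) (cyc3 p r u u) \<in> H" by (rule cyc3_conj_mem[OF D u(3)])
      moreover have d': "distinct [p, r, u]" using 4 u pqr by auto
      moreover have "cyc3 p r u q = q" by (rule cyc3_apply(4)) (use u pqr in auto)
      moreover note cyc3_apply(1,3)[OF d']
      ultimately have "cyc3 r q p \<in> H" by simp
      thus ?thesis by (rule cyc3_inverse_mem)
    qed
  qed
  have three_sub: "three_cycles n \<subseteq> H"
  proof
    fix y assume "y \<in> three_cycles n"
    then obtain cs where cs: "y = cycle_of_list cs" "distinct cs" "length cs = 3" "set cs \<subseteq> {1..n}" by blast
    obtain p q r where pqr: "cs = [p, q, r]" using stupid_lemma[OF cs(3)] by blast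
    have "y = cyc3 p q r" unfolding cs(1) pqr by (simp add: cyc3_def)
    thus "y \<in> H" using all[of p q r] cs pqr by simp
  qed
  interpret G: group "alt_group n" by (rule alt_group_is_group)
  have "subgroup H (alt_group n)"
  proof (rule G.subgroupI)
    show "H \<subseteq> alt n" "H \<noteq> {}" using H_alt H_id by auto
    show "inv\<^bsub>alt_group n\<^esub> x \<in> H" if "x \<in> H" for x
      using alt_group_inv_equality[OF H_mem[OF that]] H_inv[OF that] by simp
    show "x \<otimes>\<^bsub>alt_group n\<^esub> y \<in> H" if "x \<in> H" "y \<in> H" for x y
      unfolding alt_group_mult by (rule H_comp[OF that])
  qed
  hence "generate (alt_group n) (three_cycles n) \<subseteq> H"
    using three_sub G.generate_subgroup_incl by blast
  thus ?thesis using alt_group_carrier_as_three_cycles[of n] H_alt by blast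
qed

text \<open>Left multiplication by \<open>k\<close> maps the fibre over \<open>v\<close> injectively
  into the fibre over \<open>v'\<close>, so all fibres have the same size. Applied to
  \<open>E = H\<close> or to a stabilizer this is the orbit-stabilizer count; it also serves for a
  coset of a stabilizer.\<close>

lemma equidistribution:
  assumes E: "E \<subseteq> H" and V: "finite V" "\<And>x. x \<in> E \<Longrightarrow> x c \<in> V"
    and move: "\<And>v v'. v \<in> V \<Longrightarrow> v' \<in> V \<Longrightarrow> \<exists>k\<in>H. (\<forall>x\<in>E. k \<circ> x \<in> E) \<and> k v = v'"
    and "v \<in> V"
  shows "card E = card V * card {x \<in> E. x c = v}"
proof -
  have finE: "finite E" using E finite_H finite_subset by blast
  have le: "card {x \<in> E. x c = v} \<le> card {x \<in> E. x c = v'}" if vv': "v \<in> V" "v' \<in> V" for v v'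
  proof -
    obtain k where k: "k \<in> H" "\<forall>x\<in>E. k \<circ> x \<in> E" "k v = v'" using move[OF vv'] by blast
    have "inj_on (\<lambda>x. k \<circ> x) {x \<in> E. x c = v}"
    proof (rule inj_onI)
      fix x y assume "k \<circ> x = k \<circ> y"
      hence "inv' k \<circ> (k \<circ> x) = inv' k \<circ> (k \<circ> y)" by simp
      thus "x = y" by (simp only: alt.inv_comp_cancel(1)[OF H_mem[OF k(1)]])
    qed
    moreover have "(\<lambda>x. k \<circ> x) ` {x \<in> E. x c = v} \<subseteq> {x \<in> E. x c = v'}" using k by auto
    ultimately show ?thesis using finE by (intro card_inj_on_le) auto
  qed
  have "E = (\<Union>v\<in>V. {x \<in> E. x c = v})" using V by blast
  hence "card E = card (\<Union>v\<in>V. {x \<in> E. x c = v})" by simp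
  also have "\<dots> = (\<Sum>v\<in>V. card {x \<in> E. x c = v})"
    using V(1) finE by (intro card_UN_disjoint) auto
  also have "\<dots> = (\<Sum>v'\<in>V. card {x \<in> E. x c = v})"
    using le \<open>v \<in> V\<close> by (intro sum.cong refl antisym) auto
  finally show ?thesis by simp
qed

text \<open>Two transpositions in the same coset of \<open>H\<close> are disjoint unless \<open>H\<close> contains a 3-cycle, so
  every coset contains at most \<open>n/2\<close> transpositions.\<close>

lemma transposition_cosets:
  assumes n: "n \<ge> 2" and no3: "\<not> has_cyc3"
  shows "(n choose 2) * card H \<le> (n div 2) * card (alt n)"
    and "card (alt n) < (n choose 2) * card H \<Longrightarrow>
      \<exists>a b c d. {a, b, c, d} \<subseteq> {1..n} \<and> distinct [a, b, c, d] \<and> transpose a b \<circ> transpose c d \<in> H"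
proof -
  define I where "I = {e. e \<subseteq> {1..n} \<and> card e = 2}"
  define t :: "nat set \<Rightarrow> nat \<Rightarrow> nat" where "t e = transpose (Min e) (Max e)" for e
  have finI: "finite I" by (simp add: I_def)
  have cI: "card I = n choose 2" by (simp add: I_def n_subsets)
  have edge: "\<exists>a b. e = {a, b} \<and> a \<noteq> b \<and> {a, b} \<subseteq> {1..n} \<and> t e = transpose a b" if "e \<in> I" for e
  proof -
    obtain a b where ab: "e = {a, b}" "a \<noteq> b" using \<open>e \<in> I\<close> by (auto simp: I_def card_2_iff)
    have "t e = transpose a b"
      using ab by (cases "a < b") (auto simp: t_def transpose_commute min_def max_def)
    thus ?thesis using ab \<open>e \<in> I\<close> by (auto simp: I_def)
  qed
  have edge_at: "\<exists>a. e = {a, b} \<and> a \<noteq> b \<and> {a, b} \<subseteq> {1..n} \<and> t e = transpose a b"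
    if be: "e \<in> I" "b \<in> e" for e b
  proof -
    obtain p q where pq: "e = {p, q}" "p \<noteq> q" "{p, q} \<subseteq> {1..n}" "t e = transpose p q"
      using edge[OF be(1)] by blast
    show ?thesis
    proof (cases "b = q")
      case True thus ?thesis using pq by blast
    next
      case False
      hence "b = p" using be pq by auto
      moreover have "t e = transpose q p" using pq(4) transpose_commute by (rule trans)
      ultimately show ?thesis using pq(1-3) by blast
    qed
  qed
  have t2: "t e \<circ> t e = id" for e by (simp add: t_def)
  \<comment> \<open>The fixed factor \<open>transpose 1 2\<close> makes the transpositions even; it
    cancels in the quotients.\<close>
  define x where "x e = transpose 1 2 \<circ> t e" for e
  have x_alt: "x e \<in> alt n" if "e \<in> I" for e
  proof -
    obtain a b where ab: "a \<noteq> b" "{a, b} \<subseteq> {1..n}" "t e = transpose a b" using edge[OF \<open>e \<in> I\<close>] by blast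
    show ?thesis unfolding x_def ab(3) alt_group_carrier using ab n
      by (auto intro!: permutes_compose permutes_swap_id simp: evenperm_comp evenperm_swap permutation_swap_id)
  qed
  have quot: "inv' (x e) \<circ> x f = t e \<circ> t f" if "e \<in> I" for e f
  proof -
    have "x e \<circ> (t e \<circ> transpose 1 2) = transpose 1 2 \<circ> (t e \<circ> t e) \<circ> transpose 1 2"
      by (simp only: x_def comp_assoc)
    hence "x e \<circ> (t e \<circ> transpose 1 2) = id" by (simp only: t2 comp_id transpose_comp_involutory)
    hence "inv' (x e) \<circ> (x e \<circ> (t e \<circ> transpose 1 2)) = inv' (x e)" by (simp only: comp_id)
    hence "inv' (x e) = t e \<circ> transpose 1 2" by (simp only: alt.inv_comp_cancel(1)[OF x_alt[OF \<open>e \<in> I\<close>]])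
    hence "inv' (x e) \<circ> x f = t e \<circ> (transpose 1 2 \<circ> transpose 1 2) \<circ> t f" by (simp only: x_def comp_assoc)
    thus ?thesis by (simp only: transpose_comp_involutory comp_id)
  qed
  have disj: "e \<inter> f = {}" if ef: "e \<in> I" "f \<in> I" "e \<noteq> f" "t e \<circ> t f \<in> H" for e f
  proof (rule ccontr)
    assume "e \<inter> f \<noteq> {}"
    then obtain b where b: "b \<in> e" "b \<in> f" by blast
    obtain a where a: "e = {a, b}" "a \<noteq> b" "t e = transpose a b" "{a, b} \<subseteq> {1..n}"
      using edge_at[OF ef(1) b(1)] by blast
    obtain c where c: "f = {c, b}" "c \<noteq> b" "t f = transpose c b" "{c, b} \<subseteq> {1..n}"
      using edge_at[OF ef(2) b(2)] by blast
    have "a \<noteq> c" using a c ef(3) by auto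
    moreover have "cyc3 a b c \<in> H"
      using ef(4) unfolding a(3) c(3) by (simp only: transpose_product_adjacent[OF c(2) a(2)])
    moreover have "{a, b, c} \<subseteq> {1..n}" using a(4) c(4) by simp
    moreover have "distinct [a, b, c]" using a(2) c(2) \<open>a \<noteq> c\<close> by simp
    ultimately have has_cyc3 by (intro has_cyc3I)
    thus False using no3 by contradiction
  qed
  have bound: "card {f \<in> I. inv' (x e) \<circ> x f \<in> H} \<le> n div 2" if e: "e \<in> I" for e
  proof -
    define J where "J = {f \<in> I. t e \<circ> t f \<in> H}"
    have JI: "J \<subseteq> I" by (auto simp: J_def)
    have finJ: "finite J" using JI finI finite_subset by blast
    have pd: "f \<inter> f' = {}" if "f \<in> J" "f' \<in> J" "f \<noteq> f'" for f f'
    proof (rule disj)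
      have m: "t e \<circ> t f \<in> H" "t e \<circ> t f' \<in> H" using that by (auto simp: J_def)
      have "(t e \<circ> t f) \<circ> (t f \<circ> t e) = t e \<circ> (t f \<circ> t f) \<circ> t e" by (simp only: comp_assoc)
      hence "(t e \<circ> t f) \<circ> (t f \<circ> t e) = id" by (simp only: t2 comp_id)
      hence "inv' (t e \<circ> t f) \<circ> ((t e \<circ> t f) \<circ> (t f \<circ> t e)) = inv' (t e \<circ> t f)" by (simp only: comp_id)
      hence "inv' (t e \<circ> t f) = t f \<circ> t e" by (simp only: alt.inv_comp_cancel(1)[OF H_mem[OF m(1)]])
      hence m': "t f \<circ> t e \<in> H" using H_inv[OF m(1)] by (simp only:)
      have "(t f \<circ> t e) \<circ> (t e \<circ> t f') \<in> H" by (rule H_comp[OF m' m(2)])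
      moreover have "(t f \<circ> t e) \<circ> (t e \<circ> t f') = t f \<circ> (t e \<circ> t e) \<circ> t f'" by (simp only: comp_assoc)
      ultimately show "t f \<circ> t f' \<in> H" by (simp only: t2 comp_id)
    qed (use that JI in auto)
    have "card (\<Union>J) = (\<Sum>f\<in>J. card f)"
    proof (rule card_Union_disjoint)
      show "pairwise disjnt J" using pd by (auto simp: pairwise_def disjnt_def)
      show "finite f" if "f \<in> J" for f using that JI finite_subset[of f "{1..n}"] by (auto simp: I_def)
    qed
    also have "\<dots> = 2 * card J" using JI by (subst sum.cong[OF refl, of J card "\<lambda>_. 2"]) (auto simp: I_def)
    finally have "2 * card J = card (\<Union>J)" by simp
    also have "\<dots> \<le> card {1..n}" using JI by (intro card_mono) (auto simp: I_def)
    finally have "card J \<le> n div 2" by simp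
    thus ?thesis unfolding J_def by (simp only: quot[OF e])
  qed
  show "(n choose 2) * card H \<le> (n div 2) * card (alt n)"
    using coset_packing[OF finI x_alt bound] cI by simp
  assume big: "card (alt n) < (n choose 2) * card H"
  have "\<exists>e\<in>I. \<exists>f\<in>I. inv' (x e) \<circ> x f \<in> H \<and> e \<noteq> f"
  proof (rule ccontr)
    assume neg: "\<not> ?thesis"
    have "card I * card H \<le> card (alt n)"
      by (rule coset_packing_distinct[where x = x, OF finI]) (use x_alt neg in blast)+
    thus False using big cI by simp
  qed
  then obtain e f where ef: "e \<in> I" "f \<in> I" "e \<noteq> f" "t e \<circ> t f \<in> H" using quot by metis
  obtain a b where ab: "e = {a, b}" "a \<noteq> b" "{a, b} \<subseteq> {1..n}" "t e = transpose a b" using edge[OF ef(1)] by blast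
  obtain c d where cd: "f = {c, d}" "c \<noteq> d" "{c, d} \<subseteq> {1..n}" "t f = transpose c d" using edge[OF ef(2)] by blast
  have d: "distinct [a, b, c, d]" using disj[OF ef] ab(1,2) cd(1,2) by auto
  have sub: "{a, b, c, d} \<subseteq> {1..n}" using ab(3) cd(3) by simp
  have m: "transpose a b \<circ> transpose c d \<in> H" using ef(4) by (simp only: ab(4) cd(4))
  show "\<exists>a b c d. {a, b, c, d} \<subseteq> {1..n} \<and> distinct [a, b, c, d] \<and> transpose a b \<circ> transpose c d \<in> H"
    by (rule exI[of _ a], rule exI[of _ b], rule exI[of _ c], rule exI[of _ d], intro conjI sub d m)
qed

text \<open>The index of \<open>H\<close> is less than \<open>n (n - 3) / 2\<close>, and
  \<open>(n - 1) choose 2\<close> is one more than that number. Let \<open>O2\<close> be the orbit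
  of 2 under the stabilizer \<open>H1\<close> of 1. If \<open>O2\<close> and its complement in
  \<open>{2..n}\<close> both have at least two points, the images of \<open>O2\<close> under even
  permutations fixing 1 lie in distinct cosets, and there are at least
  \<open>(n - 1) choose 2\<close> of them. If one of the two is a single point, \<open>H1\<close>
  fixes it, and the cycle produces a third fixed point, which gives \<open>(n - 1) (n - 2)\<close>
  cosets.\<close>

lemma two_transitive_of_card:
  assumes c: "full_cycle n c" "c \<in> H" and n: "n \<ge> 5" "odd n"
    and big: "2 * card (alt n) < n * (n - 3) * card H"
  shows two_transitive
proof -
  have n_eq: "(n - 1) * (n - 2) = n * (n - 3) + 2"
  proof -
    obtain k where "n = k + 5" using n(1) le_Suc_ex by (metis add.commute)
    thus ?thesis by (simp add: algebra_simps)
  qed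
  have c_alt: "c \<in> alt n" and c_pow: "c ^^ n = id" using c by (auto simp: full_cycle_def)
  have pow: "c ^^ k \<in> H" for k
  proof (induction k)
    case 0 show ?case using H_id by (simp only: funpow_0 funpow.simps(1))
  next
    case (Suc k) show ?case unfolding funpow.simps(2) by (rule H_comp[OF c(2) Suc])
  qed
  have no_fix: "c ^^ k = id" if "(c ^^ k) 1 = 1" for k
  proof
    fix i
    have comm: "c ((c ^^ k) j) = (c ^^ k) (c j)" for j by (simp add: funpow_swap1)
    have "(c ^^ k) j = j" if "j \<in> {1..n}" for j
      by (rule full_cycle_funpow_induct[OF c(1), where P = "\<lambda>j. (c ^^ k) j = j"])
        (use \<open>(c ^^ k) 1 = 1\<close> that comm[symmetric] in auto)
    moreover have "(c ^^ k) i = i" if "i \<notin> {1..n}"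
      using H_mem[OF pow[of k]] that by (auto simp: alt_group_carrier permutes_not_in)
    ultimately show "(c ^^ k) i = id i" by (cases "i \<in> {1..n}") auto
  qed
  define H1 where "H1 = {x \<in> H. x 1 = 1}"
  have H1_comp: "x \<circ> y \<in> H1" if "x \<in> H1" "y \<in> H1" for x y
    using that H_comp by (auto simp: H1_def)
  have H1_inv: "inv' x \<in> H1" if "x \<in> H1" for x
  proof -
    have "x \<in> H" "x 1 = 1" using that by (auto simp: H1_def)
    hence "inv' x 1 = 1" using alt.inv_comp_apply(1)[OF H_mem, of x 1] by simp
    thus ?thesis using H_inv \<open>x \<in> H\<close> by (simp add: H1_def)
  qed
  \<comment> \<open>Since \<open>y\<close> commutes with \<open>c\<close>, conjugation by the power
    of \<open>c\<close> that takes 1 to \<open>i\<close> carries a fixed point \<open>y 1\<close> of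
    \<open>H1\<close> to the fixed point \<open>y i\<close> of the stabilizer of
    \<open>i\<close>.\<close>
  have fixed_pair: "x (y i) = y i" if x: "x \<in> H" "x i = i" "i \<in> {1..n}" and y: "\<And>z. z \<in> H1 \<Longrightarrow> z (y 1) = y 1"
    and yc: "\<And>j. y (c j) = c (y j)" for x y i
  proof -
    obtain k where k: "(c ^^ k) 1 = i" using c(1) x(3) unfolding full_cycle_def by blast
    have yk: "y ((c ^^ k) 1) = (c ^^ k) (y 1)" for k by (induction k) (simp_all add: yc)
    have ck: "c ^^ k \<in> alt n" by (rule H_mem[OF pow])
    have "inv' (c ^^ k) \<circ> x \<circ> (c ^^ k) \<in> H" by (intro H_comp H_inv pow x(1))
    moreover have "(inv' (c ^^ k) \<circ> x \<circ> (c ^^ k)) 1 = 1"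
      using k x(2) alt.inv_comp_apply(1)[OF ck, of 1] by simp
    ultimately have "(inv' (c ^^ k) \<circ> x \<circ> (c ^^ k)) (y 1) = y 1" using y by (auto simp: H1_def simp del: comp_apply)
    hence "inv' (c ^^ k) (x (y i)) = y 1" using yk[of k] k by simp
    hence "(c ^^ k) (inv' (c ^^ k) (x (y i))) = (c ^^ k) (y 1)" by simp
    thus ?thesis using alt.inv_comp_apply(2)[OF ck] yk[of k] k by simp
  qed
  have no_common_fixed_point: False if p: "p \<in> {2..n}" "\<And>x. x \<in> H1 \<Longrightarrow> x p = p" for p
  proof -
    obtain e where e: "(c ^^ e) 1 = p" using c(1) p(1) unfolding full_cycle_def by force
    define y where "y = c ^^ e"
    have y_alt: "y \<in> alt n" unfolding y_def by (rule H_mem[OF pow])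
    have yc: "y (c j) = c (y j)" for j by (simp add: y_def funpow_swap1)
    have y1: "y 1 = p" using e by (simp add: y_def)
    define q where "q = y p"
    have q_n: "q \<in> {1..n}" using alt_apply_mem[OF y_alt, of p] p(1) by (simp add: q_def)
    have fix_q: "x q = q" if "x \<in> H1" for x
      unfolding q_def
      by (rule fixed_pair) (use that p y1 yc in \<open>auto simp: H1_def\<close>)
    have "q \<noteq> p"
    proof
      assume "q = p"
      hence "y p = y 1" using y1 by (simp add: q_def)
      thus False using alt_eq_iff[OF y_alt] p(1) by auto
    qed
    have "q \<noteq> 1"
    proof
      assume "q = 1"
      hence "(c ^^ (e + e)) 1 = 1" using e by (simp add: q_def y_def funpow_add)
      hence 2: "c ^^ (e + e) = id" by (rule no_fix)
      \<comment> \<open>With \<open>n\<close> odd, \<open>c ^^ e\<close> is a power of its own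
        square: \<open>e (n + 1)\<close> is a multiple of \<open>2 e\<close> and agrees with
        \<open>e\<close> modulo \<open>n\<close>.\<close>
      obtain k where k: "n = 2 * k + 1" using n(2) by (rule oddE)
      have "e * (n + 1) = (e + e) * ((n + 1) div 2)" by (simp add: k algebra_simps)
      hence "c ^^ (e * (n + 1)) = (c ^^ (e + e)) ^^ ((n + 1) div 2)" by (simp only: funpow_mult)
      hence "c ^^ (e * (n + 1)) = id" by (simp only: 2 id_funpow)
      moreover have "c ^^ (e * (n + 1)) = c ^^ (n * e) \<circ> c ^^ e" by (simp only: funpow_add[symmetric]) (simp add: algebra_simps)
      moreover have "c ^^ (n * e) = id" by (simp only: funpow_mult[symmetric] c_pow id_funpow)
      ultimately have "c ^^ e = id" by (simp only: id_comp)
      hence "p = 1" using e by simp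
      thus False using p(1) by simp
    qed
    define I where "I = Sigma {2..n} (\<lambda>a. {2..n} - {a})"
    have "card I = (\<Sum>a\<in>{2..n}. card ({2..n} - {a}))" by (simp add: I_def)
    also have "\<dots> = (\<Sum>a\<in>{2..n}. n - 2)" by (intro sum.cong refl) (simp add: card_Diff_singleton)
    finally have cI: "card I = (n - 1) * (n - 2)" by simp
    have "\<exists>x. x \<in> alt n \<and> x 1 = 1 \<and> x p = a \<and> x q = b" if ab: "(a, b) \<in> I" for a b
    proof -
      define f where "f i = (if i = p then a else if i = q then b else i)" for i
      have "\<exists>g. g permutes {1..n} \<and> evenperm g \<and> (\<forall>k\<in>{1, p, q}. g k = f k)"
      proof (rule even_permutes_extend)
        show "inj_on f {1, p, q}" "f ` {1, p, q} \<subseteq> {1..n}"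
          using ab p(1) q_n \<open>q \<noteq> p\<close> \<open>q \<noteq> 1\<close> by (auto simp: f_def I_def inj_on_def)
        have "card {1, p, q} \<le> 3" by (simp add: card_insert_if)
        thus "card {1, p, q} + 2 \<le> card {1..n}" using n by simp
      qed (use p(1) q_n in auto)
      then obtain g where g: "g permutes {1..n}" "evenperm g" "\<forall>k\<in>{1, p, q}. g k = f k" by blast
      thus ?thesis using p(1) \<open>q \<noteq> p\<close> \<open>q \<noteq> 1\<close>
        by (intro exI[of _ g]) (auto simp: alt_group_carrier f_def)
    qed
    hence "\<exists>x. \<forall>ab\<in>I. x ab \<in> alt n \<and> x ab 1 = 1 \<and> x ab p = fst ab \<and> x ab q = snd ab"
      by (intro bchoice) auto
    then obtain x where x: "\<And>ab. ab \<in> I \<Longrightarrow> x ab \<in> alt n \<and> x ab 1 = 1 \<and> x ab p = fst ab \<and> x ab q = snd ab" by blast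
    have "card I * card H \<le> card (alt n)"
    proof (rule coset_packing_distinct)
      show "finite I" by (simp add: I_def)
      show "x i \<in> alt n" if "i \<in> I" for i using x[OF that] by blast
      fix i j assume ij: "i \<in> I" "j \<in> I" "inv' (x i) \<circ> x j \<in> H"
      have xi: "x i \<in> alt n" "x i 1 = 1" using x[OF ij(1)] by auto
      have "inv' (x i) 1 = 1" using alt.inv_comp_apply(1)[OF xi(1), of 1] xi(2) by simp
      hence "inv' (x i) \<circ> x j \<in> H1" using ij x[OF ij(2)] by (simp add: H1_def)
      hence "inv' (x i) (x j p) = p" "inv' (x i) (x j q) = q" using p(2) fix_q by fastforce+
      hence "x j p = x i p" "x j q = x i q" using alt.inv_comp_apply(2)[OF xi(1)] by metis+
      thus "i = j" using x[OF ij(1)] x[OF ij(2)] by (simp add: prod_eq_iff)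
    qed
    hence "(n * (n - 3) + 2) * card H \<le> card (alt n)" by (simp only: cI n_eq)
    thus False using big by (simp add: algebra_simps)
  qed
  define O2 where "O2 = (\<lambda>x. x 2) ` H1"
  have O2_sub: "O2 \<subseteq> {2..n}"
  proof
    fix i assume "i \<in> O2"
    then obtain x where x: "x \<in> H" "x 1 = 1" "i = x 2" by (auto simp: O2_def H1_def)
    have "x 2 \<noteq> x 1" using H_eq_iff[OF x(1)] by simp
    thus "i \<in> {2..n}" using H_apply[OF x(1), of 2] x n by auto
  qed
  have O2_inv: "x i \<in> O2 \<longleftrightarrow> i \<in> O2" if x: "x \<in> H1" for x i
  proof
    assume "i \<in> O2"
    then obtain y where "y \<in> H1" "i = y 2" by (auto simp: O2_def)
    thus "x i \<in> O2" using H1_comp[OF x, of y] unfolding O2_def by (auto intro!: image_eqI[of _ _ "x \<circ> y"])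
  next
    assume "x i \<in> O2"
    then obtain y where y: "y \<in> H1" "x i = y 2" by (auto simp: O2_def)
    have "inv' x (x i) = (inv' x \<circ> y) 2" using y by simp
    hence "i = (inv' x \<circ> y) 2" using alt.inv_comp_apply(1)[OF H_mem, of x i] x by (simp add: H1_def)
    thus "i \<in> O2" using H1_comp[OF H1_inv[OF x] y(1)] unfolding O2_def by blast
  qed
  have "id \<in> H1" using H_id by (simp add: H1_def)
  hence "2 \<in> O2" unfolding O2_def by (rule rev_image_eqI) simp
  have "O2 = {2..n}"
  proof (rule ccontr)
    assume ne: "O2 \<noteq> {2..n}"
    have finO: "finite O2" using O2_sub finite_subset by blast
    have cards: "card O2 + card ({2..n} - O2) = n - 1"
      using O2_sub finO card_mono[OF _ O2_sub] by (simp add: card_Diff_subset)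
    have "card O2 \<noteq> 0" "card ({2..n} - O2) \<noteq> 0" using \<open>2 \<in> O2\<close> finO ne O2_sub by auto
    moreover have "card O2 \<noteq> 1"
    proof
      assume "card O2 = 1"
      then obtain p where p: "O2 = {p}" by (rule card_1_singletonE)
      show False by (rule no_common_fixed_point[of p]) (use p O2_sub O2_inv in auto)
    qed
    moreover have "card ({2..n} - O2) \<noteq> 1"
    proof
      assume "card ({2..n} - O2) = 1"
      then obtain p where p: "{2..n} - O2 = {p}" by (rule card_1_singletonE)
      have "x p = p" if x: "x \<in> H1" for x
      proof -
        have pm: "p \<in> {2..n}" "p \<notin> O2" using p by auto
        have xH: "x \<in> H" "x 1 = 1" using x by (auto simp: H1_def)
        have "x p \<noteq> x 1" using H_eq_iff[OF xH(1)] pm by auto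
        hence "x p \<in> {2..n}" using H_apply[OF xH(1), of p] pm xH by auto
        thus ?thesis using O2_inv[OF x] p pm by blast
      qed
      thus False using no_common_fixed_point[of p] p by blast
    qed
    ultimately have r: "2 \<le> card O2" "card O2 + 2 \<le> n - 1" using cards by linarith+
    define I where "I = {P. P \<subseteq> {2..n} \<and> card P = card O2}"
    have cI: "card I = (n - 1) choose card O2" by (simp add: I_def n_subsets)
    have "\<exists>x. x \<in> alt n \<and> x 1 = 1 \<and> x ` O2 = P" if P: "P \<in> I" for P
    proof -
      have "\<exists>f. bij_betw f O2 P"
        using P finO by (intro finite_same_card_bij) (auto simp: I_def finite_subset)
      then obtain f where f: "bij_betw f O2 P" by blast
      have "\<exists>g. g permutes {2..n} \<and> evenperm g \<and> (\<forall>k\<in>O2. g k = f k)"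
        by (rule even_permutes_extend) (use f P O2_sub r in \<open>auto simp: bij_betw_def I_def\<close>)
      then obtain g where g: "g permutes {2..n}" "evenperm g" "\<forall>k\<in>O2. g k = f k" by blast
      have "g ` O2 = P" using g(3) f by (auto simp: bij_betw_def)
      moreover have "g 1 = 1" using permutes_not_in[OF g(1)] by simp
      moreover have "g \<in> alt n" using g(1,2) by (rule permutes_even_in_alt) auto
      ultimately show ?thesis by blast
    qed
    hence "\<exists>x. \<forall>P\<in>I. x P \<in> alt n \<and> x P 1 = 1 \<and> x P ` O2 = P" by (intro bchoice) blast
    then obtain x where xI: "\<forall>P\<in>I. x P \<in> alt n \<and> x P 1 = 1 \<and> x P ` O2 = P" by (rule exE)
    note x = xI[rule_format]
    have "card I * card H \<le> card (alt n)"
    proof (rule coset_packing_distinct)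
      show "finite I" by (simp add: I_def)
      show "x i \<in> alt n" if "i \<in> I" for i using x[OF that] by blast
      fix P Q assume PQ: "P \<in> I" "Q \<in> I" "inv' (x P) \<circ> x Q \<in> H"
      have xP: "x P \<in> alt n" "x P 1 = 1" "x P ` O2 = P" using x[OF PQ(1)] by auto
      have xQ: "x Q 1 = 1" "x Q ` O2 = Q" using x[OF PQ(2)] by auto
      have "inv' (x P) 1 = 1" using alt.inv_comp_apply(1)[OF xP(1), of 1] xP(2) by simp
      hence m: "inv' (x P) \<circ> x Q \<in> H1" using PQ xQ by (simp add: H1_def)
      have "Q \<subseteq> P"
      proof
        fix j assume "j \<in> Q"
        then obtain i where i: "i \<in> O2" "j = x Q i" using xQ by blast
        have "inv' (x P) j \<in> O2" using O2_inv[OF m, of i] i by simp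
        thus "j \<in> P" using xP(3) alt.inv_comp_apply(2)[OF xP(1), of j] by (metis imageI)
      qed
      thus "P = Q" using PQ finO by (intro card_subset_eq[symmetric]) (auto simp: I_def finite_subset)
    qed
    hence "((n - 1) choose card O2) * card H \<le> card (alt n)" by (simp only: cI)
    moreover have "(n - 1) choose 2 \<le> (n - 1) choose card O2" by (rule choose_two_le[OF r])
    ultimately have "((n - 1) choose 2) * card H \<le> card (alt n)"
      using mult_le_mono1 order_trans by blast
    hence le: "2 * ((n - 1) choose 2) * card H \<le> 2 * card (alt n)" by simp
    have "2 * ((n - 1) choose 2) = (n - 1) * (n - 2)"
      using n by (simp add: choose_two)
    hence "2 * ((n - 1) choose 2) = n * (n - 3) + 2" using n_eq by (rule trans)
    hence "(n * (n - 3) + 2) * card H \<le> 2 * card (alt n)" using le by (simp only:)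
    thus False using big by (simp add: algebra_simps)
  qed
  have from1: "\<exists>x\<in>H. x 1 = a \<and> x 2 = b" if ab: "a \<in> {1..n}" "b \<in> {1..n}" "a \<noteq> b" for a b
  proof -
    obtain k where k: "(c ^^ k) 1 = a" using c(1) ab(1) unfolding full_cycle_def by blast
    have ck: "c ^^ k \<in> alt n" by (rule H_mem[OF pow])
    define b' where "b' = inv' (c ^^ k) b"
    have b': "(c ^^ k) b' = b" "b' \<in> {1..n}"
      using alt.inv_comp_apply(2)[OF ck] alt_apply_mem[OF alt.inv_G[OF ck] ab(2)] by (auto simp: b'_def)
    hence "b' \<noteq> 1" using k ab(3) by auto
    hence "b' \<in> O2" using \<open>O2 = {2..n}\<close> b'(2) by auto
    then obtain x where x: "x \<in> H" "x 1 = 1" "x 2 = b'" by (auto simp: O2_def H1_def)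
    show ?thesis by (rule bexI[of _ "c ^^ k \<circ> x"]) (use x k b' H_comp[OF pow x(1)] in auto)
  qed
  show two_transitive
    unfolding two_transitive_def
  proof (intro allI impI)
    fix a b a' b' assume ab: "{a, b, a', b'} \<subseteq> {1..n}" "a \<noteq> b" "a' \<noteq> b'"
    obtain x where x: "x \<in> H" "x 1 = a" "x 2 = b" using from1[of a b] ab by auto
    obtain y where y: "y \<in> H" "y 1 = a'" "y 2 = b'" using from1[of a' b'] ab by auto
    show "\<exists>x\<in>H. x a = a' \<and> x b = b'"
    proof (rule bexI[of _ "y \<circ> inv' x"])
      show "y \<circ> inv' x \<in> H" by (intro H_comp H_inv x y)
      show "(y \<circ> inv' x) a = a' \<and> (y \<circ> inv' x) b = b'"
        using x y alt.inv_comp_apply(1)[OF H_mem[OF x(1)]] by (auto simp: x(2,3)[symmetric])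
    qed
  qed
qed

end

text \<open>Quotients of 3-cycles sharing their first two points are again 3-cycles, so a whole
  family of them falls into distinct cosets of a subgroup without 3-cycles.\<close>

lemma cyc3_quotient: "distinct [u, v, i, j] \<Longrightarrow> cyc3 u v i \<circ> cyc3 v j i = cyc3 u v j"
  by (auto simp: cyc3_def fun_eq_iff transpose_def)

lemma even_permutes_onto:
  assumes "finite J" "A \<subseteq> J" "P \<subseteq> J" "card P = card A" "card A + 2 \<le> card J"
  shows "\<exists>g. g permutes J \<and> evenperm g \<and> g ` A = P"
proof -
  have fin: "finite A" "finite P" using assms finite_subset by blast+
  obtain f where f: "bij_betw f A P" using finite_same_card_bij[OF fin] assms(4) by metis
  have "\<exists>g. g permutes J \<and> evenperm g \<and> (\<forall>k\<in>A. g k = f k)"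
    using assms f by (intro even_permutes_extend) (auto simp: bij_betw_def)
  then obtain g where g: "g permutes J" "evenperm g" "\<forall>k\<in>A. g k = f k" by blast
  have "g ` A = f ` A" using g(3) by (intro image_cong) auto
  thus ?thesis using g f by (auto simp: bij_betw_def)
qed

context alt_subgroup
begin

text \<open>If the stabilizer of 1 and 2 were to preserve a proper subset of the remaining points, then the
  cosets of \<open>H\<close> separate the images of that subset, and also the members of a family of even
  permutations whose quotients are 3-cycles.\<close>

lemma three_transitive_of_card:
  assumes two: two_transitive and no3: "\<not> has_cyc3" and n: "n \<ge> 7" "odd n"
    and big: "2 * card (alt n) < n * (n - 3) * card H"
  shows three_transitive
proof -
  define N where "N = {3..n}"
  have N: "finite N" "N \<subseteq> {1..n}" "card N = n - 2" "1 \<notin> N" "2 \<notin> N" by (auto simp: N_def)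
  have mem_N: "i \<in> N" if "i \<in> {1..n}" "i \<noteq> 1" "i \<noteq> 2" for i using that by (auto simp: N_def)
  define K where "K = {x \<in> H. x 1 = 1 \<and> x 2 = 2}"
  have K_comp: "x \<circ> y \<in> K" if "x \<in> K" "y \<in> K" for x y
    using that H_comp by (auto simp: K_def)
  have K_H: "x \<in> H" if "x \<in> K" for x using that by (simp add: K_def)
  have K_inv: "inv' x \<in> K" if x: "x \<in> K" for x
  proof -
    have "inv' x (x 1) = 1" "inv' x (x 2) = 2" using alt.inv_comp_apply(1)[OF H_mem[OF K_H[OF x]]] by auto
    thus ?thesis using x H_inv by (simp add: K_def)
  qed
  have K_N: "x i \<in> N" if x: "x \<in> K" "i \<in> N" for x i
  proof (rule mem_N)
    have xH: "x \<in> H" "x 1 = 1" "x 2 = 2" using x by (auto simp: K_def)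
    show "x i \<in> {1..n}" using H_apply[OF xH(1)] N x(2) by blast
    have "x i \<noteq> x 1" "x i \<noteq> x 2" using H_eq_iff[OF xH(1)] x(2) N by auto
    thus "x i \<noteq> 1" "x i \<noteq> 2" using xH by auto
  qed
  have quotient_K: "inv' x \<circ> y \<in> K" if "x \<in> alt n" "x 1 = 1" "x 2 = 2" "y 1 = 1" "y 2 = 2" "inv' x \<circ> y \<in> H" for x y
  proof -
    have "inv' x (x 1) = 1" "inv' x (x 2) = 2" using alt.inv_comp_apply(1)[OF that(1)] by auto
    thus ?thesis using that by (simp add: K_def)
  qed
  have fix12: "g \<in> alt n \<and> g 1 = 1 \<and> g 2 = 2" if "g permutes N" "evenperm g" for g
    using permutes_even_in_alt[OF that N(2)] permutes_not_in[OF that(1)] N by auto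
  \<comment> \<open>Assuming that \<open>A\<close> has at most half of the points is no loss,
    because the complement of an invariant set is invariant.\<close>
  have no_set: False if A: "A \<subseteq> N" "A \<noteq> {}" "2 * card A \<le> n - 2" and inv: "\<And>x i. x \<in> K \<Longrightarrow> i \<in> A \<Longrightarrow> x i \<in> A" for A
  proof -
    have finA: "finite A" using A(1) N(1) finite_subset by blast
    define I where "I = {P. P \<subseteq> N \<and> card P = card A}"
    have finI: "finite I" using N(1) by (simp add: I_def)
    have cI: "card I = (n - 2) choose card A" using N by (simp add: I_def n_subsets)
    have cA: "card A \<ge> 1" using A(2) finA by (simp add: Suc_leI card_gt_0_iff)
    have cA2: "card A + 2 \<le> n - 2" using A(3) n by linarith
    have "\<exists>g. g permutes N \<and> evenperm g \<and> g ` A = P" if "P \<in> I" for P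
      by (rule even_permutes_onto) (use that A N cA2 in \<open>auto simp: I_def\<close>)
    hence "\<exists>g. \<forall>P\<in>I. g P permutes N \<and> evenperm (g P) \<and> g P ` A = P" by (intro bchoice) blast
    then obtain g where gI: "\<forall>P\<in>I. g P permutes N \<and> evenperm (g P) \<and> g P ` A = P" by (rule exE)
    note g = gI[rule_format]
    have cND: "card (N - A) = n - 2 - card A" using A N finA by (simp add: card_Diff_subset)
    \<comment> \<open>If two elements \<open>g P \<circ> \<kappa> l\<close> share a coset,
      invariance of \<open>A\<close> first forces equal images \<open>P\<close>; then
      \<open>g P\<close> cancels and the quotient of the \<open>\<kappa>\<close>s lies in
      \<open>H\<close>.\<close>
    have clique: "card I * card L * card H \<le> card (alt n)"
      if L: "finite L" "\<And>l. l \<in> L \<Longrightarrow> \<kappa> l permutes (N - A)" "\<And>l. l \<in> L \<Longrightarrow> evenperm (\<kappa> l)"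
        "\<And>l m. l \<in> L \<Longrightarrow> m \<in> L \<Longrightarrow> inv' (\<kappa> l) \<circ> \<kappa> m \<in> H \<Longrightarrow> l = m" for L :: "nat set" and \<kappa> :: "nat \<Rightarrow> nat \<Rightarrow> nat"
    proof -
      define x where "x p = g (fst p) \<circ> \<kappa> (snd p)" for p
      have \<kappa>: "\<kappa> l \<in> alt n" "\<kappa> l 1 = 1" "\<kappa> l 2 = 2" "\<And>i. i \<in> A \<Longrightarrow> \<kappa> l i = i" if "l \<in> L" for l
      proof -
        have "\<kappa> l permutes N" using L(2)[OF that] by (rule permutes_subset) auto
        thus "\<kappa> l \<in> alt n" "\<kappa> l 1 = 1" "\<kappa> l 2 = 2" using fix12 L(3)[OF that] by blast+
        show "\<kappa> l i = i" if "i \<in> A" for i using permutes_not_in[OF L(2)[OF \<open>l \<in> L\<close>]] that by blast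
      qed
      have x: "x p \<in> alt n" "x p 1 = 1" "x p 2 = 2" "x p ` A = fst p" if p: "p \<in> I \<times> L" for p
      proof -
        have P: "fst p \<in> I" "snd p \<in> L" using p by auto
        have gp: "g (fst p) \<in> alt n" "g (fst p) 1 = 1" "g (fst p) 2 = 2" using fix12 g[OF P(1)] by blast+
        show "x p \<in> alt n" unfolding x_def by (rule alt.comp_G[OF gp(1) \<kappa>(1)[OF P(2)]])
        show "x p 1 = 1" "x p 2 = 2" using gp \<kappa>(2,3)[OF P(2)] by (auto simp: x_def)
        have "x p ` A = g (fst p) ` A" using \<kappa>(4)[OF P(2)] by (intro image_cong) (auto simp: x_def)
        thus "x p ` A = fst p" using g[OF P(1)] by simp
      qed
      have "card (I \<times> L) * card H \<le> card (alt n)"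
      proof (rule coset_packing_distinct[where x = x])
        show "finite (I \<times> L)" using finI L(1) by simp
        show "x p \<in> alt n" if "p \<in> I \<times> L" for p by (rule x(1)[OF that])
        fix p q assume p: "p \<in> I \<times> L" and q: "q \<in> I \<times> L" and m: "inv' (x p) \<circ> x q \<in> H"
        have mK: "inv' (x p) \<circ> x q \<in> K"
          by (rule quotient_K[OF x(1,2,3)[OF p] x(2,3)[OF q] m])
        have "fst q \<subseteq> fst p"
        proof
          fix j assume "j \<in> fst q"
          hence "j \<in> x q ` A" using x(4)[OF q] by simp
          then obtain i where i: "i \<in> A" "j = x q i" by blast
          have "inv' (x p) j \<in> A" using inv[OF mK i(1)] i(2) by simp
          hence "x p (inv' (x p) j) \<in> x p ` A" by (rule imageI)
          thus "j \<in> fst p" using x(4)[OF p] alt.inv_comp_apply(2)[OF x(1)[OF p], of j] by simp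
        qed
        moreover have "finite (fst p)" "card (fst q) = card (fst p)"
          using p q N(1) finite_subset by (auto simp: I_def)
        ultimately have eq: "fst q = fst p" using card_subset_eq by blast
        have gp: "g (fst p) \<in> alt n" using fix12 g p by auto
        have \<kappa>p: "\<kappa> (snd p) \<in> alt n" using \<kappa> p by auto
        have "inv' (x p) \<circ> x q = inv' (\<kappa> (snd p)) \<circ> (inv' (g (fst p)) \<circ> (g (fst p) \<circ> \<kappa> (snd q)))"
          unfolding x_def eq by (simp only: alt.inv_of_comp[OF gp \<kappa>p] comp_assoc)
        also have "\<dots> = inv' (\<kappa> (snd p)) \<circ> \<kappa> (snd q)" by (simp only: alt.inv_comp_cancel(1)[OF gp])
        finally have "snd p = snd q" using L(4)[of "snd p" "snd q"] m p q by auto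
        thus "p = q" using eq by (simp add: prod_eq_iff)
      qed
      thus ?thesis by (simp add: card_cartesian_product)
    qed
    show False
    proof (cases "card A = 1")
      case True
      have "card (N - A) \<ge> 2" using cND True n by linarith
      then obtain D where D: "D \<subseteq> N - A" "card D = 2" by (meson obtain_subset_with_card_n)
      then obtain u v where uv: "u \<in> N - A" "v \<in> N - A" "u \<noteq> v" by (auto simp: card_2_iff)
      define L where "L = N - A - {v}"
      \<comment> \<open>The index \<open>u\<close> stands for the identity, so the family has
        \<open>n - 4\<close> members. Together with the \<open>n - 2\<close> images of a single
        point this exceeds the index from \<open>n = 7\<close> on: \<open>2 (n - 2) (n - 4)\<close>
        is 30 there and \<open>n (n - 3)\<close> is 28.\<close>
      define \<kappa> where "\<kappa> i = (if i = u then id else cyc3 u v i)" for i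
      have cL: "card L = n - 4" using cND True uv N by (simp add: L_def card_Diff_singleton)
      have sub: "{u, v, i} \<subseteq> N - A" "i \<noteq> v" if "i \<in> L" for i using that uv by (auto simp: L_def)
      have "card I * card L * card H \<le> card (alt n)"
      proof (rule clique[where \<kappa> = \<kappa>])
        show "finite L" using N by (simp add: L_def)
        show "\<kappa> l permutes (N - A)" if "l \<in> L" for l
          using sub[OF that] unfolding \<kappa>_def cyc3_def
          by (auto intro!: permutes_compose permutes_swap_id permutes_id)
        show "evenperm (\<kappa> l)" if "l \<in> L" for l
          using sub[OF that] uv unfolding \<kappa>_def cyc3_def
          by (auto simp: evenperm_comp evenperm_swap permutation_swap_id)
        fix l m assume l: "l \<in> L" and m: "m \<in> L" and lm: "inv' (\<kappa> l) \<circ> \<kappa> m \<in> H"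
        have sN: "{u, v, l, m} \<subseteq> {1..n}" using sub[OF l] sub[OF m] N by blast
        have three: "has_cyc3" if "cyc3 a b c \<in> H" "{a, b, c} \<subseteq> {u, v, l, m}" "distinct [a, b, c]" for a b c
          using has_cyc3I[of a b c] that sN by (meson subset_trans)
        have inv_cyc: "inv' (cyc3 a b c) = cyc3 c b a" for a b c :: nat
          by (rule inv_unique_comp[OF cyc3_inverse cyc3_inverse])
        show "l = m"
        proof (rule ccontr)
          assume ne: "l \<noteq> m"
          consider "l = u" | "m = u" "l \<noteq> u" | "l \<noteq> u" "m \<noteq> u" by blast
          thus False
          proof cases
            case 1
            hence "cyc3 u v m \<in> H" using lm ne by (simp add: \<kappa>_def)
            thus False using three[of u v m] no3 ne 1 sub[OF m] uv by auto
          next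
            case 2
            hence "cyc3 l v u \<in> H" using lm by (simp add: \<kappa>_def inv_cyc)
            thus False using three[of l v u] no3 2 sub[OF l] uv by auto
          next
            case 3
            have d: "distinct [u, v, l, m]" using 3 ne sub[OF l] sub[OF m] uv by auto
            have ua: "cyc3 u v l \<in> alt n" by (rule cyc3_in_alt) (use d sN in auto)
            have "inv' (cyc3 u v l) \<circ> cyc3 u v m = inv' (cyc3 u v l) \<circ> (cyc3 u v l \<circ> cyc3 v m l)"
              by (simp only: cyc3_quotient[OF d])
            also have "\<dots> = cyc3 v m l" by (rule alt.inv_comp_cancel(1)[OF ua])
            finally have "cyc3 v m l \<in> H" using lm 3 by (simp add: \<kappa>_def)
            thus False using three[of v m l] no3 d by auto
          qed
        qed
      qed
      hence "(n - 2) * (n - 4) * card H \<le> card (alt n)" using cI cL True by simp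
      hence "2 * ((n - 2) * (n - 4)) * card H \<le> 2 * card (alt n)" by simp
      also have "\<dots> < n * (n - 3) * card H" by (rule big)
      finally have "2 * ((n - 2) * (n - 4)) < n * (n - 3)" by simp
      moreover obtain k where "n = k + 7" using n(1) le_Suc_ex by (metis add.commute)
      ultimately show False by (simp add: algebra_simps)
    next
      case False
      hence r: "2 \<le> card A" using cA by simp
      have "card (N - A) \<ge> 3" using cND A(3) n by linarith
      then obtain D where D: "D \<subseteq> N - A" "card D = 3" by (meson obtain_subset_with_card_n)
      then obtain u v w where uvw: "{u, v, w} \<subseteq> N - A" "distinct [u, v, w]" by (auto simp: card_3_iff)
      \<comment> \<open>For larger \<open>A\<close> the identity and one 3-cycle are enough: they
        double \<open>(n - 2) choose 2\<close> to \<open>(n - 2) (n - 3)\<close>.\<close>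
      define \<kappa> where "\<kappa> i = (if i = 0 then id else cyc3 u v w)" for i :: nat
      have uN: "{u, v, w} \<subseteq> {1..n}" using uvw N by blast
      have "card I * card {0, 1 :: nat} * card H \<le> card (alt n)"
      proof (rule clique[where \<kappa> = \<kappa>])
        show "\<kappa> l permutes (N - A)" if "l \<in> {0, 1}" for l
          using uvw(1) unfolding \<kappa>_def cyc3_def
          by (auto intro!: permutes_compose permutes_swap_id permutes_id)
        show "evenperm (\<kappa> l)" if "l \<in> {0, 1}" for l
          using uvw(2) unfolding \<kappa>_def cyc3_def
          by (auto simp: evenperm_comp evenperm_swap permutation_swap_id)
        have inv_cyc: "inv' (cyc3 u v w) = cyc3 w v u"
          by (rule inv_unique_comp[OF cyc3_inverse cyc3_inverse])
        fix l m :: nat assume l: "l \<in> {0, 1}" and m: "m \<in> {0, 1}" and lm: "inv' (\<kappa> l) \<circ> \<kappa> m \<in> H"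
        show "l = m"
        proof (rule ccontr)
          assume "l \<noteq> m"
          hence "cyc3 u v w \<in> H \<or> cyc3 w v u \<in> H" using l m lm inv_cyc by (auto simp: \<kappa>_def)
          hence "cyc3 u v w \<in> H" using cyc3_inverse_mem by blast
          thus False using has_cyc3I[OF uN uvw(2)] no3 by blast
        qed
      qed simp
      moreover have "card {0, 1 :: nat} = 2" by simp
      ultimately have 1: "((n - 2) choose card A) * 2 * card H \<le> card (alt n)" by (simp only: cI)
      have "(n - 2) choose 2 \<le> (n - 2) choose card A" by (rule choose_two_le[OF r cA2])
      hence "((n - 2) choose 2) * 2 * card H \<le> ((n - 2) choose card A) * 2 * card H" by simp
      hence 2: "((n - 2) choose 2) * 2 * card H \<le> card (alt n)" using 1 by linarith
      have "((n - 2) choose 2) * 2 = (n - 2) * (n - 3)"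
      proof -
        have "even ((n - 2) * (n - 2 - 1))" using n by simp
        moreover have "n - 2 - 1 = n - 3" using n by simp
        ultimately show ?thesis unfolding choose_two by simp
      qed
      hence "2 * ((n - 2) * (n - 3)) * card H \<le> 2 * card (alt n)" using 2 by simp
      also have "\<dots> < n * (n - 3) * card H" by (rule big)
      finally have "2 * ((n - 2) * (n - 3)) < n * (n - 3)" by simp
      moreover obtain k where "n = k + 7" using n(1) le_Suc_ex by (metis add.commute)
      ultimately show False by (simp add: algebra_simps)
    qed
  qed
  define O3 where "O3 = (\<lambda>x. x 3) ` K"
  have three_N: "3 \<in> N" using n by (simp add: N_def)
  have O3_sub: "O3 \<subseteq> N" using K_N three_N by (auto simp: O3_def)
  have O3_inv: "x i \<in> O3" if x: "x \<in> K" and i: "i \<in> O3" for x i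
  proof -
    obtain y where y: "y \<in> K" "i = y 3" using i by (auto simp: O3_def)
    have "x i = (x \<circ> y) 3" using y by simp
    thus ?thesis using K_comp[OF x y(1)] unfolding O3_def by (rule image_eqI)
  qed
  have "id \<in> K" using H_id by (simp add: K_def)
  hence three_O3: "3 \<in> O3" unfolding O3_def by (rule rev_image_eqI) simp
  have "O3 = N"
  proof (rule ccontr)
    assume ne: "O3 \<noteq> N"
    have finO: "finite O3" using O3_sub N(1) finite_subset by blast
    have sum: "card O3 + card (N - O3) = n - 2"
      using O3_sub N finO card_mono[OF N(1) O3_sub] by (simp add: card_Diff_subset)
    have compl: "x i \<in> N - O3" if x: "x \<in> K" and i: "i \<in> N - O3" for x i
    proof -
      have "x i \<notin> O3"
      proof
        assume "x i \<in> O3"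
        hence "inv' x (x i) \<in> O3" by (rule O3_inv[OF K_inv[OF x]])
        thus False using i alt.inv_comp_apply(1)[OF H_mem[OF K_H[OF x]], of i] by simp
      qed
      thus ?thesis using K_N[OF x] i by blast
    qed
    show False
    proof (cases "2 * card O3 \<le> n - 2")
      case True
      have "O3 \<noteq> {}" using three_O3 by blast
      thus False using no_set[of O3] O3_sub True O3_inv by blast
    next
      case False
      hence "2 * card (N - O3) \<le> n - 2" using sum by linarith
      thus False using no_set[of "N - O3"] compl ne O3_sub by blast
    qed
  qed
  have from3: "\<exists>h\<in>K. h i = j" if i: "i \<in> N" and j: "j \<in> N" for i j
  proof -
    obtain x where x: "x \<in> K" "x 3 = i" using i \<open>O3 = N\<close> by (auto simp: O3_def)
    obtain y where y: "y \<in> K" "y 3 = j" using j \<open>O3 = N\<close> by (auto simp: O3_def)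
    have "inv' x (x 3) = 3" by (rule alt.inv_comp_apply(1)[OF H_mem[OF K_H[OF x(1)]]])
    hence "(y \<circ> inv' x) i = j" using x y by simp
    thus ?thesis using K_comp[OF y(1) K_inv[OF x(1)]] by blast
  qed
  have base: "\<exists>x\<in>H. x 1 = a \<and> x 2 = b" if "{a, b} \<subseteq> {1..n}" "a \<noteq> b" for a b
  proof -
    have "{1, 2, a, b} \<subseteq> {1..n}" using that n by auto
    thus ?thesis using two that(2) unfolding two_transitive_def by (metis one_eq_numeral_iff semiring_norm(85))
  qed
  show three_transitive
    unfolding three_transitive_def
  proof (intro allI impI)
    fix a b c a' b' c' assume s: "{a, b, c, a', b', c'} \<subseteq> {1..n}" "distinct [a, b, c]" "distinct [a', b', c']"
    obtain x where x: "x \<in> H" "x 1 = a" "x 2 = b" using base[of a b] s by auto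
    obtain y where y: "y \<in> H" "y 1 = a'" "y 2 = b'" using base[of a' b'] s by auto
    have inv: "inv' x (x i) = i" "inv' y (y i) = i" "x (inv' x i) = i" "y (inv' y i) = i" for i
      using alt.inv_comp_apply H_mem x y by blast+
    have 1: "inv' x c \<in> N"
    proof (rule mem_N)
      show "inv' x c \<in> {1..n}" using H_apply[OF H_inv[OF x(1)]] s by auto
      show "inv' x c \<noteq> 1" "inv' x c \<noteq> 2" using inv(3)[of c] x s by auto
    qed
    have 2: "inv' y c' \<in> N"
    proof (rule mem_N)
      show "inv' y c' \<in> {1..n}" using H_apply[OF H_inv[OF y(1)]] s by auto
      show "inv' y c' \<noteq> 1" "inv' y c' \<noteq> 2" using inv(4)[of c'] y s by auto
    qed
    obtain h where h: "h \<in> K" "h (inv' x c) = inv' y c'" using from3[OF 1 2] by blast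
    have hh: "h \<in> H" "h 1 = 1" "h 2 = 2" using h by (auto simp: K_def)
    show "\<exists>x\<in>H. x a = a' \<and> x b = b' \<and> x c = c'"
    proof (rule bexI[of _ "y \<circ> (h \<circ> inv' x)"])
      show "y \<circ> (h \<circ> inv' x) \<in> H" by (intro H_comp H_inv x y hh)
      have "inv' x a = 1" "inv' x b = 2" using inv(1)[of 1] inv(1)[of 2] x by auto
      thus "(y \<circ> (h \<circ> inv' x)) a = a' \<and> (y \<circ> (h \<circ> inv' x)) b = b' \<and> (y \<circ> (h \<circ> inv' x)) c = c'"
        using hh h y inv(4)[of c'] by simp
    qed
  qed
qed

lemma transposition_pair_conj_mem:
  assumes x: "x \<in> H" and m: "transpose p q \<circ> transpose r s \<in> H"
  shows "transpose (x p) (x q) \<circ> transpose (x r) (x s) \<in> H"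
proof -
  have inj: "inj x" using alt.bij_G[OF H_mem[OF x]] by (rule bij_is_inj)
  have "x \<circ> (transpose p q \<circ> transpose r s) \<circ> inv' x = (x \<circ> transpose p q) \<circ> transpose r s \<circ> inv' x"
    by (simp only: comp_assoc)
  also have "\<dots> = transpose (x p) (x q) \<circ> (x \<circ> transpose r s) \<circ> inv' x"
    by (simp only: transpose_conj[OF inj] comp_assoc)
  also have "\<dots> = transpose (x p) (x q) \<circ> transpose (x r) (x s) \<circ> (x \<circ> inv' x)"
    by (simp only: transpose_conj[OF inj] comp_assoc)
  also have "\<dots> = transpose (x p) (x q) \<circ> transpose (x r) (x s)"
    by (simp only: alt.inv_comp(2)[OF H_mem[OF x]] comp_id)
  finally have "transpose (x p) (x q) \<circ> transpose (x r) (x s) =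
      x \<circ> (transpose p q \<circ> transpose r s) \<circ> inv' x" by (rule sym)
  moreover have "x \<circ> (transpose p q \<circ> transpose r s) \<circ> inv' x \<in> H"
    by (intro H_comp[OF H_comp] x m H_inv)
  ultimately show ?thesis by (simp only:)
qed

lemma transposition_pair_inverse_mem:
  assumes m: "transpose p q \<circ> transpose r s \<in> H"
  shows "transpose r s \<circ> transpose p q \<in> H"
proof -
  have "(transpose p q \<circ> transpose r s) \<circ> (transpose r s \<circ> transpose p q) =
      transpose p q \<circ> (transpose r s \<circ> transpose r s) \<circ> transpose p q" by (simp only: comp_assoc)
  hence "(transpose p q \<circ> transpose r s) \<circ> (transpose r s \<circ> transpose p q) = id"
    by (simp only: transpose_comp_involutory comp_id)
  hence "inv' (transpose p q \<circ> transpose r s) \<circ> ((transpose p q \<circ> transpose r s) \<circ> (transpose r s \<circ> transpose p q))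
      = inv' (transpose p q \<circ> transpose r s)" by (simp only: comp_id)
  hence "inv' (transpose p q \<circ> transpose r s) = transpose r s \<circ> transpose p q"
    by (simp only: alt.inv_comp_cancel(1)[OF H_mem[OF m]])
  thus ?thesis using H_inv[OF m] by (simp only:)
qed

text \<open>Conjugating a double transposition so that the supports meet in a single point and taking a
  commutator gives a 3-cycle.\<close>

lemma has_cyc3_of_three_transitive:
  assumes three: three_transitive and n: "n \<ge> 9"
    and abcd: "{a, b, c, d} \<subseteq> {1..n}" "distinct [a, b, c, d]"
    and h: "transpose a b \<circ> transpose c d \<in> H"
  shows has_cyc3
proof -
  have "card {a, b, c, d} + 2 \<le> card {1..n}" using card_length[of "[a, b, c, d]"] n by simp
  then obtain u where u: "u \<in> {1..n} - {a, b, c, d}"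
    using exists_two_outside[of "{1..n}" "{a, b, c, d}"] by (metis finite.emptyI finite_insert finite_atLeastAtMost)
  \<comment> \<open>Conjugation by \<open>x\<close> in \<open>E\<close> turns
    \<open>(a b)(c d)\<close> into \<open>(a u)(w z)\<close> with \<open>w = x c\<close> and
    \<open>z = x d\<close>; it remains to keep \<open>w\<close> and \<open>z\<close> off the old
    support.\<close>
  define E where "E = {x \<in> H. x a = a \<and> x b = u}"
  define V where "V = {1..n} - {a, u}"
  have ab: "a \<in> {1..n}" "b \<in> {1..n}" "c \<in> {1..n}" "d \<in> {1..n}" "u \<in> {1..n}" using abcd u by auto
  have ne: "u \<noteq> a" "u \<noteq> b" "u \<noteq> c" "u \<noteq> d" using u by auto
  have move3: "\<exists>k\<in>H. k a = a \<and> k p = q \<and> k r = s"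
    if "{p, q, r, s} \<subseteq> {1..n} - {a}" "p \<noteq> r" "q \<noteq> s" for p q r s
    by (rule three[unfolded three_transitive_def, rule_format]) (use that ab in auto)
  have "\<exists>k\<in>H. k a = a \<and> k b = u \<and> k c = c" by (rule move3) (use ab ne abcd in auto)
  hence "E \<noteq> {}" by (auto simp: E_def)
  moreover have finE: "finite E" using finite_H by (simp add: E_def)
  ultimately have cE: "card E > 0" by (simp add: card_gt_0_iff)
  have cV: "card V = n - 2" using ab ne by (simp add: V_def card_Diff_subset)
  have equi: "card E = (n - 2) * card {x \<in> E. x p = v}" if p: "p \<in> {c, d}" and v: "v \<in> {b, c, d}" for p v
    unfolding cV[symmetric]
  proof (rule equidistribution)
    show "E \<subseteq> H" "finite V" by (auto simp: E_def V_def)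
    show "x p \<in> V" if "x \<in> E" for x
    proof -
      have x: "x \<in> H" "x a = a" "x b = u" using that by (auto simp: E_def)
      have "x p \<noteq> x a" "x p \<noteq> x b" using H_eq_iff[OF x(1)] p abcd(2) by auto
      moreover have "x p \<in> {1..n}" by (rule H_apply[OF x(1)]) (use p ab in auto)
      ultimately show ?thesis using x by (auto simp: V_def)
    qed
    show "\<exists>k\<in>H. (\<forall>x\<in>E. k \<circ> x \<in> E) \<and> k w = w'" if w: "w \<in> V" "w' \<in> V" for w w'
    proof -
      have "\<exists>k\<in>H. k a = a \<and> k u = u \<and> k w = w'" by (rule move3) (use w ab ne in \<open>auto simp: V_def\<close>)
      then obtain k where k: "k \<in> H" "k a = a" "k u = u" "k w = w'" by blast
      have "k \<circ> x \<in> E" if "x \<in> E" for x using that k H_comp[OF k(1)] by (auto simp: E_def)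
      thus ?thesis using k by blast
    qed
    show "v \<in> V" using v ab ne abcd(2) by (auto simp: V_def)
  qed
  \<comment> \<open>Each of the six events that \<open>x\<close> sends \<open>c\<close> or
    \<open>d\<close> to one of \<open>b\<close>, \<open>c\<close>, \<open>d\<close> holds for a
    fraction \<open>1 / (n - 2)\<close> of \<open>E\<close>. As \<open>n - 2 > 6\<close>, some
    \<open>x\<close> avoids them all.\<close>
  have "\<exists>x\<in>E. x c \<notin> {b, c, d} \<and> x d \<notin> {b, c, d}"
  proof (rule ccontr)
    assume "\<not> ?thesis"
    hence "E \<subseteq> (\<Union>(p, v)\<in>{c, d} \<times> {b, c, d}. {x \<in> E. x p = v})" by blast
    hence "card E \<le> card (\<Union>(p, v)\<in>{c, d} \<times> {b, c, d}. {x \<in> E. x p = v})"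
      using finE by (intro card_mono) auto
    also have "\<dots> \<le> (\<Sum>(p, v)\<in>{c, d} \<times> {b, c, d}. card {x \<in> E. x p = v})"
      using card_UN_le[of "{c, d} \<times> {b, c, d}" "\<lambda>(p, v). {x \<in> E. x p = v}"] by (simp add: case_prod_unfold)
    finally have "(n - 2) * card E \<le> (n - 2) * (\<Sum>(p, v)\<in>{c, d} \<times> {b, c, d}. card {x \<in> E. x p = v})"
      by (rule mult_le_mono2)
    also have "\<dots> = (\<Sum>(p, v)\<in>{c, d} \<times> {b, c, d}. (n - 2) * card {x \<in> E. x p = v})"
      by (simp add: sum_distrib_left case_prod_unfold)
    also have "\<dots> = (\<Sum>(p, v)\<in>{c, d} \<times> {b, c, d}. card E)"
      by (intro sum.cong refl) (simp only: case_prod_unfold, rule equi[symmetric], auto)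
    also have "\<dots> = 6 * card E" using abcd(2) by (simp add: case_prod_unfold card_cartesian_product)
    finally have "n - 2 \<le> 6" using cE by simp
    thus False using n by simp
  qed
  then obtain x where x: "x \<in> H" "x a = a" "x b = u" and good: "x c \<notin> {b, c, d}" "x d \<notin> {b, c, d}"
    by (auto simp: E_def)
  define w z where "w = x c" and "z = x d"
  have "w \<noteq> x a" "z \<noteq> x a" using H_eq_iff[OF x(1)] abcd(2) by (auto simp: w_def z_def)
  hence wz: "w \<notin> {a, b, c, d}" "z \<notin> {a, b, c, d}" using good x by (auto simp: w_def z_def)
  have g: "transpose a u \<circ> transpose w z \<in> H"
    using transposition_pair_conj_mem[OF x(1) h] by (simp only: x w_def z_def)
  have "transpose ((transpose a b \<circ> transpose c d) a) ((transpose a b \<circ> transpose c d) u) \<circ>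
      transpose ((transpose a b \<circ> transpose c d) w) ((transpose a b \<circ> transpose c d) z) \<in> H"
    by (rule transposition_pair_conj_mem[OF h g])
  moreover have "(transpose a b \<circ> transpose c d) a = b" using abcd(2) by simp
  moreover have "(transpose a b \<circ> transpose c d) y = y" if "y \<notin> {a, b, c, d}" for y using that by simp
  ultimately have hg: "transpose b u \<circ> transpose w z \<in> H" using wz ne by (simp del: comp_apply)
  have "(transpose b u \<circ> transpose w z) \<circ> (transpose w z \<circ> transpose a u) \<in> H"
    by (rule H_comp[OF hg transposition_pair_inverse_mem[OF g]])
  moreover have "(transpose b u \<circ> transpose w z) \<circ> (transpose w z \<circ> transpose a u) =
      transpose b u \<circ> (transpose w z \<circ> transpose w z) \<circ> transpose a u" by (simp only: comp_assoc)
  ultimately have "transpose b u \<circ> transpose a u \<in> H" by (simp only: transpose_comp_involutory comp_id)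
  hence "cyc3 b u a \<in> H" by (simp only: transpose_product_adjacent[OF ne(1)[symmetric] ne(2)[symmetric]])
  thus ?thesis by (intro has_cyc3I[of b u a]) (use ab ne abcd in auto)
qed

text \<open>Orbit-stabilizer three times; \<open>id\<close> and \<open>h\<close> in the last
  stabilizer supply the factor 2.\<close>

lemma card_ge_of_three_transitive:
  assumes three: three_transitive and n: "n \<ge> 4"
    and i: "{i1, i2, i3} \<subseteq> {1..n}" "distinct [i1, i2, i3]"
    and h: "h \<in> H" "h \<noteq> id" "h i1 = i1" "h i2 = i2" "h i3 = i3"
  shows "n * (n - 1) * (n - 2) * 2 \<le> card H"
proof -
  define E1 where "E1 = {x \<in> H. x i1 = i1}"
  define E2 where "E2 = {x \<in> E1. x i2 = i2}"
  define E3 where "E3 = {x \<in> E2. x i3 = i3}"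
  have i': "i1 \<in> {1..n}" "i2 \<in> {1..n}" "i3 \<in> {1..n}" using i by auto
  have move: "\<exists>k\<in>H. k p = p' \<and> k q = q' \<and> k r = r'"
    if "{p, q, r, p', q', r'} \<subseteq> {1..n}" "distinct [p, q, r]" "distinct [p', q', r']" for p q r p' q' r'
    by (rule three[unfolded three_transitive_def, rule_format]) (use that in auto)
  have other: "\<exists>q r. {q, r} \<subseteq> {1..n} \<and> distinct [p, q, r]" for p
  proof -
    obtain q r where "q \<in> {1..n} - {p}" "r \<in> {1..n} - {p}" "q \<noteq> r"
      using exists_two_outside[of "{1..n}" "{p}"] n by auto
    thus ?thesis by (intro exI[of _ q] exI[of _ r]) auto
  qed
  have 1: "card H = card {1..n} * card {x \<in> H. x i1 = i1}"
  proof (rule equidistribution[OF subset_refl _ _ _ i'(1)])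
    show "x i1 \<in> {1..n}" if "x \<in> H" for x by (rule H_apply[OF that i'(1)])
    show "\<exists>k\<in>H. (\<forall>x\<in>H. k \<circ> x \<in> H) \<and> k v = v'" if v: "v \<in> {1..n}" "v' \<in> {1..n}" for v v'
    proof -
      obtain q r where qr: "{q, r} \<subseteq> {1..n}" "distinct [v, q, r]" using other by blast
      obtain q' r' where qr': "{q', r'} \<subseteq> {1..n}" "distinct [v', q', r']" using other by blast
      have "\<exists>k\<in>H. k v = v' \<and> k q = q' \<and> k r = r'" by (rule move) (use v qr qr' in auto)
      thus ?thesis using H_comp by blast
    qed
  qed simp
  have 2: "card E1 = card ({1..n} - {i1}) * card {x \<in> E1. x i2 = i2}"
  proof (rule equidistribution)
    show "E1 \<subseteq> H" by (auto simp: E1_def)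
    show "x i2 \<in> {1..n} - {i1}" if "x \<in> E1" for x
      using that H_apply[of x i2] H_eq_iff[of x i2 i1] i i' by (auto simp: E1_def)
    show "\<exists>k\<in>H. (\<forall>x\<in>E1. k \<circ> x \<in> E1) \<and> k v = v'" if v: "v \<in> {1..n} - {i1}" "v' \<in> {1..n} - {i1}" for v v'
    proof -
      have "card {i1, v} + 2 \<le> card {1..n}" using card_length[of "[i1, v]"] n by simp
      then obtain q where q: "q \<in> {1..n} - {i1, v}"
        using exists_two_outside[of "{1..n}" "{i1, v}"] by auto
      have "card {i1, v'} + 2 \<le> card {1..n}" using card_length[of "[i1, v']"] n by simp
      then obtain q' where q': "q' \<in> {1..n} - {i1, v'}"
        using exists_two_outside[of "{1..n}" "{i1, v'}"] by auto
      have "\<exists>k\<in>H. k i1 = i1 \<and> k v = v' \<and> k q = q'" by (rule move) (use v q q' i' in auto)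
      then obtain k where k: "k \<in> H" "k i1 = i1" "k v = v'" by blast
      have "k \<circ> x \<in> E1" if "x \<in> E1" for x using that k H_comp[OF k(1)] by (auto simp: E1_def)
      thus ?thesis using k by blast
    qed
  qed (use i i' in auto)
  have 3: "card E2 = card ({1..n} - {i1, i2}) * card {x \<in> E2. x i3 = i3}"
  proof (rule equidistribution)
    show "E2 \<subseteq> H" by (auto simp: E1_def E2_def)
    show "x i3 \<in> {1..n} - {i1, i2}" if "x \<in> E2" for x
      using that H_apply[of x i3] H_eq_iff[of x i3 i1] H_eq_iff[of x i3 i2] i i'
      by (auto simp: E1_def E2_def)
    show "\<exists>k\<in>H. (\<forall>x\<in>E2. k \<circ> x \<in> E2) \<and> k v = v'"
      if v: "v \<in> {1..n} - {i1, i2}" "v' \<in> {1..n} - {i1, i2}" for v v'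
    proof -
      have "\<exists>k\<in>H. k i1 = i1 \<and> k i2 = i2 \<and> k v = v'" by (rule move) (use v i i' in auto)
      then obtain k where k: "k \<in> H" "k i1 = i1" "k i2 = i2" "k v = v'" by blast
      have "k \<circ> x \<in> E2" if "x \<in> E2" for x using that k H_comp[OF k(1)] by (auto simp: E1_def E2_def)
      thus ?thesis using k by blast
    qed
  qed (use i i' in auto)
  have "finite E3" using finite_H by (simp add: E1_def E2_def E3_def)
  moreover have "{id, h} \<subseteq> E3" using h H_id by (simp add: E1_def E2_def E3_def)
  ultimately have "card {id, h} \<le> card E3" by (rule card_mono)
  hence "2 \<le> card E3" using h(2) by simp
  moreover have "card H = n * ((n - 1) * ((n - 2) * card E3))"
  proof -
    have "card {1..n} = n" "card ({1..n} - {i1}) = n - 1" "card ({1..n} - {i1, i2}) = n - 2"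
      using i i' by (simp_all add: card_Diff_subset)
    thus ?thesis
      using 1 2 3 by (simp only: E1_def[symmetric] E2_def[symmetric] E3_def[symmetric])
  qed
  ultimately show ?thesis by simp
qed

theorem eq_alt_of_card:
  assumes c: "full_cycle n c" "c \<in> H" and n: "n \<ge> 5" "odd n"
    and big: "2 * card (alt n) < n * (n - 3) * card H"
  shows "H = alt n"
proof -
  have two: two_transitive by (rule two_transitive_of_card[OF c n big])
  have has_cyc3
  proof (rule ccontr)
    assume no3: "\<not> has_cyc3"
    have n2: "n \<ge> 2" using n by simp
    note cosets = transposition_cosets[OF n2 no3]
    show False
    proof (cases "n = 5")
      case True
      \<comment> \<open>Here \<open>n choose 2\<close> and \<open>n (n - 3)\<close> are both 10, and
        \<open>n div 2 = 2\<close>, so the coset bound contradicts \<open>big\<close>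
        directly.\<close>
      have "10 * card H \<le> 2 * card (alt n)" using cosets(1) by (simp add: True choose_two)
      moreover have "2 * card (alt n) < 10 * card H" using big by (simp add: True)
      ultimately show False by simp
    next
      case False
      have "n \<noteq> 6" using n(2) by auto
      hence n7: "n \<ge> 7" using n(1) False by simp
      have three: three_transitive by (rule three_transitive_of_card[OF two no3 n7 n(2) big])
      have "even (n * (n - 1))" using n by simp
      hence "2 * (n choose 2) = n * (n - 1)" unfolding choose_two by (rule dvd_mult_div_cancel)
      moreover have "n * (n - 3) * card H \<le> n * (n - 1) * card H" by (intro mult_le_mono) auto
      ultimately have "2 * card (alt n) < 2 * (n choose 2) * card H" using big by (simp only:)
      hence "card (alt n) < (n choose 2) * card H" by simp
      then obtain a b c d where abcd: "{a, b, c, d} \<subseteq> {1..n}" "distinct [a, b, c, d]"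
        "transpose a b \<circ> transpose c d \<in> H" using cosets(2) by blast
      show False
      proof (cases "n = 7")
        case True
        \<comment> \<open>Seven points are too few for the commutator argument. Instead the double
          transposition fixes the three remaining points, which forces
          \<open>card H \<ge> 420\<close>, while the coset bound with \<open>|A_7| = 2520\<close>
          allows at most 360.\<close>
        have "card ({1..n} - {a, b, c, d}) = 3"
          using abcd True by (simp add: card_Diff_subset)
        then obtain i1 i2 i3 where i: "{1..n} - {a, b, c, d} = {i1, i2, i3}" "distinct [i1, i2, i3]"
          by (auto simp: card_3_iff)
        have out: "i1 \<notin> {a, b, c, d}" "i2 \<notin> {a, b, c, d}" "i3 \<notin> {a, b, c, d}" using i(1) by blast+
        have "n * (n - 1) * (n - 2) * 2 \<le> card H"
        proof (rule card_ge_of_three_transitive[OF three _ _ i(2) abcd(3)])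
          show "n \<ge> 4" using True by simp
          show "{i1, i2, i3} \<subseteq> {1..n}" using i(1) by blast
          have "(transpose a b \<circ> transpose c d) a = b" using abcd(2) by simp
          thus "transpose a b \<circ> transpose c d \<noteq> id" using abcd(2) by (metis distinct_length_2_or_more id_apply)
          show "(transpose a b \<circ> transpose c d) i1 = i1" "(transpose a b \<circ> transpose c d) i2 = i2"
            "(transpose a b \<circ> transpose c d) i3 = i3" using out by simp_all
        qed
        hence "420 \<le> card H" by (simp add: True)
        moreover have "21 * card H \<le> 3 * card (alt n)" using cosets(1) by (simp add: True choose_two)
        moreover have "2 * card (alt n) = 5040"
          using alt_group_card_carrier[of n] by (simp add: True fact_numeral)
        ultimately show False by linarith
      next
        case False
        have "n \<noteq> 8" using n(2) by auto
        hence "n \<ge> 9" using n7 False by simp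
        thus False using has_cyc3_of_three_transitive[OF three _ abcd] no3 by blast
      qed
    qed
  qed
  thus ?thesis by (rule eq_alt_of_cyc3[OF two])
qed

end

section \<open>Uniformity in the degree\<close>

text \<open>Every entry of the list is moved by \<open>c\<close>, whereas elements of A_n fix all
  numbers outside \<open>{1..n}\<close>; so the \<open>n\<close> entries are exactly
  \<open>{1..n}\<close>.\<close>

lemma full_cycle_of_cycle:
  assumes c: "c \<in> alt n" "is_cycle_of_length n c" and n: "n \<ge> 2"
  shows "full_cycle n c"
proof -
  obtain cs where cs: "distinct cs" "length cs = n" "c = cycle_of_list cs"
    using c(2) by (auto simp: is_cycle_of_length_def)
  have rot: "map (c ^^ k) cs = rotate k cs" for k using cyclic_rotation[OF cs(1)] cs(3) by simp
  have nth: "(c ^^ k) (cs ! a) = cs ! ((k + a) mod n)" if "a < n" for a k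
    using arg_cong[OF rot[of k], of "\<lambda>l. l ! a"] that cs(2) by (simp add: nth_rotate)
  have "set cs \<subseteq> {1..n}"
  proof
    fix x assume "x \<in> set cs"
    then obtain a where a: "a < n" "cs ! a = x" using cs(2) by (auto simp: in_set_conv_nth)
    have "(1 + a) mod n \<noteq> a" using a n by (cases "1 + a = n") auto
    moreover have "(1 + a) mod n < n" using n by simp
    ultimately have "cs ! ((1 + a) mod n) \<noteq> cs ! a"
      using nth_eq_iff_index_eq[OF cs(1)] a(1) cs(2) by metis
    hence "c x \<noteq> x" using nth[of a 1] a by simp
    thus "x \<in> {1..n}" using c(1) unfolding alt_group_carrier by (meson permutes_not_in)
  qed
  hence set_cs: "set cs = {1..n}"
    using card_subset_eq[of "{1..n}" "set cs"] distinct_card[OF cs(1)] cs(2) by simp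
  have "\<exists>k. (c ^^ k) 1 = i" if i: "i \<in> {1..n}" for i
  proof -
    obtain a b where ab: "a < n" "cs ! a = 1" "b < n" "cs ! b = i"
      using i set_cs cs(2) n by (metis atLeastAtMost_iff in_set_conv_nth le_refl order_trans one_le_numeral)
    have "(n - a + b + a) mod n = b" using ab by simp
    hence "(c ^^ (n - a + b)) 1 = i" using nth[OF ab(1), of "n - a + b"] ab by simp
    thus ?thesis by blast
  qed
  moreover have "c ^^ n = id" using cycle_is_id_root[OF cs(1)] cs by simp
  ultimately show ?thesis using c(1) by (simp add: full_cycle_def)
qed

lemma prods_funpow: "c \<in> B \<Longrightarrow> c ^^ k \<in> prods n B k"
proof (induction k)
  case 0 thus ?case by (simp only: funpow.simps prods_0)
next
  case (Suc k)
  hence "c \<circ> c ^^ k \<in> prods n B (1 + k)" by (intro prods_mult prods_1)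
  thus ?case by (simp only: funpow.simps plus_1_eq_Suc)
qed

text \<open>The whole group absorbs further factors. This permits a single exponent for all
  degrees.\<close>

lemma prods_extend:
  assumes "prods n B k = alt n" "B \<subseteq> alt n" "B \<noteq> {}"
  shows "prods n B (k + m) = alt n"
proof (induction m)
  case 0 thus ?case using assms(1) by simp
next
  case (Suc m)
  obtain b where b: "b \<in> B" using assms(3) by blast
  show ?case
  proof
    show "prods n B (k + Suc m) \<subseteq> alt n" by (rule prods_subset[OF assms(2)])
    show "alt n \<subseteq> prods n B (k + Suc m)"
    proof
      fix x assume x: "x \<in> alt n"
      have b_alt: "b \<in> alt n" using b assms(2) by blast
      have "inv' b \<circ> x \<in> prods n B (k + m)"
        unfolding Suc by (rule alt.comp_G[OF alt.inv_G[OF b_alt] x])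
      from prods_mult[OF prods_1[OF b] this]
      have "b \<circ> (inv' b \<circ> x) \<in> prods n B (1 + (k + m))" .
      thus "x \<in> prods n B (k + Suc m)" unfolding alt.inv_comp_cancel(2)[OF b_alt] by simp
    qed
  qed
qed

text \<open>Even powers of \<open>B\<close> increase because \<open>c \<circ> inv' c = id\<close>
  pads a product by two factors; by finiteness, covering the group by their union means covering it
  by one of them.\<close>

lemma exists_covering_exponent:
  assumes c: "full_cycle n c" "c \<in> S" and n: "n \<ge> 5" "odd n" and S: "S \<subseteq> alt n"
    and big: "2 * card (alt n) < n * (n - 3) * card S"
  shows "\<exists>k. prods n (S \<union> inv' ` S) k = alt n"
proof -
  define B where "B = S \<union> inv' ` S"
  have B: "B \<subseteq> alt n" "\<And>b. b \<in> B \<Longrightarrow> inv' b \<in> B"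
    using S alt.inv_G alt.inv_inv by (auto simp: B_def)
  have cB: "c \<in> B" "S \<subseteq> B" using c(2) by (auto simp: B_def)
  define H where "H = (\<Union>j. prods n B (2 * j))"
  have "c \<circ> inv' c \<in> prods n B (1 + 1)" by (intro prods_mult prods_1 cB B)
  hence id2: "id \<in> prods n B 2" using alt.inv_comp(2)[of c n] cB B by (simp add: subset_iff numeral_2_eq_2)
  have id_even: "id \<in> prods n B (2 * d)" for d
  proof (induction d)
    case 0 thus ?case using prods_0[of n B] by (simp only: mult_0_right)
  next
    case (Suc d)
    from prods_mult[OF id2 this] have "id \<circ> id \<in> prods n B (2 + 2 * d)" .
    thus ?case by (simp only: id_comp mult_Suc_right)
  qed
  have incr: "prods n B (2 * i) \<subseteq> prods n B (2 * j)" if "i \<le> j" for i j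
  proof
    fix x assume "x \<in> prods n B (2 * i)"
    from prods_mult[OF this id_even] have "x \<circ> id \<in> prods n B (2 * i + 2 * (j - i))" .
    moreover have "2 * i + 2 * (j - i) = 2 * j" using that by simp
    ultimately show "x \<in> prods n B (2 * j)" by (simp only: comp_id)
  qed
  have SH: "S \<subseteq> H"
  proof
    fix s assume "s \<in> S"
    \<comment> \<open>Appending \<open>c ^^ n = id\<close> gives \<open>s\<close> the length
      \<open>1 + n\<close>, which is even because \<open>n\<close> is odd.\<close>
    hence "s \<circ> c ^^ n \<in> prods n B (1 + n)"
      using cB by (intro prods_mult prods_1 prods_funpow) auto
    moreover have "s \<circ> c ^^ n = s" using c(1) unfolding full_cycle_def by (simp only: comp_id)
    ultimately have "s \<in> prods n B (1 + n)" by (simp only:)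
    moreover have "even (1 + n)" using n(2) by simp
    then obtain j where "1 + n = 2 * j" by (rule evenE)
    ultimately show "s \<in> H" unfolding H_def by auto
  qed
  interpret alt_subgroup n H
  proof
    show "H \<subseteq> alt n" unfolding H_def using prods_subset[OF B(1)] by blast
    show "id \<in> H" unfolding H_def using id2 by (auto intro!: exI[of _ 1])
    show "inv' x \<in> H" if "x \<in> H" for x
      using that prods_inv[OF B] unfolding H_def by blast
    show "x \<circ> y \<in> H" if xy: "x \<in> H" "y \<in> H" for x y
    proof -
      obtain i j where "x \<in> prods n B (2 * i)" "y \<in> prods n B (2 * j)"
        using xy unfolding H_def by blast
      from prods_mult[OF this] have "x \<circ> y \<in> prods n B (2 * (i + j))" by (simp only: distrib_left)
      thus ?thesis unfolding H_def by blast
    qed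
  qed
  have "card S \<le> card H" by (rule card_mono[OF finite_H SH])
  hence "n * (n - 3) * card S \<le> n * (n - 3) * card H" by simp
  hence "2 * card (alt n) < n * (n - 3) * card H" using big by linarith
  hence H: "H = alt n" by (intro eq_alt_of_card[OF c(1) _ n]) (use SH c(2) in blast)
  have "\<forall>x\<in>alt n. \<exists>j. x \<in> prods n B (2 * j)" using H by (auto simp: H_def)
  then obtain j where j: "\<And>x. x \<in> alt n \<Longrightarrow> x \<in> prods n B (2 * j x)" by metis
  have "x \<in> prods n B (2 * (\<Sum>y\<in>alt n. j y))" if "x \<in> alt n" for x
    using incr[of "j x"] member_le_sum[OF that _ alt.finite_G, of j] j[OF that] by auto
  hence "prods n B (2 * (\<Sum>y\<in>alt n. j y)) = alt n" using prods_subset[OF B(1)] by blast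
  thus ?thesis unfolding B_def by blast
qed

text \<open>With \<open>r \<ge> (n - 3) / 2\<close> the claim reduces to
  \<open>n^2 - 16 n + 30 \<ge> 0\<close>, which holds from 14 on.\<close>

lemma exists_odd_near_half:
  assumes n: "odd n" "n \<ge> 14"
  shows "\<exists>r. odd r \<and> 5 \<le> r \<and> 2 * r \<le> n \<and> (real n)\<^sup>2 / 16 \<le> real (r choose 2)"
proof -
  obtain k where k: "n = 2 * k + 1" using n(1) by (auto elim: oddE)
  define r where "r = (if odd k then k else k - 1)"
  have r: "odd r" "5 \<le> r" "2 * r \<le> n" "n \<le> 2 * r + 3" using k n by (auto simp: r_def)
  have nr: "real n \<ge> 14" "real n \<le> 2 * real r + 3" using n r by linarith+
  have "real (r choose 2) = real r * (real r - 1) / 2"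
    using r(2) by (simp add: choose_two real_of_nat_div of_nat_diff)
  moreover have "(real n - 3) / 2 * ((real n - 5) / 2) \<le> real r * (real r - 1)"
    using nr by (intro mult_mono) auto
  moreover have "14 * (real n - 14) \<le> real n * (real n - 14)" using nr by (intro mult_right_mono) auto
  moreover have "(real n - 3) / 2 * ((real n - 5) / 2) = (real n * real n - 8 * real n + 15) / 4"
    by (simp add: field_simps)
  moreover have "real n * (real n - 14) = real n * real n - 14 * real n" by (simp add: algebra_simps)
  ultimately have "(real n)\<^sup>2 / 16 \<le> real (r choose 2)"
    unfolding power2_eq_square using nr by argo
  thus ?thesis using r by blast
qed

text \<open>With \<open>m = n (n - 3) / 2\<close> the contraction factor is at most
  \<open>8 m powr (- \<alpha>)\<close>; the 8 compares \<open>m\<close> with the lower bound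
  \<open>n^2 / 16\<close> for the number of translates. Since \<open>\<alpha> * j \<ge> 2\<close>,
  the \<open>j\<close>-th power is at most \<open>8 ^ j / m^2\<close>. One factor \<open>m\<close>
  is spent on \<open>g / s \<le> m\<close>, and the other outweighs
  \<open>20 * 8 ^ j\<close>.\<close>

lemma large_degree_exponent:
  assumes c: "full_cycle n c" "c \<in> S" and n: "n \<ge> 2 ^ 20" "odd n" and S: "S \<subseteq> alt n"
    and \<alpha>: "\<alpha> > 0" and j: "\<alpha> * real j \<ge> 2" and nj: "20 * 8 ^ j \<le> n"
    and big: "real (card S) \<ge> (1 / (1/2 * real n * (real n - 3))) powr (1 - \<alpha>) * real (card (alt n))"
  shows "prods n (S \<union> inv' ` S) (8 * (2 * j + 3)) = alt n"
proof -
  have n14: "n \<ge> 14" using n(1) by simp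
  obtain r where r: "odd r" "5 \<le> r" "2 * r \<le> n" and r2: "(real n)\<^sup>2 / 16 \<le> real (r choose 2)"
    using exists_odd_near_half[OF n(2) n14] by blast
  define m where "m = 1/2 * real n * (real n - 3)"
  define g where "g = real (card (alt n))"
  define s where "s = real (card S)"
  define M where "M = real (r choose 2)"
  have "real n * 1 \<le> real n * ((real n - 3) / 2)" using n14 by (intro mult_left_mono) auto
  hence mn: "m \<ge> real n" by (simp add: m_def)
  hence m: "m \<ge> 1" using n14 by simp
  have "m / 8 \<le> (real n)\<^sup>2 / 16" by (simp add: m_def power2_eq_square algebra_simps)
  hence M: "m / 8 \<le> M" using r2 by (simp add: M_def)
  have g: "g > 0" using alt.card_G_pos by (simp add: g_def)
  have s: "s > 0" using c(2) S finite_subset[OF S alt.finite_G] by (auto simp: s_def card_gt_0_iff)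
  have "g * (1 / m) powr (1 - \<alpha>) \<le> s" using big by (simp add: g_def s_def m_def mult.commute)
  hence "g / m powr (1 - \<alpha>) \<le> s" using m by (simp add: powr_divide)
  hence t: "g / s \<le> m powr (1 - \<alpha>)" using s m by (simp add: field_simps)
  have "m powr (1 - \<alpha>) \<le> m powr 1" using m \<alpha> by (intro powr_mono) auto
  hence tm: "g / s \<le> m" using t m by simp
  have "g / (M * s) = (g / s) / M" by simp
  also have "\<dots> \<le> m powr (1 - \<alpha>) / (m / 8)" using t M m g s by (intro frac_le) auto
  also have "\<dots> = 8 * m powr (- \<alpha>)" using m by (simp add: powr_diff powr_minus field_simps)
  finally have "(g / (M * s)) ^ j \<le> (8 * m powr (- \<alpha>)) ^ j"
    using g s M m by (intro power_mono) auto
  also have "\<dots> = 8 ^ j * m powr (- (\<alpha> * real j))"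
    using m by (simp add: power_mult_distrib powr_power mult.commute)
  also have "\<dots> \<le> 8 ^ j * m powr (- 2)" using m j by (intro mult_left_mono powr_mono) auto
  also have "\<dots> = 8 ^ j / m\<^sup>2" using m by (simp add: powr_minus powr_numeral divide_inverse)
  finally have X: "(g / (M * s)) ^ j \<le> 8 ^ j / m\<^sup>2" .
  have "20 * g * ((g / (M * s)) ^ j / s) = 20 * ((g / s) * (g / (M * s)) ^ j)" by simp
  also have "(g / s) * (g / (M * s)) ^ j \<le> m * (8 ^ j / m\<^sup>2)"
    using tm X g s m M by (intro mult_mono) auto
  also have "20 * (m * (8 ^ j / m\<^sup>2)) = 20 * 8 ^ j / m" using m by (simp add: power2_eq_square)
  also have "20 * 8 ^ j / m \<le> 1"
  proof -
    have "real (20 * 8 ^ j) \<le> real n" using nj by (simp only: of_nat_le_iff)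
    thus ?thesis using mn m by simp
  qed
  finally have bound: "20 * g * ((g / (M * s)) ^ j / s) \<le> 1" by simp
  show ?thesis
    by (rule large_degree_cover[OF c(1) n(1) r r2 S c(2)])
      (use bound in \<open>simp only: g_def M_def s_def\<close>)
qed

text \<open>Positivity of \<alpha> turns the hypothesis into a strict inequality, on which the coset
  counts depend.\<close>

lemma card_bound_of_powr_bound:
  assumes n: "n \<ge> 5" and \<alpha>: "\<alpha> > 0"
    and big: "real (card S) \<ge> (1 / (1/2 * real n * (real n - 3))) powr (1 - \<alpha>) * real (card (alt n))"
  shows "2 * card (alt n) < n * (n - 3) * card S"
proof -
  define m where "m = 1/2 * real n * (real n - 3)"
  have "5 * 2 \<le> real n * (real n - 3)" using n by (intro mult_mono) auto
  hence m: "m > 1" by (simp add: m_def)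
  have g: "real (card (alt n)) > 0" using alt.card_G_pos by simp
  have "1 / m = (1 / m) powr 1" using m by simp
  also have "\<dots> < (1 / m) powr (1 - \<alpha>)" using m \<alpha> by (intro powr_less_mono') auto
  finally have "1 / m * real (card (alt n)) < real (card S)"
    using big g unfolding m_def[symmetric] by (smt (verit) mult_strict_right_mono)
  hence "real (card (alt n)) < m * real (card S)" using m by (simp add: field_simps)
  hence "2 * real (card (alt n)) < real n * (real n - 3) * real (card S)" by (simp add: m_def)
  hence "real (2 * card (alt n)) < real (n * (n - 3) * card S)" using n by (simp add: of_nat_diff)
  thus ?thesis by (simp only: of_nat_less_iff)
qed

theorem proposition1p10:
  shows "\<forall>\<alpha>::real. \<alpha> > 0 \<longrightarrow> (\<exists>k::nat. k > 0 \<and>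
    (\<forall>(n::nat) (C :: (nat \<Rightarrow> nat) set) (S :: (nat \<Rightarrow> nat) set).
       n \<ge> 5 \<longrightarrow> odd n \<longrightarrow>
       C \<in> conjugacy_classes (alt_group n) \<longrightarrow> (\<forall>c\<in>C. is_cycle_of_length n c) \<longrightarrow>
       S \<subseteq> carrier (alt_group n) \<longrightarrow> S \<inter> C \<noteq> {} \<longrightarrow>
       real (card S) \<ge> (1 / (1/2 * real n * (real n - 3))) powr (1 - \<alpha>)
                         * real (order (alt_group n)) \<longrightarrow>
       carrier (alt_group n) =
         set_power (alt_group n) (S \<union> set_inv\<^bsub>alt_group n\<^esub> S) k))"
proof (intro allI impI)
  fix \<alpha> :: real assume \<alpha>: "\<alpha> > 0"
  define j where "j = nat \<lceil>2 / \<alpha>\<rceil>"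
  have "2 / \<alpha> \<le> real j" unfolding j_def by linarith
  hence j: "\<alpha> * real j \<ge> 2" using \<alpha> by (simp add: field_simps)
  define N :: nat where "N = max (2 ^ 20) (20 * 8 ^ j)"
  define covers where "covers n S k \<longleftrightarrow> prods n (S \<union> inv' ` S) k = alt n" for n S k
  define small where "small = (SIGMA n:{..<N}. {S. S \<subseteq> alt n})"
  have finite_small: "finite small"
    unfolding small_def by (intro finite_SigmaI) (use alt.finite_G in \<open>auto simp: Pow_def[symmetric]\<close>)
  \<comment> \<open>For pairs that no power covers, \<open>e\<close> is an arbitrary number. It
    enters the finite sum in \<open>K\<close> all the same, which does no harm since
    \<open>K\<close> may be enlarged.\<close>
  define e where "e n S = (SOME k. covers n S k)" for n S
  define K where "K = 8 * (2 * j + 3) + (\<Sum>(n, S)\<in>small. e n S)"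
  show "\<exists>k::nat. k > 0 \<and>
    (\<forall>(n::nat) (C :: (nat \<Rightarrow> nat) set) (S :: (nat \<Rightarrow> nat) set).
       n \<ge> 5 \<longrightarrow> odd n \<longrightarrow>
       C \<in> conjugacy_classes (alt_group n) \<longrightarrow> (\<forall>c\<in>C. is_cycle_of_length n c) \<longrightarrow>
       S \<subseteq> carrier (alt_group n) \<longrightarrow> S \<inter> C \<noteq> {} \<longrightarrow>
       real (card S) \<ge> (1 / (1/2 * real n * (real n - 3))) powr (1 - \<alpha>)
                         * real (order (alt_group n)) \<longrightarrow>
       carrier (alt_group n) =
         set_power (alt_group n) (S \<union> set_inv\<^bsub>alt_group n\<^esub> S) k)"
  proof (intro exI[of _ K] conjI allI impI)
    show "K > 0" by (simp add: K_def)
    fix n :: nat and C S :: "(nat \<Rightarrow> nat) set"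
    assume n: "n \<ge> 5" "odd n" and C: "\<forall>c\<in>C. is_cycle_of_length n c"
      and S: "S \<subseteq> alt n" "S \<inter> C \<noteq> {}"
      and "real (card S) \<ge> (1 / (1/2 * real n * (real n - 3))) powr (1 - \<alpha>) * real (order (alt_group n))"
    hence big: "real (card S) \<ge> (1 / (1/2 * real n * (real n - 3))) powr (1 - \<alpha>) * real (card (alt n))"
      by (simp only: order_def)
    obtain c where c: "c \<in> S" "c \<in> C" using S(2) by blast
    have fc: "full_cycle n c" by (rule full_cycle_of_cycle) (use c S C n in auto)
    have B: "S \<union> inv' ` S \<subseteq> alt n" "S \<union> inv' ` S \<noteq> {}" using S c alt.inv_G by auto
    have "\<exists>k\<le>K. covers n S k"
    proof (cases "n < N")
      case True
      have "\<exists>k. covers n S k"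
        unfolding covers_def
        by (rule exists_covering_exponent[OF fc c(1) n S(1) card_bound_of_powr_bound[OF n(1) \<alpha> big]])
      hence "covers n S (e n S)" unfolding e_def by (rule someI_ex)
      moreover have "(n, S) \<in> small" using True S(1) by (simp add: small_def)
      hence "(\<lambda>(n, S). e n S) (n, S) \<le> (\<Sum>(n, S)\<in>small. e n S)"
        by (intro member_le_sum finite_small) auto
      hence "e n S \<le> K" by (simp add: K_def)
      ultimately show ?thesis by blast
    next
      case False
      hence "2 ^ 20 \<le> n" "20 * 8 ^ j \<le> n" by (auto simp: N_def)
      hence "covers n S (8 * (2 * j + 3))"
        unfolding covers_def by (intro large_degree_exponent[OF fc c(1) _ n(2) S(1) \<alpha> j _ big])
      thus ?thesis by (intro exI[of _ "8 * (2 * j + 3)"]) (simp add: K_def)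
    qed
    then obtain k where "k \<le> K" "prods n (S \<union> inv' ` S) k = alt n" by (auto simp: covers_def)
    hence "prods n (S \<union> inv' ` S) K = alt n"
      using prods_extend[OF _ B, of k "K - k"] by simp
    moreover have "set_inv\<^bsub>alt_group n\<^esub> S = inv' ` S"
      unfolding SET_INV_def using S(1) by (auto simp: alt_group_inv_equality subset_iff)
    ultimately show "alt n = set_power (alt_group n) (S \<union> set_inv\<^bsub>alt_group n\<^esub> S) K" by simp
  qed
qed

end
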